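(* There is a linear-time algorithm which, given a di-tree $T$, computes a metric basis of $T$ (and hence the metric dimension of $T$).
   Context: A digraph has no loops; it may contain directed 2-cycles (pairs of opposite arcs $\overrightarrow{uv},\overrightarrow{vu}$). Its underlying graph is the simple undirected graph obtained by ignoring arc orientations and merging multiple edges. A di-tree is a digraph whose underlying graph is a tree. For vertices $x,y$ of a digraph, $\mathrm{dist}(x,y)$ is the length of a shortest directed path from $x$ to $y$, and $\mathrm{dist}(x,y)=\infty$ if no such path exists ($y$ is then not reachable from $x$). A set $S$ of vertices of a digraph $G$ is a resolving set if (1) for every pair of distinct vertices $v,w$ of $G$ there is $x\in S$ with $\mathrm{dist}(x,v)\neq\mathrm{dist}(x,w)$, and (2) every vertex of $G$ is reachable from at least one vertex of $S$ (a vertex is reachable from itself). The metric dimension of $G$ is the minimum size of a resolving set, and a resolving set of minimum size is a metric basis. Linear time means time linear in the number of vertices plus arcs. *)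

theory Defs
  imports "Graph_Theory.Graph_Theory" "HOL-Library.Extended_Nat"
begin

section \<open>Metric dimension of digraphs\<close>

definition di_dist :: "('a, 'b) pre_digraph \<Rightarrow> 'a \<Rightarrow> 'a \<Rightarrow> enat" where
  "di_dist G x y = (INF p \<in> {p. pre_digraph.apath G x p y}. enat (length p))"

definition resolving_set :: "('a, 'b) pre_digraph \<Rightarrow> 'a set \<Rightarrow> bool" where
  "resolving_set G S \<longleftrightarrow> S \<subseteq> verts G \<and>
     (\<forall>v \<in> verts G. \<forall>w \<in> verts G. v \<noteq> w \<longrightarrow> (\<exists>x \<in> S. di_dist G x v \<noteq> di_dist G x w)) \<and>
     (\<forall>v \<in> verts G. \<exists>x \<in> S. x \<rightarrow>\<^sup>*\<^bsub>G\<^esub> v)"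

definition metric_dimension :: "('a, 'b) pre_digraph \<Rightarrow> nat" where
  "metric_dimension G = (LEAST k. \<exists>S. resolving_set G S \<and> card S = k)"

definition metric_basis :: "('a, 'b) pre_digraph \<Rightarrow> 'a set \<Rightarrow> bool" where
  "metric_basis G S \<longleftrightarrow> resolving_set G S \<and> (\<forall>S'. resolving_set G S' \<longrightarrow> card S \<le> card S')"

text \<open>
  The symmetric closure \<^const>\<open>mk_symmetric\<close> represents the underlying simple graph. Every edge
  gives a directed cycle of length 2 in it, so the library predicate \<^const>\<open>tree\<close> fails as soon
  as there is an arc; cycles of the underlying graph are the directed cycles of length at least 3.
\<close>

definition di_tree :: "('a, 'b) pre_digraph \<Rightarrow> bool" where
  "di_tree G \<longleftrightarrow> digraph G \<and> connected G \<and>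
     \<not> (\<exists>p. pre_digraph.cycle (with_proj (mk_symmetric G)) p \<and> length p \<ge> 3)"


section \<open>A random access machine with bounded words\<close>

text \<open>
  Programs are written in a structured language over scalar registers and arrays with constant-time
  random access; both are indexed by the natural numbers, and a program mentions only finitely many
  of them. Each executed command and each evaluated test costs one time unit: the size of an
  expression is a constant of the program, so this is the usual uniform cost up to a constant factor.

  To prevent large numbers from being used for hidden parallelism, a word holds only the numbers up
  to a capacity \<open>W\<close>. A command that would produce a larger value, also as an intermediate
  result or an array index, has no execution.
\<close>

datatype exp = N nat | V nat | Get nat exp | Plus exp exp | Minus exp exp

datatype test = Less exp exp | Eq exp exp | Neg test | Conj test test

datatype com =
    Skip
  | Assign nat exp
  | Store nat exp exp
  | Seq com com
  | Ite test com com
  | While test com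

record state =
  reg :: "nat \<Rightarrow> nat"
  arr :: "nat \<Rightarrow> nat \<Rightarrow> nat"

fun aval :: "state \<Rightarrow> exp \<Rightarrow> nat" where
  "aval s (N k) = k"
| "aval s (V x) = reg s x"
| "aval s (Get a e) = arr s a (aval s e)"
| "aval s (Plus e f) = aval s e + aval s f"
| "aval s (Minus e f) = aval s e - aval s f"

fun tval :: "state \<Rightarrow> test \<Rightarrow> bool" where
  "tval s (Less e f) = (aval s e < aval s f)"
| "tval s (Eq e f) = (aval s e = aval s f)"
| "tval s (Neg b) = (\<not> tval s b)"
| "tval s (Conj b c) = (tval s b \<and> tval s c)"

fun exp_ok :: "nat \<Rightarrow> state \<Rightarrow> exp \<Rightarrow> bool" where
  "exp_ok W s (N k) = (k \<le> W)"
| "exp_ok W s (V x) = (reg s x \<le> W)"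
| "exp_ok W s (Get a e) = (exp_ok W s e \<and> aval s (Get a e) \<le> W)"
| "exp_ok W s (Plus e f) = (exp_ok W s e \<and> exp_ok W s f \<and> aval s (Plus e f) \<le> W)"
| "exp_ok W s (Minus e f) = (exp_ok W s e \<and> exp_ok W s f)"

fun test_ok :: "nat \<Rightarrow> state \<Rightarrow> test \<Rightarrow> bool" where
  "test_ok W s (Less e f) = (exp_ok W s e \<and> exp_ok W s f)"
| "test_ok W s (Eq e f) = (exp_ok W s e \<and> exp_ok W s f)"
| "test_ok W s (Neg b) = test_ok W s b"
| "test_ok W s (Conj b c) = (test_ok W s b \<and> test_ok W s c)"

definition set_reg :: "nat \<Rightarrow> nat \<Rightarrow> state \<Rightarrow> state" where
  "set_reg x v s = s\<lparr>reg := (reg s)(x := v)\<rparr>"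

definition set_arr :: "nat \<Rightarrow> nat \<Rightarrow> nat \<Rightarrow> state \<Rightarrow> state" where
  "set_arr a i v s = s\<lparr>arr := (arr s)(a := (arr s a)(i := v))\<rparr>"

text \<open>
  \<open>exec W c s t s'\<close>: on words of capacity \<open>W\<close>, command \<open>c\<close> started in
  state \<open>s\<close> halts after \<open>t\<close> time units in state \<open>s'\<close>.
\<close>

inductive exec :: "nat \<Rightarrow> com \<Rightarrow> state \<Rightarrow> nat \<Rightarrow> state \<Rightarrow> bool" for W where
  Skip: "exec W Skip s 1 s"
| Assign: "exp_ok W s e \<Longrightarrow> exec W (Assign x e) s 1 (set_reg x (aval s e) s)"
| Store: "exp_ok W s i \<Longrightarrow> exp_ok W s e \<Longrightarrow>
    exec W (Store a i e) s 1 (set_arr a (aval s i) (aval s e) s)"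
| Seq: "exec W c1 s1 t1 s2 \<Longrightarrow> exec W c2 s2 t2 s3 \<Longrightarrow> exec W (Seq c1 c2) s1 (t1 + t2) s3"
| IteTrue: "test_ok W s b \<Longrightarrow> tval s b \<Longrightarrow> exec W c1 s t s' \<Longrightarrow> exec W (Ite b c1 c2) s (1 + t) s'"
| IteFalse: "test_ok W s b \<Longrightarrow> \<not> tval s b \<Longrightarrow> exec W c2 s t s' \<Longrightarrow> exec W (Ite b c1 c2) s (1 + t) s'"
| WhileFalse: "test_ok W s b \<Longrightarrow> \<not> tval s b \<Longrightarrow> exec W (While b c) s 1 s"
| WhileTrue: "test_ok W s1 b \<Longrightarrow> tval s1 b \<Longrightarrow> exec W c s1 t1 s2 \<Longrightarrow> exec W (While b c) s2 t2 s3 \<Longrightarrow>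
    exec W (While b c) s1 (1 + t1 + t2) s3"

lemma exec_deterministic:
  "exec W c s t s' \<Longrightarrow> exec W c s u s'' \<Longrightarrow> u = t \<and> s'' = s'"
proof (induction arbitrary: u s'' rule: exec.induct)
  case Skip from Skip.prems show ?case by cases auto
next
  case Assign from Assign.prems show ?case by cases auto
next
  case Store from Store.prems show ?case by cases auto
next
  case (Seq c1 s1 t1 s2 c2 t2 s3)
  from Seq.prems obtain u1 v u2 where "u = u1 + u2" "exec W c1 s1 u1 v" "exec W c2 v u2 s''"
    by cases auto
  with Seq.IH(1)[of u1 v] Seq.IH(2)[of u2 s''] show ?case by auto
next
  case (IteTrue s b c1 t s' c2)
  from IteTrue.prems IteTrue.hyps obtain u1 where "u = 1 + u1" "exec W c1 s u1 s''"
    by cases auto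
  with IteTrue.IH[of u1 s''] show ?case by auto
next
  case (IteFalse s b c2 t s' c1)
  from IteFalse.prems IteFalse.hyps obtain u1 where "u = 1 + u1" "exec W c2 s u1 s''"
    by cases auto
  with IteFalse.IH[of u1 s''] show ?case by auto
next
  case WhileFalse from WhileFalse.prems WhileFalse.hyps show ?case by cases auto
next
  case (WhileTrue s1 b c t1 s2 t2 s3)
  from WhileTrue.prems WhileTrue.hyps(1,2) obtain u1 v u2
    where "u = 1 + u1 + u2" "exec W c s1 u1 v" "exec W (While b c) v u2 s''"
    by cases auto
  with WhileTrue.IH(1)[of u1 v] WhileTrue.IH(2)[of u2 s''] show ?case by auto
qed


section \<open>Input and output\<close>

text \<open>
  The input is a digraph on the vertices \<open>0, \<dots>, n - 1\<close>, presented by \<open>n\<close> and a list of its arcs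
  in arbitrary order: register 0 holds \<open>n\<close>, register 1 the number of arcs, and arrays 0 and 1 hold
  the tails and heads of the arcs. All other registers and array cells are 0.

  On halting, register 0 holds the number of vertices in the answer, and the vertices
  themselves are listed at the beginning of array 0.
\<close>

definition digraph_of :: "nat \<Rightarrow> (nat \<times> nat) list \<Rightarrow> (nat, nat \<times> nat) pre_digraph" where
  "digraph_of n es = \<lparr>verts = {..<n}, arcs = set es, tail = fst, head = snd\<rparr>"

definition input_state :: "nat \<Rightarrow> (nat \<times> nat) list \<Rightarrow> state" where
  "input_state n es = \<lparr>
     reg = (\<lambda>x. if x = 0 then n else if x = 1 then length es else 0),
     arr = (\<lambda>a i. if i < length es
              then (if a = 0 then fst (es ! i) else if a = 1 then snd (es ! i) else 0)
              else 0)\<rparr>"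

definition output_list :: "state \<Rightarrow> nat list" where
  "output_list s = map (arr s 0) [0..<reg s 0]"

end

theory Submission
  imports Defs
begin

text \<open>
  In a di-tree, two vertices at equal distance from a vertex that reaches both are unresolved by \<open>S\<close>
  only if the paths to them branch at some \<open>z\<close> into out-neighbours \<open>a\<close> and \<open>b\<close> of which neither is
  reached by \<open>S\<close> without passing through \<open>z\<close>. Hence \<open>S\<close> is resolving iff it reaches every vertex and, for
  every \<open>z\<close>, at most one out-neighbour of \<open>z\<close> is not reached by \<open>S\<close> in the digraph without \<open>z\<close>.

  This condition is local, so it can be tested by removing leaves one at a time: three bits per
  remaining vertex describe the influence of \<open>S\<close> on the part already merged into it. Minimising the
  size of \<open>S\<close> over these labels is a dynamic program with constant work per removed leaf, and
  backtracking along the removals recovers an optimal \<open>S\<close>. Leaves are found by maintaining, for every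
  vertex, the number and the sum of its remaining out- and in-neighbours.
\<close>

section \<open>Trees\<close>

text \<open>Opposite arcs and unreachable vertices make directed distances look irregular. However,
  a directed walk cannot avoid the path of the underlying tree, so wherever \<open>y\<close> is
  reachable from \<open>x\<close>, the distance is the tree distance
  (\<open>rtrancl_relpow\<close>). All distances are therefore compared in one symmetric metric, and
  orientation only decides reachability. Both conditions on \<open>S\<close> then become statements
  about what \<open>S\<close> reaches after one vertex is deleted. A merged part takes part in such
  a statement only through the single edge to its neighbour, which is why three bits are enough.
  With eight labels, all cases of \<open>join\<close> can be written out in the program text, so
  that merging a leaf is loop-free code of constant cost. Linear time is then a matter of counting
  the rounds of each loop.\<close>

definition adj :: "('a \<times> 'a) set \<Rightarrow> 'a \<Rightarrow> 'a \<Rightarrow> bool" where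
  "adj E x y \<longleftrightarrow> (x, y) \<in> E \<or> (y, x) \<in> E"

lemma adj_sym: "adj E x y \<longleftrightarrow> adj E y x"
  by (auto simp: adj_def)

lemma adj_irrefl: "irrefl E \<Longrightarrow> \<not> adj E x x"
  by (auto simp: adj_def irrefl_def)

definition leaf :: "('a \<times> 'a) set \<Rightarrow> 'a set \<Rightarrow> 'a \<Rightarrow> 'a \<Rightarrow> bool" where
  "leaf E A v p \<longleftrightarrow> v \<in> A \<and> {y \<in> A. adj E v y} = {p}"

text \<open>Generation by attached leaves gives induction on trees without paths or cycles.
  \<open>di_tree_tree_on\<close> shows that every di-tree has this form.\<close>

inductive tree_on :: "('a \<times> 'a) set \<Rightarrow> 'a set \<Rightarrow> bool" for E where
  single: "tree_on E {r}"
| insert: "tree_on E A \<Longrightarrow> v \<notin> A \<Longrightarrow> leaf E (insert v A) v p \<Longrightarrow> tree_on E (insert v A)"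

lemma tree_on_nonempty: "tree_on E A \<Longrightarrow> A \<noteq> {}"
  by (induction rule: tree_on.induct) auto

lemma leaf_neighbour: "irrefl E \<Longrightarrow> leaf E A v p \<Longrightarrow> v \<in> A \<and> p \<in> A \<and> p \<noteq> v \<and> adj E v p"
  using adj_irrefl[of E v] unfolding leaf_def by blast

lemma leaf_unique: "leaf E A v p \<Longrightarrow> y \<in> A \<Longrightarrow> adj E v y \<Longrightarrow> y = p"
  unfolding leaf_def by blast

lemma tree_on_no_leaf:
  assumes "tree_on E A" "\<And>v p. \<not> leaf E A v p"
  obtains r where "A = {r}"
  using assms by (cases rule: tree_on.cases) auto

lemma tree_on_neighbour:
  assumes "tree_on E A" "irrefl E" "v \<in> A" "A \<noteq> {v}"
  shows "\<exists>y \<in> A. adj E v y"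
  using assms
proof (induction arbitrary: v rule: tree_on.induct)
  case (insert A w p)
  note lf = leaf_neighbour[OF insert.prems(1) insert.hyps(3)]
  show ?case
  proof (cases "v = w")
    case True
    then show ?thesis using lf by blast
  next
    case False
    then show ?thesis
      using lf insert.prems insert.IH[OF insert.prems(1), of v] by (cases "A = {v}") (auto simp: adj_sym)
  qed
qed auto

text \<open>The program chooses its own order of removal, so the leaf may differ from the one
  attached last. Two leaves can be removed in either order unless they are adjacent, and then they
  are the whole tree.\<close>

lemma tree_on_remove_leaf:
  assumes "tree_on E A" "irrefl E" "leaf E A v p"
  shows "tree_on E (A - {v})"
  using assms
proof (induction arbitrary: v p rule: tree_on.induct)
  case (single r)
  then show ?case by (auto simp: leaf_def adj_def irrefl_def)
next
  case (insert A w q)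
  note w = leaf_neighbour[OF insert.prems(1) insert.hyps(3)]
  note v = leaf_neighbour[OF insert.prems(1) insert.prems(2)]
  show ?case
  proof (cases "v = w")
    case True
    then show ?thesis using insert.hyps by simp
  next
    case vw: False
    show ?thesis
    proof (cases "p = w")
      case True
      have "A = {v}"
      proof (rule ccontr)
        assume "A \<noteq> {v}"
        then obtain y where "y \<in> A" "adj E v y"
          using tree_on_neighbour[OF insert.hyps(1) insert.prems(1), of v] v vw by auto
        then show False using leaf_unique[OF insert.prems(2), of y] True insert.hyps(2) by auto
      qed
      then show ?thesis using vw by (auto intro: single simp: insert_Diff_if)
    next
      case False
      have "leaf E A v p"
        using insert.prems(2) False vw v unfolding leaf_def by auto
      with insert.IH insert.prems have tr: "tree_on E (A - {v})" by blast
      have "q \<noteq> v" using leaf_unique[OF insert.prems(2), of w] w False by (auto simp: adj_sym)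
      then have "leaf E (insert w (A - {v})) w q"
        using insert.hyps(3) vw unfolding leaf_def by auto
      from tree_on.insert[OF tr _ this] insert.hyps(2)
      have "tree_on E (insert w (A - {v}))" by auto
      then show ?thesis using vw by (simp add: insert_Diff_if)
    qed
  qed
qed

text \<open>\<open>d\<close> stands for path length in the tree and is given only by the properties
  used. Every edge splits the vertices into two sides (\<open>side\<close>), and passing between the
  sides means crossing that edge (\<open>cross\<close>), so undirected paths never have to be
  handled.\<close>

locale tree_metric =
  fixes E :: "('a \<times> 'a) set" and A :: "'a set" and d :: "'a \<Rightarrow> 'a \<Rightarrow> nat"
  assumes zero_iff: "x \<in> A \<Longrightarrow> y \<in> A \<Longrightarrow> d x y = 0 \<longleftrightarrow> x = y"
    and sym: "x \<in> A \<Longrightarrow> y \<in> A \<Longrightarrow> d x y = d y x"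
    and triangle: "x \<in> A \<Longrightarrow> y \<in> A \<Longrightarrow> z \<in> A \<Longrightarrow> d x z \<le> d x y + d y z"
    and adj_one: "x \<in> A \<Longrightarrow> y \<in> A \<Longrightarrow> adj E x y \<Longrightarrow> d x y = 1"
    and side: "z \<in> A \<Longrightarrow> a \<in> A \<Longrightarrow> y \<in> A \<Longrightarrow> adj E z a \<Longrightarrow> d y z = d y a + 1 \<or> d y a = d y z + 1"
    and cross: "z \<in> A \<Longrightarrow> a \<in> A \<Longrightarrow> y \<in> A \<Longrightarrow> w \<in> A \<Longrightarrow> adj E z a \<Longrightarrow>
      d y z = d y a + 1 \<Longrightarrow> d w a = d w z + 1 \<Longrightarrow> d y w = d y a + 1 + d z w"

lemma tree_metric_exists:
  assumes "tree_on E A" "irrefl E"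
  shows "\<exists>d. tree_metric E A d"
  using assms
proof (induction rule: tree_on.induct)
  case (single r)
  then show ?case
    by (intro exI[of _ "\<lambda>_ _. 0"]) (auto simp: tree_metric_def adj_irrefl)
next
  case (insert A v p)
  then obtain d where d: "tree_metric E A d" by blast
  note lf = leaf_neighbour[OF insert.prems(1) insert.hyps(3)]
  have nb: "\<And>y. y \<in> A \<Longrightarrow> adj E v y \<longleftrightarrow> y = p" "\<And>y. y \<in> A \<Longrightarrow> adj E y v \<longleftrightarrow> y = p"
    using leaf_unique[OF insert.hyps(3)] lf by (auto simp: adj_sym)
  have pA: "p \<in> A" using lf by auto
  define d' where "d' = (\<lambda>x y. if x = v then (if y = v then 0 else d p y + 1)
     else if y = v then d x p + 1 else d x y)"
  have d'[simp]: "d' v v = 0" "\<And>y. y \<in> A \<Longrightarrow> d' v y = d p y + 1"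
     "\<And>y. y \<in> A \<Longrightarrow> d' y v = d y p + 1" "\<And>x y. x \<in> A \<Longrightarrow> y \<in> A \<Longrightarrow> d' x y = d x y"
    using insert.hyps(2) by (auto simp: d'_def)
  interpret tree_metric E A d by (rule d)
  note m0 = zero_iff and ms = sym and mt = triangle and m1 = adj_one and mside = side and mcross = cross
  have nvv: "\<not> adj E v v" by (rule adj_irrefl[OF insert.prems])
  have "tree_metric E (insert v A) d'"
  proof
    fix x y assume "x \<in> insert v A" "y \<in> insert v A"
    then show "d' x y = 0 \<longleftrightarrow> x = y"
      using insert.hyps(2) by (auto simp: m0)
  next
    fix x y assume "x \<in> insert v A" "y \<in> insert v A"
    then show "d' x y = d' y x"
      using pA by (auto simp: ms)
  next
    fix x y z assume "x \<in> insert v A" "y \<in> insert v A" "z \<in> insert v A"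
    then show "d' x z \<le> d' x y + d' y z"
      using pA mt[of x y z] mt[of p y z] mt[of x p z] mt[of x y p] by auto
  next
    fix x y assume "x \<in> insert v A" "y \<in> insert v A" "adj E x y"
    then show "d' x y = 1"
      using pA m0 m1 nvv by (auto simp: nb)
  next
    fix z a y assume "z \<in> insert v A" "a \<in> insert v A" "y \<in> insert v A" "adj E z a"
    then show "d' y z = d' y a + 1 \<or> d' y a = d' y z + 1"
      using pA mside[of z a y] mside[of z a p] m0 nvv by (auto simp: nb)
  next
      fix z a y w
      assume zayw: "z \<in> insert v A" "a \<in> insert v A" "y \<in> insert v A" "w \<in> insert v A"
        and e: "adj E z a" and yz: "d' y z = d' y a + 1" and wa: "d' w a = d' w z + 1"
      \<comment> \<open>For the new edge, the side of \<open>v\<close> is \<open>{v}\<close>, which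
        determines \<open>w\<close> or \<open>y\<close>. An old edge reduces to \<open>d\<close>
        with \<open>p\<close> in place of \<open>v\<close>.\<close>
      consider "z = v" "a = p" | "a = v" "z = p" | "z \<in> A" "a \<in> A"
        using zayw e nvv nb by auto
      then show "d' y w = d' y a + 1 + d' z w"
      proof cases
        case 1
        then have "w = v" using wa zayw pA by auto
        then show ?thesis using 1 yz by simp
      next
        case 2
        then have "y = v" using yz zayw pA by auto
        then show ?thesis using 2 zayw wa pA by auto
      next
        case 3
        then show ?thesis using zayw yz wa e pA mcross[of z a y w] mcross[of z a p w] mcross[of z a y p] ms m0
          mcross[of z a p p]
          by auto
      qed
  qed
  then show ?case by blast
qed

section \<open>Distances in di-trees\<close>

definition away :: "('a \<times> 'a) set \<Rightarrow> 'a set \<Rightarrow> 'a \<Rightarrow> ('a \<times> 'a) set" where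
  "away E A z = E \<inter> (A - {z}) \<times> (A - {z})"

definition reached :: "('a \<times> 'a) set \<Rightarrow> 'a set \<Rightarrow> ('a \<Rightarrow> bool) \<Rightarrow> 'a \<Rightarrow> 'a \<Rightarrow> bool" where
  "reached E A P z a \<longleftrightarrow> (\<exists>s \<in> A - {z}. P s \<and> (s, a) \<in> (away E A z)\<^sup>*)"

lemma away_subset: "away E A z \<subseteq> E"
  by (auto simp: away_def)

lemma rtrancl_away_imp: "(x, y) \<in> (away E A z)\<^sup>* \<Longrightarrow> (x, y) \<in> E\<^sup>*"
  using rtrancl_mono[OF away_subset[of E A z]] by blast

lemma rtrancl_away_in:
  "(x, y) \<in> (away E A z)\<^sup>* \<Longrightarrow> x \<in> A \<Longrightarrow> x \<noteq> z \<Longrightarrow> y \<in> A \<and> y \<noteq> z"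
  by (induction rule: rtrancl_induct) (auto simp: away_def)

lemma first_visit:
  assumes "(x, z) \<in> E\<^sup>*" "E \<subseteq> A \<times> A" "x \<noteq> z"
  shows "\<exists>y. (x, y) \<in> (away E A z)\<^sup>* \<and> (y, z) \<in> E \<and> y \<noteq> z"
  using assms
proof (induction rule: converse_rtrancl_induct)
  case (step x x')
  show ?case
  proof (cases "x' = z")
    case False
    with step obtain y where "(x', y) \<in> (away E A z)\<^sup>*" "(y, z) \<in> E" "y \<noteq> z" by blast
    moreover have "(x, x') \<in> away E A z" using step False by (auto simp: away_def)
    ultimately show ?thesis by (meson converse_rtrancl_into_rtrancl)
  qed (use step in blast)
qed simp

lemma avoids_or_visits:
  assumes "(x, a) \<in> E\<^sup>*" "E \<subseteq> A \<times> A" "a \<noteq> z" "x \<noteq> z"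
  shows "(x, a) \<in> (away E A z)\<^sup>* \<or> (x, z) \<in> E\<^sup>*"
  using assms
proof (induction rule: converse_rtrancl_induct)
  case (step x x')
  show ?case
  proof (cases "x' = z")
    case False
    then have "(x, x') \<in> away E A z" using step by (auto simp: away_def)
    then show ?thesis using False step by (meson converse_rtrancl_into_rtrancl)
  qed (use step in blast)
qed simp

locale metric_ditree = tree_metric +
  assumes closed: "E \<subseteq> A \<times> A" and irrefl: "irrefl E"
begin

lemma arc_in: "(x, y) \<in> E \<Longrightarrow> x \<in> A \<and> y \<in> A"
  using closed by auto

lemma arc_adj: "(x, y) \<in> E \<Longrightarrow> adj E x y"
  by (simp add: adj_def)

lemma arc_one: "(x, y) \<in> E \<Longrightarrow> d x y = 1"
  using arc_in arc_adj adj_one by blast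

lemma relpow_in: "(x, y) \<in> E ^^ k \<Longrightarrow> x \<in> A \<Longrightarrow> y \<in> A"
  by (cases k) (auto dest: arc_in)

lemma relpow_le: "(x, y) \<in> E ^^ k \<Longrightarrow> x \<in> A \<Longrightarrow> d x y \<le> k"
proof (induction k arbitrary: y)
  case 0
  then show ?case by (auto simp: zero_iff)
next
  case (Suc k)
  then obtain u where u: "(x, u) \<in> E ^^ k" "(u, y) \<in> E" by auto
  then show ?case
    using Suc triangle[of x u y] arc_in[OF u(2)] arc_one[OF u(2)] by fastforce
qed

text \<open>No other edge joins the two sides of the edge between \<open>z\<close> and
  \<open>a\<close>: if \<open>y\<close> were across, \<open>cross\<close> would give
  \<open>d x y = d x a + 1 + d z y\<close>, and this is 1 only for \<open>y = z\<close>.\<close>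

lemma adj_away_side:
  assumes "z \<in> A" "a \<in> A" "adj E z a" "x \<in> A" "y \<in> A" "adj E x y" "x \<noteq> z" "y \<noteq> z"
    and "d x z = d x a + 1"
  shows "d y z = d y a + 1"
proof (rule ccontr)
  assume "\<not> ?thesis"
  then have "d y a = d y z + 1" using side[of z a y] assms by blast
  from cross[OF assms(1,2,4,5,3,9) this] have "d z y = 0" using assms adj_one by simp
  then show False using zero_iff assms by blast
qed

lemma away_side:
  assumes "z \<in> A" "a \<in> A" "adj E z a" "(x, y) \<in> (away E A z)\<^sup>*"
  shows "d x z = d x a + 1 \<longleftrightarrow> d y z = d y a + 1"
  using assms(4)
proof (induction rule: rtrancl_induct)
  case (step y y')
  then have "y \<in> A" "y' \<in> A" "y \<noteq> z" "y' \<noteq> z" "adj E y y'" "adj E y' y"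
    by (auto simp: away_def adj_def)
  then show ?case using step.IH adj_away_side[of z a y y'] adj_away_side[of z a y' y] assms by blast
qed simp

text \<open>If \<open>y\<close> differed from \<open>u\<close>, it would lie across the edge between
  \<open>z\<close> and \<open>u\<close> as seen from \<open>x\<close>, hence be farther from
  \<open>x\<close> than \<open>u\<close>; but both are one step nearer than
  \<open>z\<close>.\<close>

lemma closer_unique:
  assumes "x \<in> A" "u \<in> A" "y \<in> A" "z \<in> A" "adj E z u" "adj E z y"
    and "d x z = d x u + 1" "d x z = d x y + 1"
  shows "u = y"
proof (rule ccontr)
  assume "u \<noteq> y"
  then have "d y u = d y z + 1"
    using side[of z u y] assms adj_one[of z y] zero_iff[of y u] sym[of y z] by auto
  then have "d x y = d x u + 1 + d z y" using cross[of z u x y] assms by blast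
  then show False using assms by simp
qed

text \<open>Directed and tree distance agree on reachable pairs. In the induction along the path, an
  arc that leads back toward \<open>x\<close> must end at the predecessor of \<open>u\<close> on a
  shortest walk, by \<open>closer_unique\<close>, and that predecessor has already been reached in
  one step less.\<close>

lemma rtrancl_relpow:
  assumes "(x, y) \<in> E\<^sup>*" "x \<in> A"
  shows "(x, y) \<in> E ^^ (d x y)"
  using assms
proof (induction rule: rtrancl_induct)
  case base
  then show ?case using zero_iff[of x x] by simp
next
  case (step u y)
  then have uy: "u \<in> A" "y \<in> A" "adj E u y" "adj E y u" by (auto dest: arc_in simp: adj_def)
  then consider "d x y = d x u + 1" | "d x u = d x y + 1" using side step.prems by blast
  then show ?case
  proof cases
    case 1
    then show ?thesis using step by auto
  next
    case 2
    with step obtain u' where u': "(x, u') \<in> E ^^ (d x y)" "(u', u) \<in> E" by auto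
    then have u'A: "u' \<in> A" "adj E u u'" by (auto dest: arc_in simp: adj_def)
    moreover have "d x u' \<le> d x y" using relpow_le u' step.prems by blast
    ultimately have "d x u = d x u' + 1" using side[of u u' x] step.prems uy 2 by auto
    then have "u' = y" using closer_unique[of x u' y u] u'A uy 2 step.prems by blast
    then show ?thesis using u' by simp
  qed
qed

text \<open>A walk from the side of \<open>a\<close> first enters \<open>z\<close> from a neighbour
  on that side, and \<open>a\<close> is the only one.\<close>

lemma rtrancl_toward:
  assumes "(z, a) \<in> E" "x \<in> A" "d x z = d x a + 1" "(x, z) \<in> E\<^sup>*"
  shows "(x, a) \<in> (away E A z)\<^sup>*"
proof -
  note za = arc_in[OF assms(1)] arc_adj[OF assms(1)]
  have "x \<noteq> z" using assms(3) zero_iff[of z z] za by auto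
  from first_visit[OF assms(4) closed this] obtain y
    where y: "(x, y) \<in> (away E A z)\<^sup>*" "(y, z) \<in> E" by blast
  then have "d y z = d y a + 1" using away_side[of z a x y] za assms by blast
  then have "y = a" using arc_one[OF y(2)] arc_in[OF y(2)] zero_iff za by auto
  then show ?thesis using y by simp
qed

lemma reached_side:
  assumes "(z, a) \<in> E" "s \<in> A" "(s, a) \<in> (away E A z)\<^sup>*"
  shows "d s z = d s a + 1"
proof -
  note za = arc_in[OF assms(1)] arc_adj[OF assms(1)]
  have "d a z = d a a + 1" using arc_one[OF assms(1)] za sym[of a z] zero_iff[of a a] by simp
  then show ?thesis using away_side[of z a s a] za assms(3) by blast
qed

end

text \<open>Compare the vertices just before \<open>v\<close> and \<open>w\<close>: if they are
  equal, this is the branching point, otherwise the walks branch earlier. Equal total length makes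
  the two arms equally long.\<close>

lemma relpow_diverge:
  assumes "(x, v) \<in> E ^^ k" "(x, w) \<in> E ^^ k" "v \<noteq> w"
  shows "\<exists>z a b i j. (x, z) \<in> E ^^ i \<and> (z, a) \<in> E \<and> (z, b) \<in> E \<and> a \<noteq> b \<and>
    (a, v) \<in> E ^^ j \<and> (b, w) \<in> E ^^ j \<and> k = i + 1 + j"
  using assms
proof (induction k arbitrary: v w)
  case (Suc k)
  then obtain v' w' where vw': "(x, v') \<in> E ^^ k" "(v', v) \<in> E" "(x, w') \<in> E ^^ k" "(w', w) \<in> E"
    by auto
  show ?case
  proof (cases "v' = w'")
    case True
    with vw' Suc.prems show ?thesis
      by (intro exI[of _ v'] exI[of _ v] exI[of _ w] exI[of _ k] exI[of _ 0]) auto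
  next
    case False
    from Suc.IH[OF vw'(1,3) False] obtain z a b i j where
      *: "(x, z) \<in> E ^^ i" "(z, a) \<in> E" "(z, b) \<in> E" "a \<noteq> b"
      "(a, v') \<in> E ^^ j" "(b, w') \<in> E ^^ j" "k = i + 1 + j" by blast
    then have "(a, v) \<in> E ^^ Suc j" "(b, w) \<in> E ^^ Suc j" using vw' by auto
    with * show ?thesis
      by (intro exI[of _ z] exI[of _ a] exI[of _ b] exI[of _ i] exI[of _ "Suc j"]) auto
  qed
qed simp

section \<open>Directed distance as least walk length\<close>

lemma (in wf_digraph) awalk_relpow: "awalk x p y \<Longrightarrow> (x, y) \<in> arcs_ends G ^^ length p"
proof (induction p arbitrary: x)
  case (Cons e p)
  then have "(x, head G e) \<in> arcs_ends G" "(head G e, y) \<in> arcs_ends G ^^ length p"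
    by (auto simp: awalk_Cons_iff in_arcs_imp_in_arcs_ends)
  then show ?case by (metis length_Cons relpow_Suc_I2)
qed (simp add: awalk_Nil_iff)

lemma (in wf_digraph) relpow_awalk:
  "(x, y) \<in> arcs_ends G ^^ k \<Longrightarrow> x \<in> verts G \<Longrightarrow> \<exists>p. awalk x p y \<and> length p = k"
proof (induction k arbitrary: y)
  case 0
  then show ?case by (auto simp: awalk_Nil_iff)
next
  case (Suc k)
  then obtain u where u: "(x, u) \<in> arcs_ends G ^^ k" "(u, y) \<in> arcs_ends G" by auto
  with Suc obtain p where p: "awalk x p u" "length p = k" by blast
  from u(2) obtain e where "awalk u [e] y" by (auto simp: arcs_ends_conv awalk_simps dest: wellformed)
  with p have "awalk x (p @ [e]) y \<and> length (p @ [e]) = Suc k" by (auto intro: awalk_appendI)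
  then show ?case by blast
qed

lemma (in wf_digraph) length_awalk_to_apath:
  assumes "awalk u p v"
  shows "length (awalk_to_apath p) \<le> length p"
  using assms
proof (induct rule: awalk_to_apath_induct)
  case (path p)
  then have "awalk_to_apath p = p" by (auto simp: awalk_to_apath.simps)
  then show ?case by simp
next
  case (decomp p q r s)
  then have "length (awalk_to_apath (q @ s)) \<le> length p" by (auto elim!: awalk_cyc_decompE)
  then show ?case using step_awalk_to_apath[OF decomp(1,2,3)] by simp
qed

text \<open>Cutting cycles out of a walk does not lengthen it, so the infimum over simple paths can
  be read as one over walks. The form with \<open>\<le>\<close> also covers unreachable vertices,
  for which no \<open>k\<close> works.\<close>

lemma (in wf_digraph) di_dist_le_iff:
  assumes "x \<in> verts G"
  shows "di_dist G x y \<le> enat k \<longleftrightarrow> (\<exists>j \<le> k. (x, y) \<in> arcs_ends G ^^ j)"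
proof
  assume le: "di_dist G x y \<le> enat k"
  let ?D = "(\<lambda>p. enat (length p)) ` {p. apath x p y}"
  have "?D \<noteq> {}"
  proof
    assume "?D = {}"
    then have "di_dist G x y = \<infinity>" by (simp add: di_dist_def top_enat_def)
    then show False using le by simp
  qed
  then have "Inf ?D \<in> ?D"
    unfolding Inf_enat_def using LeastI_ex[of "\<lambda>n. n \<in> ?D"] by auto
  then obtain p where "apath x p y" "di_dist G x y = enat (length p)"
    unfolding di_dist_def by auto
  then show "\<exists>j \<le> k. (x, y) \<in> arcs_ends G ^^ j"
    using le awalk_relpow[of x p y] by (auto simp: apath_def)
next
  assume "\<exists>j \<le> k. (x, y) \<in> arcs_ends G ^^ j"
  then obtain p where p: "awalk x p y" "length p \<le> k" using relpow_awalk[OF _ assms] by blast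
  have "length (awalk_to_apath p) \<le> length p"
    by (rule length_awalk_to_apath[OF p(1)])
  moreover have "apath x (awalk_to_apath p) y" using p apath_awalk_to_apath by blast
  ultimately show "di_dist G x y \<le> enat k"
    unfolding di_dist_def by (intro INF_lower2[of "awalk_to_apath p"]) (use p in auto)
qed

section \<open>Resolving sets as valid labellings\<close>

text \<open>
  During the elimination of leaves, a remaining vertex \<open>u\<close> stands for the part of the tree that
  has been merged into it, and its label summarises the chosen set \<open>S\<close> on that part:
  \<open>source\<close> means that \<open>S\<close> reaches \<open>u\<close> from within the part; \<open>settled\<close> that the part makes no
  further demand that \<open>u\<close> be reached from the remaining tree; \<open>spent\<close> that the one exceptional
  out-neighbour that \<open>u\<close> is allowed lies in the part.
\<close>

datatype label = Label (source: bool) (settled: bool) (spent: bool)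

definition unreached :: "('a \<times> 'a) set \<Rightarrow> 'a set \<Rightarrow> ('a \<Rightarrow> bool) \<Rightarrow> 'a \<Rightarrow> 'a set" where
  "unreached E A P z = {a \<in> A. (z, a) \<in> E \<and> \<not> reached E A P z a}"

text \<open>Reaching \<open>u\<close> is expressed through the last arc into \<open>u\<close>, so
  that both conditions speak of the digraph without one vertex and respond to the removal of a leaf
  through the same lemma, \<open>reached_remove_leaf\<close>.\<close>

definition valid :: "('a \<times> 'a) set \<Rightarrow> 'a set \<Rightarrow> ('a \<Rightarrow> label) \<Rightarrow> bool" where
  "valid E A l \<longleftrightarrow>
     (\<forall>z\<in>A. of_bool (spent (l z)) + card (unreached E A (source \<circ> l) z) \<le> 1) \<and>
     (\<forall>u\<in>A. settled (l u) \<or> (\<exists>y. (y, u) \<in> E \<and> reached E A (source \<circ> l) u y))"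

definition "inside = Label True True False"
definition "outside = Label False False False"

definition membership :: "'a set \<Rightarrow> 'a \<Rightarrow> label" where
  "membership S u = (if u \<in> S then inside else outside)"

lemma membership_simps[simp]:
  "source (membership S u) \<longleftrightarrow> u \<in> S" "settled (membership S u) \<longleftrightarrow> u \<in> S" "\<not> spent (membership S u)"
  by (auto simp: membership_def inside_def outside_def)

section \<open>The local criterion for resolving sets\<close>

locale ditree_digraph = digraph G for G :: "('a, 'b) pre_digraph" +
  fixes d
  assumes tm: "tree_metric (arcs_ends G) (verts G) d"
begin

sublocale metric_ditree "arcs_ends G" "verts G" d
proof -
  interpret tree_metric "arcs_ends G" "verts G" d by (rule tm)
  show "metric_ditree (arcs_ends G) (verts G) d"
    by unfold_locales (auto simp: irrefl_def dest: adj_in_verts adj_not_same)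
qed

lemma di_dist_eq:
  assumes "x \<in> verts G"
  shows "di_dist G x y = (if (x, y) \<in> (arcs_ends G)\<^sup>* then enat (d x y) else \<infinity>)"
proof (cases "(x, y) \<in> (arcs_ends G)\<^sup>*")
  case True
  have "di_dist G x y \<le> enat (d x y)"
    using rtrancl_relpow[OF True assms] unfolding di_dist_le_iff[OF assms] by blast
  moreover have "d x y \<le> k" if "di_dist G x y = enat k" for k
    using that di_dist_le_iff[OF assms, of y k] relpow_le[OF _ assms] by fastforce
  ultimately have "di_dist G x y = enat (d x y)"
    by (cases "di_dist G x y") auto
  then show ?thesis using True by simp
next
  case False
  then have "\<not> di_dist G x y \<le> enat k" for k
    using di_dist_le_iff[OF assms, of y k] relpow_imp_rtrancl by blast
  then have "di_dist G x y = \<infinity>" by (cases "di_dist G x y") auto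
  then show ?thesis using False by simp
qed

lemma reachable_rtrancl: "x \<in> verts G \<Longrightarrow> x \<rightarrow>\<^sup>*\<^bsub>G\<^esub> y \<longleftrightarrow> (x, y) \<in> (arcs_ends G)\<^sup>*"
  by (rule reachable_conv')

abbreviation "dir \<equiv> arcs_ends G"

text \<open>The tree path from \<open>s\<close> to \<open>w\<close> runs through \<open>a\<close>
  and \<open>z\<close>, so \<open>d s w = d s a + j + 2\<close>, whereas \<open>v\<close> is at most
  \<open>d s a + j\<close> away. If \<open>w\<close> is unreachable from \<open>s\<close>, the
  distances differ anyway, since \<open>v\<close> is reachable.\<close>

lemma branch_resolved:
  assumes x: "x \<in> verts G" "(x, v) \<in> dir ^^ (i + 1 + j)" "d x v = i + 1 + j"
    and br: "(x, z) \<in> dir ^^ i" "(z, a) \<in> dir" "(z, b) \<in> dir" "a \<noteq> b" "(a, v) \<in> dir ^^ j" "(b, w) \<in> dir ^^ j"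
    and dw: "d x w = i + 1 + j"
    and s: "s \<in> verts G" "(s, a) \<in> (away dir (verts G) z)\<^sup>*"
  shows "di_dist G s v \<noteq> di_dist G s w"
proof -
  have A: "z \<in> verts G" "a \<in> verts G" "b \<in> verts G" "v \<in> verts G" "w \<in> verts G"
    using br arc_in relpow_in by blast+
  have adj: "adj dir z a" "adj dir z b" "adj dir a z" "adj dir b z" using br by (auto simp: adj_def)
  have le: "d x z \<le> i" "d a v \<le> j" "d b w \<le> j" "d z a = 1" "d z b = 1"
    using relpow_le br A x arc_one by blast+
  have dz: "d z v = Suc j" "d z w = Suc j"
    using le x dw triangle[of x z v] triangle[of x z w] triangle[of z a v] triangle[of z b w] A by auto
  have "d w z = d w b + 1"
    using dz side[of z b w] adj A le triangle[of w b z] sym[of w z] sym[of w b] adj_one by auto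
  moreover have "d a b = d a z + 1"
    using side[of z b a] adj A zero_iff[of a b] adj_one[of a z] br(4) by auto
  \<comment> \<open>The way from \<open>w\<close> to \<open>a\<close> leads through \<open>b\<close>
    and \<open>z\<close>, which places \<open>w\<close> across the edge between \<open>z\<close> and
    \<open>a\<close> from \<open>s\<close>.\<close>
  ultimately have "d w a = d w b + 1 + d z a" using cross[of z b w a] adj A by blast
  then have "d w a = d w z + 1" using \<open>d w z = d w b + 1\<close> le by simp
  then have sw: "d s w = d s a + 1 + d z w"
    using cross[of z a s w] adj A s reached_side[OF br(2) s] by blast
  moreover have "d s v \<le> d s a + d a v" using triangle A s by blast
  ultimately have "d s v < d s w" using le dz by simp
  moreover have "(s, v) \<in> dir\<^sup>*"
    using rtrancl_away_imp[OF s(2)] relpow_imp_rtrancl[OF br(5)] by (rule rtrancl_trans)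
  ultimately show ?thesis using di_dist_eq s by simp
qed

lemma resolving_of_valid:
  assumes S: "S \<subseteq> verts G" and "valid dir (verts G) (membership S)"
  shows "resolving_set G S"
proof -
  have spare: "\<And>z. z \<in> verts G \<Longrightarrow> card (unreached dir (verts G) (\<lambda>u. u \<in> S) z) \<le> 1"
    and settled: "\<And>u. u \<in> verts G \<Longrightarrow> u \<in> S \<or> (\<exists>y. (y, u) \<in> dir \<and> reached dir (verts G) (\<lambda>u. u \<in> S) u y)"
    using assms(2) by (auto simp: valid_def comp_def)
  have cover: "\<exists>x\<in>S. (x, v) \<in> dir\<^sup>*" if v: "v \<in> verts G" for v
  proof (cases "v \<in> S")
    case False
    then obtain y s where "(y, v) \<in> dir" "s \<in> S" "(s, y) \<in> (away dir (verts G) v)\<^sup>*"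
      using settled[OF v] unfolding reached_def by blast
    then show ?thesis using rtrancl_away_imp[of s y] by (meson rtrancl.rtrancl_into_rtrancl)
  qed auto
  have "\<exists>x\<in>S. di_dist G x v \<noteq> di_dist G x w" if vw: "v \<in> verts G" "w \<in> verts G" "v \<noteq> w" for v w
  proof (rule ccontr)
    assume neg: "\<not> ?thesis"
    obtain x where x: "x \<in> S" "(x, v) \<in> dir\<^sup>*" using cover vw by blast
    then have xV: "x \<in> verts G" using S by blast
    \<comment> \<open>The distance from \<open>x\<close> to \<open>v\<close> is finite, so equality
      with that to \<open>w\<close> makes \<open>w\<close> reachable as well.\<close>
    then have xw: "(x, w) \<in> dir\<^sup>*" "d x v = d x w"
      using neg x di_dist_eq[of x v] di_dist_eq[of x w] by (auto split: if_splits)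
    have rv: "(x, v) \<in> dir ^^ d x v" "(x, w) \<in> dir ^^ d x v"
      using rtrancl_relpow x xw xV by metis+
    from relpow_diverge[OF this vw(3)] obtain z a b i j where
      *: "(x, z) \<in> dir ^^ i" "(z, a) \<in> dir" "(z, b) \<in> dir" "a \<noteq> b"
      "(a, v) \<in> dir ^^ j" "(b, w) \<in> dir ^^ j" "d x v = i + 1 + j" by blast
    then have A: "z \<in> verts G" "a \<in> verts G" "b \<in> verts G" using arc_in by blast+
    note rv' = rv[unfolded *(7)] and dxw = trans[OF xw(2)[symmetric] *(7)]
    have "\<not> {a, b} \<subseteq> unreached dir (verts G) (\<lambda>u. u \<in> S) z"
    proof
      assume "{a, b} \<subseteq> unreached dir (verts G) (\<lambda>u. u \<in> S) z"
      then have "card {a, b} \<le> card (unreached dir (verts G) (\<lambda>u. u \<in> S) z)"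
        by (intro card_mono) (auto simp: unreached_def)
      then show False using spare[OF A(1)] * by simp
    qed
    then consider s where "s \<in> S" "(s, a) \<in> (away dir (verts G) z)\<^sup>*"
      | s where "s \<in> S" "(s, b) \<in> (away dir (verts G) z)\<^sup>*"
      using A * by (auto simp: unreached_def reached_def)
    then show False
    proof cases
      case 1
      then have "s \<in> verts G" using S by blast
      from branch_resolved[OF xV rv'(1) *(7,1-6) dxw this 1(2)] show False using 1 neg by blast
    next
      case 2
      then have "s \<in> verts G" using S by blast
      from branch_resolved[OF xV rv'(2) dxw *(1,3,2) *(4)[symmetric] *(6,5,7) this 2(2)]
      show False using 2 neg by metis
    qed
  qed
  then show ?thesis using S cover reachable_rtrancl unfolding resolving_set_def by blast
qed

text \<open>A member of \<open>P\<close> can reach \<open>a\<close> only through \<open>z\<close>,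
  and sees it one step beyond \<open>z\<close>. Hence two unreached out-neighbours of the same
  \<open>z\<close> look alike from every member of \<open>P\<close>.\<close>

lemma unreached_dist:
  assumes "(z, a) \<in> dir" "\<not> reached dir (verts G) P z a" "x \<in> verts G" "P x"
  shows "di_dist G x a = (if (x, z) \<in> dir\<^sup>* then enat (d x z + 1) else \<infinity>)"
proof -
  note za = arc_in[OF assms(1)] arc_adj[OF assms(1)]
  have far: "(x, a) \<notin> (away dir (verts G) z)\<^sup>*" if "x \<noteq> z"
    using assms that unfolding reached_def by blast
  have "(x, a) \<in> dir\<^sup>* \<longleftrightarrow> (x, z) \<in> dir\<^sup>*"
  proof
    assume "(x, a) \<in> dir\<^sup>*"
    then show "(x, z) \<in> dir\<^sup>*"
      using avoids_or_visits[of x a dir "verts G" z] closed far arc_one[OF assms(1)] zero_iff[of z a] za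
      by (cases "x = z") auto
  next
    assume "(x, z) \<in> dir\<^sup>*"
    then show "(x, a) \<in> dir\<^sup>*" using assms(1) by (rule rtrancl_into_rtrancl)
  qed
  moreover have "d x a = d x z + 1" if "(x, z) \<in> dir\<^sup>*"
  proof (rule ccontr)
    assume "\<not> ?thesis"
    then have side': "d x z = d x a + 1" using side[of z a x] za assms(3) by blast
    then have "x \<noteq> z" using zero_iff[of z z] za by auto
    then show False using far rtrancl_toward[OF assms(1,3) side' that] by blast
  qed
  ultimately show ?thesis using di_dist_eq[OF assms(3), of a] by simp
qed

lemma valid_of_resolving:
  assumes "resolving_set G S"
  shows "valid dir (verts G) (membership S)"
proof -
  have S: "S \<subseteq> verts G"
    and res: "\<And>v w. v \<in> verts G \<Longrightarrow> w \<in> verts G \<Longrightarrow> v \<noteq> w \<Longrightarrow> \<exists>x\<in>S. di_dist G x v \<noteq> di_dist G x w"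
    and cover: "\<And>v. v \<in> verts G \<Longrightarrow> \<exists>x\<in>S. x \<rightarrow>\<^sup>*\<^bsub>G\<^esub> v"
    using assms by (auto simp: resolving_set_def)
  have "card (unreached dir (verts G) (\<lambda>u. u \<in> S) z) \<le> 1" for z
  proof -
    have "a = b" if ab: "a \<in> unreached dir (verts G) (\<lambda>u. u \<in> S) z" "b \<in> unreached dir (verts G) (\<lambda>u. u \<in> S) z" for a b
    proof (rule ccontr)
      assume "a \<noteq> b"
      then obtain x where "x \<in> S" "di_dist G x a \<noteq> di_dist G x b"
        using res[of a b] ab by (auto simp: unreached_def)
      moreover from this have "x \<in> verts G" using S by blast
      ultimately show False
        using ab unreached_dist[of z a "\<lambda>u. u \<in> S" x] unreached_dist[of z b "\<lambda>u. u \<in> S" x]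
        by (simp add: unreached_def)
    qed
    moreover have "finite (unreached dir (verts G) (\<lambda>u. u \<in> S) z)" by (simp add: unreached_def)
    ultimately show ?thesis by (simp add: card_le_Suc0_iff_eq)
  qed
  moreover have "u \<in> S \<or> (\<exists>y. (y, u) \<in> dir \<and> reached dir (verts G) (\<lambda>u. u \<in> S) u y)" if u: "u \<in> verts G" for u
  proof (rule ccontr)
    assume neg: "\<not> ?thesis"
    obtain x where x: "x \<in> S" "x \<rightarrow>\<^sup>*\<^bsub>G\<^esub> u" using cover u by blast
    then have "x \<in> verts G" "(x, u) \<in> dir\<^sup>*" "x \<noteq> u" using S reachable_rtrancl neg by blast+
    then obtain y where "(x, y) \<in> (away dir (verts G) u)\<^sup>*" "(y, u) \<in> dir"
      using first_visit closed by metis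
    then show False using neg x \<open>x \<in> verts G\<close> \<open>x \<noteq> u\<close> unfolding reached_def by blast
  qed
  ultimately show ?thesis by (simp add: valid_def comp_def)
qed

lemma resolving_iff_valid:
  "resolving_set G S \<longleftrightarrow> S \<subseteq> verts G \<and> valid dir (verts G) (membership S)"
  using resolving_of_valid valid_of_resolving by (auto simp: resolving_set_def)

end

section \<open>Removing a leaf\<close>

text \<open>
  \<open>join up down p v\<close> is the new label of the neighbour of a removed leaf, where \<open>p\<close> and \<open>v\<close> are the
  labels of the neighbour and of the leaf, and \<open>up\<close> (\<open>down\<close>) says whether there is an arc from
  (to) the leaf. If \<open>need\<close> holds, then the neighbour must be reached from outside the part merged
  into the leaf: either from the part merged into the neighbour so far, or from the remaining tree.
\<close>

definition join :: "bool \<Rightarrow> bool \<Rightarrow> label \<Rightarrow> label \<Rightarrow> label option" where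
  "join up down p v =
    (let over = down \<and> \<not> source v; gain = up \<and> source v; need = \<not> settled v \<or> spent v \<and> up in
     if (\<not> settled v \<and> \<not> down) \<or> (spent p \<and> over) then None
     else Some (Label (source p \<or> gain) ((settled p \<or> gain) \<and> (need \<longrightarrow> source p)) (spent p \<or> over)))"

lemma reached_cong: "(\<And>s. s \<in> A - {z} \<Longrightarrow> P s = Q s) \<Longrightarrow> reached E A P z a = reached E A Q z a"
  by (auto simp: reached_def)

lemma away_diff_subset: "away E (A - {v}) z \<subseteq> away E A z"
  by (auto simp: away_def)

section \<open>Effect of deleting a leaf on \<open>reached\<close> and \<open>valid\<close>\<close>

context
  fixes E :: "('a \<times> 'a) set" and A v p
  assumes fin: "finite A" and irr: "irrefl E" and lf: "leaf E A v p"
begin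

lemma leaf_facts: "v \<in> A" "p \<in> A" "p \<noteq> v"
  using leaf_neighbour[OF irr lf] by auto

lemma leaf_out: "(v, y) \<in> E \<Longrightarrow> y \<in> A \<Longrightarrow> y = p"
  and leaf_in: "(y, v) \<in> E \<Longrightarrow> y \<in> A \<Longrightarrow> y = p"
  using leaf_unique[OF lf] by (auto simp: adj_def)

text \<open>A walk enters and leaves \<open>v\<close> through \<open>p\<close>, so visits to
  \<open>v\<close> can be cut out. The induction therefore records, while the walk stands at
  \<open>v\<close>, that it has already been at \<open>p\<close>.\<close>

lemma rtrancl_bypass_leaf:
  assumes "(x, y) \<in> (away E A z)\<^sup>*" "x \<in> A" "x \<noteq> z" "x \<noteq> v" "y \<noteq> v"
  shows "(x, y) \<in> (away E (A - {v}) z)\<^sup>*"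
proof -
  have "y \<noteq> v \<longrightarrow> (x, y) \<in> (away E (A - {v}) z)\<^sup>*"
    "y = v \<longrightarrow> (x, p) \<in> (away E (A - {v}) z)\<^sup>*"
    using assms(1)
  proof (induction rule: rtrancl_induct)
    case (step y y')
    {
      case 1
      show ?case
      proof
        assume "y' \<noteq> v"
        show "(x, y') \<in> (away E (A - {v}) z)\<^sup>*"
        proof (cases "y = v")
          case True
          then show ?thesis using step leaf_out[of y'] by (auto simp: away_def)
        next
          case False
          then have "(y, y') \<in> away E (A - {v}) z" using step \<open>y' \<noteq> v\<close> by (auto simp: away_def)
          then show ?thesis using step False by (meson rtrancl.rtrancl_into_rtrancl)
        qed
      qed
    next
      case 2
      show ?case using step leaf_in[of y] leaf_facts irr by (auto simp: away_def irrefl_def)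
    }
  qed (use assms in auto)
  then show ?thesis using assms by blast
qed

text \<open>Every walk out of \<open>v\<close> continues at \<open>p\<close>, so a source at the
  leaf can be moved to \<open>p\<close> whenever the arc \<open>(v, p)\<close> exists.\<close>

lemma reached_remove_leaf:
  assumes "z \<in> A" "z \<noteq> v" "a \<in> A" "a \<noteq> v" "a \<noteq> z"
    and Q: "\<And>u. u \<in> A \<Longrightarrow> u \<noteq> v \<Longrightarrow> Q u \<longleftrightarrow> P u \<or> (u = p \<and> (v, p) \<in> E \<and> P v)"
  shows "reached E A P z a \<longleftrightarrow> reached E (A - {v}) Q z a"
proof
  assume "reached E A P z a"
  then obtain s where s: "s \<in> A" "s \<noteq> z" "P s" "(s, a) \<in> (away E A z)\<^sup>*"
    by (auto simp: reached_def)
  show "reached E (A - {v}) Q z a"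
  proof (cases "s = v")
    case False
    then show ?thesis using s rtrancl_bypass_leaf[of s a z] assms Q[of s] by (auto simp: reached_def)
  next
    case True
    then obtain y where y: "(v, y) \<in> away E A z" "(y, a) \<in> (away E A z)\<^sup>*"
      using s assms by (metis converse_rtranclE)
    then have "y = p" "p \<noteq> z" "(v, p) \<in> E" using leaf_out by (auto simp: away_def)
    then show ?thesis using rtrancl_bypass_leaf[of p a z] y assms leaf_facts s True Q[of p]
      by (auto simp: reached_def)
  qed
next
  assume "reached E (A - {v}) Q z a"
  then obtain s where s: "s \<in> A" "s \<noteq> v" "s \<noteq> z" "Q s" "(s, a) \<in> (away E (A - {v}) z)\<^sup>*"
    by (auto simp: reached_def)
  have sa: "(s, a) \<in> (away E A z)\<^sup>*" using s(5) rtrancl_mono[OF away_diff_subset[of E A v z]] by blast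
  from s Q consider "P s" | "s = p" "(v, p) \<in> E" "P v" by blast
  then show "reached E A P z a"
  proof cases
    case 1
    then show ?thesis using s sa by (auto simp: reached_def)
  next
    case 2
    then have "(v, p) \<in> away E A z" using s leaf_facts assms by (auto simp: away_def)
    then show ?thesis using 2 sa assms leaf_facts
      unfolding reached_def by (metis DiffI converse_rtrancl_into_rtrancl singletonD)
  qed
qed

lemma reached_leaf_iff: "reached E A P p v \<longleftrightarrow> P v"
proof
  assume "reached E A P p v"
  then obtain s where s: "s \<in> A" "s \<noteq> p" "P s" "(s, v) \<in> (away E A p)\<^sup>*"
    by (auto simp: reached_def)
  then have "s = v" using leaf_in by (auto simp: away_def elim: rtranclE)
  then show "P v" using s by simp
qed (use leaf_facts in \<open>auto simp: reached_def\<close>)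

text \<open>The alternatives are the part merged into \<open>p\<close> and the remaining tree.
  \<open>join\<close> must separate them: the first is known at once, the second only after later
  removals.\<close>

lemma reached_neighbour_iff: "reached E A P v p \<longleftrightarrow> P p \<or> (\<exists>y\<in>A - {v}. (y, p) \<in> E \<and> reached E (A - {v}) P p y)"
proof
  let ?F = "away E A v"
  assume "reached E A P v p"
  then obtain s where s: "s \<in> A" "s \<noteq> v" "P s" "(s, p) \<in> ?F\<^sup>*"
    by (auto simp: reached_def)
  show "P p \<or> (\<exists>y\<in>A - {v}. (y, p) \<in> E \<and> reached E (A - {v}) P p y)"
  proof (cases "s = p")
    case False
    have "?F \<subseteq> (A - {v}) \<times> (A - {v})" by (auto simp: away_def)
    from first_visit[OF s(4) this False] obtain y where
      y: "(s, y) \<in> (away ?F (A - {v}) p)\<^sup>*" "(y, p) \<in> ?F" "y \<noteq> p" by blast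
    have "away ?F (A - {v}) p \<subseteq> away E (A - {v}) p" by (auto simp: away_def)
    then have "(s, y) \<in> (away E (A - {v}) p)\<^sup>*" using y rtrancl_mono by blast
    then show ?thesis using y s False unfolding reached_def by (auto simp: away_def)
  qed (use s in simp)
next
  assume "P p \<or> (\<exists>y\<in>A - {v}. (y, p) \<in> E \<and> reached E (A - {v}) P p y)"
  then show "reached E A P v p"
  proof
    assume "P p"
    then show ?thesis using leaf_facts by (auto simp: reached_def)
  next
    assume "\<exists>y\<in>A - {v}. (y, p) \<in> E \<and> reached E (A - {v}) P p y"
    then obtain y s where *: "y \<in> A" "y \<noteq> v" "(y, p) \<in> E" "s \<in> A" "s \<noteq> v" "P s"
      "(s, y) \<in> (away E (A - {v}) p)\<^sup>*" by (auto simp: reached_def)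
    have "away E (A - {v}) p \<subseteq> away E A v" by (auto simp: away_def)
    then have "(s, y) \<in> (away E A v)\<^sup>*" using * rtrancl_mono by blast
    moreover have "(y, p) \<in> away E A v" using * leaf_facts by (auto simp: away_def)
    ultimately show ?thesis using * unfolding reached_def
      by (metis DiffI rtrancl.rtrancl_into_rtrancl singletonD)
  qed
qed

text \<open>Away from \<open>v\<close> and \<open>p\<close>, both conditions are unchanged. At
  \<open>p\<close>, the leaf is an additional unreached out-neighbour exactly in case
  \<open>over\<close>. The demands arising at \<open>v\<close> ask for \<open>P p \<or> ext\<close>,
  where \<open>ext\<close> says that the remaining tree reaches \<open>p\<close>; they are handed on
  to \<open>p\<close> through \<open>settled\<close>. One bit can carry them together with the
  demand of \<open>p\<close> itself because \<open>ext\<close> fulfils them all.\<close>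

lemma valid_remove_leaf:
  "valid E A l \<longleftrightarrow>
    (\<exists>j. join ((v, p) \<in> E) ((p, v) \<in> E) (l p) (l v) = Some j \<and> valid E (A - {v}) (l(p := j)))"
proof -
  define up where "up \<longleftrightarrow> (v, p) \<in> E"
  define down where "down \<longleftrightarrow> (p, v) \<in> E"
  define P where "P = source \<circ> l"
  define ext where "ext \<longleftrightarrow> (\<exists>y\<in>A - {v}. (y, p) \<in> E \<and> reached E (A - {v}) P p y)"
  define over where "over \<longleftrightarrow> down \<and> \<not> P v"
  define j where "j = Label (P p \<or> (up \<and> P v))
    ((settled (l p) \<or> (up \<and> P v)) \<and> (\<not> settled (l v) \<or> spent (l v) \<and> up \<longrightarrow> P p)) (spent (l p) \<or> over)"
  define Q where "Q = source \<circ> l(p := j)"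
  define B where "B = A - {v, p}"
  note lff = leaf_facts
  have QP: "Q u \<longleftrightarrow> P u \<or> (u = p \<and> (v, p) \<in> E \<and> P v)" for u
    by (auto simp: Q_def P_def j_def up_def)
  have noloop: "(x, x) \<notin> E" for x using irr by (auto simp: irrefl_def)
  have rin: "reached E C R z y \<Longrightarrow> y \<in> C \<and> y \<noteq> z" for C R z y
    by (auto simp: reached_def dest: rtrancl_away_in)
  have rm: "reached E A P z a \<longleftrightarrow> reached E (A - {v}) Q z a"
    if "z \<in> A" "z \<noteq> v" "a \<in> A" "a \<noteq> v" "a \<noteq> z" for z a
    using reached_remove_leaf[OF that QP] .
  have split: "A = insert v (insert p B)" "v \<notin> insert p B" "p \<notin> B" "A - {v} = insert p B"
    using lff by (auto simp: B_def)
  have ext_eq: "ext \<longleftrightarrow> (\<exists>y. (y, p) \<in> E \<and> reached E (A - {v}) Q p y)"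
  proof -
    have "reached E (A - {v}) P p y \<longleftrightarrow> reached E (A - {v}) Q p y" for y
      by (rule reached_cong) (simp add: QP)
    then show ?thesis unfolding ext_def using rin[of "A - {v}" Q p] by blast
  qed
  have un_other: "unreached E A P z = unreached E (A - {v}) Q z" if z: "z \<in> B" for z
  proof -
    have "a \<in> unreached E A P z \<longleftrightarrow> a \<in> unreached E (A - {v}) Q z" for a
      using rm[of z a] leaf_in[of z] z noloop[of z]
      by (cases "a = v") (auto simp: unreached_def B_def)
    then show ?thesis by blast
  qed
  have un_p: "unreached E A P p = unreached E (A - {v}) Q p \<union> (if over then {v} else {})"
  proof -
    have "a \<in> unreached E A P p \<longleftrightarrow> a \<in> unreached E (A - {v}) Q p \<or> a = v \<and> over" for a
      using rm[of p a] reached_leaf_iff[of P] lff noloop[of p]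
      by (cases "a = v") (auto simp: unreached_def over_def down_def)
    then show ?thesis by auto
  qed
  have un_v: "unreached E A P v = (if up \<and> \<not> (P p \<or> ext) then {p} else {})"
  proof -
    have "a \<in> unreached E A P v \<longleftrightarrow> a = p \<and> up \<and> \<not> (P p \<or> ext)" for a
      using leaf_out[of a] lff reached_neighbour_iff[of P]
      unfolding unreached_def up_def ext_def by blast
    then show ?thesis by auto
  qed
  have st_other: "(\<exists>y. (y, u) \<in> E \<and> reached E A P u y) \<longleftrightarrow> (\<exists>y. (y, u) \<in> E \<and> reached E (A - {v}) Q u y)"
    if u: "u \<in> B" for u
  proof -
    have "(y, u) \<in> E \<and> reached E A P u y \<longleftrightarrow> (y, u) \<in> E \<and> reached E (A - {v}) Q u y" for y
      using rin[of A P u y] rin[of "A - {v}" Q u y] rm[of u y] leaf_out[of u] u unfolding B_def by blast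
    then show ?thesis by simp
  qed
  have st_p: "(\<exists>y. (y, p) \<in> E \<and> reached E A P p y) \<longleftrightarrow> ext \<or> (up \<and> P v)"
  proof -
    have "(y, p) \<in> E \<and> reached E A P p y \<longleftrightarrow>
      (y, p) \<in> E \<and> reached E (A - {v}) Q p y \<or> y = v \<and> up \<and> P v" for y
    proof (cases "y = v")
      case True
      then show ?thesis using rin[of "A - {v}" Q p v] reached_leaf_iff[of P] by (auto simp: up_def)
    next
      case False
      then show ?thesis using rin[of A P p y] rin[of "A - {v}" Q p y] rm[of p y] lff by blast
    qed
    then show ?thesis unfolding ext_eq by blast
  qed
  have st_v: "(\<exists>y. (y, v) \<in> E \<and> reached E A P v y) \<longleftrightarrow> down \<and> (P p \<or> ext)"
  proof -
    have "(y, v) \<in> E \<and> reached E A P v y \<longleftrightarrow> y = p \<and> down \<and> (P p \<or> ext)" for y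
      using reached_neighbour_iff[of P] leaf_in[of y] rin[of A P v y] lff
      unfolding ext_def[symmetric] down_def by blast
    then show ?thesis by blast
  qed
  have card_un: "card (unreached E A P p) = card (unreached E (A - {v}) Q p) + of_bool over"
    unfolding un_p by (subst card_Un_disjoint) (use fin in \<open>auto simp: unreached_def\<close>)
  have "valid E A l \<longleftrightarrow> \<not> ((\<not> settled (l v) \<and> \<not> down) \<or> (spent (l p) \<and> over)) \<and> valid E (A - {v}) (l(p := j))"
  proof -
    define bud where "bud \<longleftrightarrow> (\<forall>z\<in>B. of_bool (spent (l z)) + card (unreached E (A - {v}) Q z) \<le> 1)"
    define set where "set \<longleftrightarrow> (\<forall>u\<in>B. settled (l u) \<or> (\<exists>y. (y, u) \<in> E \<and> reached E (A - {v}) Q u y))"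
    define c where "c = card (unreached E (A - {v}) Q p)"
    have "valid E A l \<longleftrightarrow> bud \<and> set \<and> of_bool (spent (l p)) + c + of_bool over \<le> 1
        \<and> (spent (l v) \<and> up \<longrightarrow> P p \<or> ext)
        \<and> (settled (l p) \<or> ext \<or> (up \<and> P v)) \<and> (settled (l v) \<or> down \<and> (P p \<or> ext))"
    proof -
      have all_A: "(\<forall>z\<in>A. F z) \<longleftrightarrow> F v \<and> F p \<and> (\<forall>z\<in>B. F z)" for F
        using split(1) by blast
      have 1: "(\<forall>z\<in>B. of_bool (spent (l z)) + card (unreached E A P z) \<le> 1) \<longleftrightarrow> bud"
        unfolding bud_def using un_other by auto
      have 2: "(\<forall>u\<in>B. settled (l u) \<or> (\<exists>y. (y, u) \<in> E \<and> reached E A P u y)) \<longleftrightarrow> set"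
        unfolding set_def using st_other by blast
      have 3: "of_bool (spent (l v)) + card (unreached E A P v) \<le> 1 \<longleftrightarrow> (spent (l v) \<and> up \<longrightarrow> P p \<or> ext)"
        unfolding un_v by simp
      show ?thesis
        unfolding valid_def P_def[symmetric] all_A 1 2 3 st_p st_v card_un c_def[symmetric]
        by (auto simp: add.assoc)
    qed
    moreover have "valid E (A - {v}) (l(p := j)) \<longleftrightarrow> bud \<and> set \<and> of_bool (spent j) + c \<le> 1
        \<and> (settled j \<or> ext)"
    proof -
      have all_B: "(\<forall>z\<in>A - {v}. F ((l(p := j)) z) z) \<longleftrightarrow> F j p \<and> (\<forall>z\<in>B. F (l z) z)" for F
        using split(3,4) by auto
      show ?thesis
        unfolding valid_def Q_def[symmetric] all_B[of "\<lambda>l z. of_bool (spent l) + card (unreached E (A - {v}) Q z) \<le> 1"]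
          all_B[of "\<lambda>l u. settled l \<or> (\<exists>y. (y, u) \<in> E \<and> reached E (A - {v}) Q u y)"]
          bud_def set_def c_def ext_eq by blast
    qed
    ultimately show ?thesis unfolding j_def by (cases over; cases "spent (l p)"; auto simp: over_def)
  qed
  moreover have "join ((v, p) \<in> E) ((p, v) \<in> E) (l p) (l v) =
    (if (\<not> settled (l v) \<and> \<not> down) \<or> (spent (l p) \<and> over) then None else Some j)"
    by (auto simp: join_def j_def P_def up_def down_def over_def Let_def)
  ultimately show ?thesis by simp
qed

end

lemma valid_singleton: "irrefl E \<Longrightarrow> valid E {r} l \<longleftrightarrow> settled (l r)"
  by (auto simp: valid_def unreached_def reached_def irrefl_def cong: conj_cong)

lemma valid_cong: "(\<And>u. u \<in> A \<Longrightarrow> l u = l' u) \<Longrightarrow> valid E A l \<longleftrightarrow> valid E A l'"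
proof -
  assume "\<And>u. u \<in> A \<Longrightarrow> l u = l' u"
  moreover from this have "reached E A (source \<circ> l) z a = reached E A (source \<circ> l') z a" for z a
    by (intro reached_cong) simp
  ultimately show ?thesis by (simp add: valid_def unreached_def)
qed

section \<open>Connected digraphs without long cycles\<close>

context wf_digraph begin

text \<open>Supplies the path that closes a long cycle in \<open>tree_on_verts\<close>. It stays
  inside \<open>A\<close>, so a vertex outside \<open>A\<close> can be added without
  repetition.\<close>

lemma tree_on_apath:
  assumes irr: "irrefl E" and dom: "\<And>x y. x \<rightarrow>\<^bsub>G\<^esub> y \<longleftrightarrow> adj E x y"
    and "tree_on E A" "A \<subseteq> verts G" "x \<in> A" "y \<in> A"
  shows "\<exists>p. apath x p y \<and> set (awalk_verts x p) \<subseteq> A"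
proof -
  show ?thesis using assms(3-)
  proof (induction arbitrary: x y rule: tree_on.induct)
    case (single r)
    then show ?case by (intro exI[of _ "[]"]) (auto simp: apath_Nil_iff)
  next
    case (insert A v q)
    note lf = leaf_neighbour[OF irr insert.hyps(3)]
    have qA: "q \<in> A" and arc: "v \<rightarrow>\<^bsub>G\<^esub> q" "q \<rightarrow>\<^bsub>G\<^esub> v"
      using lf by (auto simp: dom adj_sym)
    obtain e f where ef: "e \<in> arcs G" "tail G e = v" "head G e = q" "f \<in> arcs G" "tail G f = q" "head G f = v"
      using arc by (auto simp: arcs_ends_conv)
    have AV: "A \<subseteq> verts G" using insert.prems by auto
    consider "x \<in> A" "y \<in> A" | "x = v" "y = v" | "x = v" "y \<in> A" | "x \<in> A" "y = v"
      using insert.prems by auto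
    then show ?case
    proof cases
      case 1
      then show ?thesis using insert.IH[OF AV, of x y] by blast
    next
      case 2
      then show ?thesis using insert.prems by (intro exI[of _ "[]"]) (auto simp: apath_Nil_iff)
    next
      case 3
      obtain p where p: "apath q p y" "set (awalk_verts q p) \<subseteq> A"
        using insert.IH[OF AV qA 3(2)] by blast
      then have "apath v (e # p) y"
        using ef insert.hyps(2) by (auto simp: apath_Cons_iff)
      then show ?thesis using p 3 ef by (intro exI[of _ "e # p"]) auto
    next
      case 4
      obtain p where p: "apath x p q" "set (awalk_verts x p) \<subseteq> A"
        using insert.IH[OF AV 4(1) qA] by blast
      have "awalk q [f] v" using ef insert.prems qA by (auto simp: awalk_simps)
      then have aw: "awalk x (p @ [f]) v" using p by (auto simp: apath_def)
      have "awalk_verts x (p @ [f]) = awalk_verts x p @ [v]"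
        using awalk_verts_append[OF aw] ef by simp
      then show ?thesis using p aw 4 insert.hyps(2)
        by (intro exI[of _ "p @ [f]"]) (auto simp: apath_def)
    qed
  qed
qed

text \<open>Take a largest \<open>A\<close> with \<open>tree_on E A\<close>. If a vertex is missing,
  connectivity gives an outside vertex \<open>w\<close> with a neighbour in \<open>A\<close>. By
  maximality \<open>w\<close> has a second one, and the path between the two inside \<open>A\<close>
  closes a cycle through \<open>w\<close>.\<close>

lemma tree_on_verts:
  assumes irr: "irrefl E" and dom: "\<And>x y. x \<rightarrow>\<^bsub>G\<^esub> y \<longleftrightarrow> adj E x y"
    and fin: "finite (verts G)" and conn: "strongly_connected G" and acyc: "\<And>p. cycle p \<Longrightarrow> length p < 3"
  shows "tree_on E (verts G)"
proof -
  let ?T = "\<lambda>A. A \<subseteq> verts G \<and> tree_on E A"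
  obtain r where "r \<in> verts G" using conn by (auto simp: strongly_connected_def)
  then have "?T {r}" by (auto intro: tree_on.single)
  moreover have "\<forall>A. ?T A \<longrightarrow> card A < Suc (card (verts G))"
    using card_mono[OF fin] by (auto simp: less_Suc_eq_le)
  ultimately obtain A where A: "?T A" and max: "\<And>B. ?T B \<Longrightarrow> card B \<le> card A"
    using ex_has_greatest_nat[of ?T "{r}" card "Suc (card (verts G))"] by blast
  have finA: "finite A" using A finite_subset[OF _ fin] by blast
  have "A = verts G"
  proof (rule ccontr)
    assume "A \<noteq> verts G"
    then obtain u where u: "u \<in> verts G" "u \<notin> A" using A by blast
    obtain a where a: "a \<in> A" using A tree_on_nonempty by blast
    then have "a \<rightarrow>\<^sup>*\<^bsub>G\<^esub> u" using conn u A by (auto simp: strongly_connected_def)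
    then have "\<exists>q w. q \<in> A \<and> w \<in> verts G \<and> w \<notin> A \<and> w \<rightarrow>\<^bsub>G\<^esub> q"
      using a u
    proof (induction rule: converse_reachable_induct)
      case (step x y)
      then have "y \<in> verts G" by (meson adj_in_verts)
      then show ?case using step
        by (cases "y \<in> A") (auto simp: dom adj_sym dest: adj_in_verts)
    qed auto
    then obtain q w where qw: "q \<in> A" "w \<in> verts G" "w \<notin> A" "adj E w q"
      by (auto simp: dom)
    have "\<not> leaf E (insert w A) w q"
    proof
      assume "leaf E (insert w A) w q"
      then have "?T (insert w A)" using A qw by (auto intro: tree_on.insert)
      then show False using max[of "insert w A"] qw finA by simp
    qed
    then obtain q' where q': "q' \<in> A" "q' \<noteq> q" "adj E w q'"
      using qw adj_irrefl[OF irr, of w] unfolding leaf_def by blast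
    obtain p where p: "apath q p q'" "set (awalk_verts q p) \<subseteq> A"
      using tree_on_apath[OF irr dom, of A q q'] A qw q' by blast
    have ap: "awalk q p q'" "distinct (awalk_verts q p)" using p by (auto simp: apath_def)
    have "q' \<rightarrow>\<^bsub>G\<^esub> w" "w \<rightarrow>\<^bsub>G\<^esub> q" using qw q' by (auto simp: dom adj_sym)
    then obtain e f where ef: "e \<in> arcs G" "tail G e = q'" "head G e = w" "f \<in> arcs G" "tail G f = w" "head G f = q"
      by (auto simp: arcs_ends_conv)
    have e: "awalk q' [e] w" using ef q' qw A by (auto simp: awalk_simps)
    have aw: "awalk q (p @ [e]) w" using ap e by auto
    have vs: "awalk_verts q (p @ [e]) = awalk_verts q p @ [w]"
      using awalk_verts_append[OF aw] ef by simp
    have "awalk w (f # p @ [e]) w"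
      using aw ef by (auto simp: awalk_Cons_iff)
    then have "cycle (f # p @ [e])"
      unfolding cycle_def using vs ap p qw by (intro exI[of _ w]) (auto simp: ef)
    \<comment> \<open>A length below 3 leaves only the two arcs at \<open>w\<close>, which would
      force \<open>q = q'\<close>.\<close>
    then have "p = []" using acyc[of "f # p @ [e]"] by simp
    then show False using ap q' by (auto simp: awalk_Nil_iff)
  qed
  then show ?thesis using A by simp
qed

end

lemma di_tree_tree_on:
  assumes "di_tree G"
  shows "digraph G \<and> tree_on (arcs_ends G) (verts G)"
proof -
  from assms interpret digraph G by (simp add: di_tree_def)
  interpret H: pair_fin_digraph "mk_symmetric G" ..
  have dom: "(x, y) \<in> arcs_ends (with_proj (mk_symmetric G)) \<longleftrightarrow> adj (arcs_ends G) x y" for x y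
    by (auto simp: parcs_mk_symmetric adj_def arcs_ends_conv)
  have irr: "irrefl (arcs_ends G)" by (auto simp: irrefl_def dest: adj_not_same)
  have cyc: "pre_digraph.cycle (with_proj (mk_symmetric G)) p \<Longrightarrow> length p < 3" for p
    using assms unfolding di_tree_def by (meson linorder_not_le)
  have "tree_on (arcs_ends G) (verts (with_proj (mk_symmetric G)))"
    using wf_digraph.tree_on_verts[OF H.wf_digraph irr dom _ _ cyc] assms
    by (simp add: di_tree_def connected_def)
  then show ?thesis using digraph_axioms by simp
qed

section \<open>Dynamic programming\<close>

text \<open>The pairs come in reverse order of removal, as on the stack: when \<open>(v, p)\<close>
  is undone, \<open>l p\<close> is the label that \<open>p\<close> received by that removal. Here
  \<open>c\<close> and \<open>d\<close> are tables of choices; \<open>d\<close> is no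
  metric.\<close>

fun backtrack :: "(nat \<Rightarrow> label \<Rightarrow> label) \<Rightarrow> (nat \<Rightarrow> label \<Rightarrow> label) \<Rightarrow> (nat \<times> nat) list \<Rightarrow>
    (nat \<Rightarrow> label) \<Rightarrow> nat \<Rightarrow> label" where
  "backtrack c d [] l = l"
| "backtrack c d ((v, p) # ps) l = backtrack c d ps (l(p := c v (l p), v := d v (l p)))"

lemma backtrack_cong:
  "(\<And>v. v \<in> fst ` set ps \<Longrightarrow> c v = c' v \<and> d v = d' v) \<Longrightarrow> backtrack c d ps l = backtrack c' d' ps l"
  by (induction ps arbitrary: l) auto

text \<open>A min-plus product along \<open>join\<close>, truncated at infinity: above
  \<open>n\<close>, \<open>h\<close> has to be a lower bound only, which is all that remains known
  once entries are capped.\<close>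

definition merged :: "nat \<Rightarrow> bool \<Rightarrow> bool \<Rightarrow> (label \<Rightarrow> nat) \<Rightarrow> (label \<Rightarrow> nat) \<Rightarrow> (label \<Rightarrow> nat) \<Rightarrow>
    (label \<Rightarrow> label) \<Rightarrow> (label \<Rightarrow> label) \<Rightarrow> bool" where
  "merged n up down f g h c d \<longleftrightarrow>
     (\<forall>a b q. join up down a b = Some q \<longrightarrow> h q \<le> f a + g b) \<and>
     (\<forall>q. h q \<le> n \<longrightarrow> join up down (c q) (d q) = Some q \<and> h q = f (c q) + g (d q))"

text \<open>
  \<open>F u q\<close> is the least cost of label \<open>q\<close> at \<open>u\<close>; values above \<open>n\<close> stand for infinity, and only for
  values up to \<open>n\<close> do \<open>c\<close> and \<open>d\<close> record meaningful choices. The third conjunct says that the tables are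
  lower bounds, the fourth that backtracking realises them.
\<close>

definition dp_inv :: "(nat \<times> nat) set \<Rightarrow> nat \<Rightarrow> nat set \<Rightarrow> (nat \<Rightarrow> label \<Rightarrow> nat) \<Rightarrow>
    (nat \<Rightarrow> label \<Rightarrow> label) \<Rightarrow> (nat \<Rightarrow> label \<Rightarrow> label) \<Rightarrow> (nat \<times> nat) list \<Rightarrow> bool" where
  "dp_inv E n A F c d ps \<longleftrightarrow>
     A \<subseteq> {..<n} \<and> fst ` set ps \<inter> A = {} \<and>
     (\<forall>S \<subseteq> {..<n}. valid E {..<n} (membership S) \<longrightarrow>
        (\<exists>l. valid E A l \<and> (\<Sum>u\<in>A. F u (l u)) \<le> card S)) \<and>
     (\<forall>l. valid E A l \<longrightarrow> (\<Sum>u\<in>A. F u (l u)) \<le> n \<longrightarrow>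
        (\<exists>S \<subseteq> {..<n}. valid E {..<n} (membership S) \<and> card S \<le> (\<Sum>u\<in>A. F u (l u)) \<and>
           (\<forall>u<n. backtrack c d ps l u = membership S u)))"

text \<open>A total cost of at most \<open>n\<close> rules out the entry \<open>Suc n\<close>, so
  only \<open>inside\<close> and \<open>outside\<close> occur and the labelling is a membership
  whose cost is the size of the set.\<close>

lemma dp_inv_init:
  assumes F: "\<And>u q. u < n \<Longrightarrow> F u q = (if q = inside then 1 else if q = outside then 0 else Suc n)"
  shows "dp_inv E n {..<n} F c d []"
proof -
  have io: "inside \<noteq> outside" by (simp add: inside_def outside_def)
  have sum: "(\<Sum>u<n. F u (l u)) = card S"
    if "\<And>u. u < n \<Longrightarrow> l u = membership S u" "S \<subseteq> {..<n}" for S l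
  proof -
    have "(\<Sum>u<n. F u (l u)) = (\<Sum>u<n. if u \<in> S then 1 else 0)"
      using that io by (intro sum.cong) (auto simp: F membership_def)
    also have "\<dots> = card S" using that(2) by (simp add: sum.If_cases Int_absorb1)
    finally show ?thesis .
  qed
  have fin: "\<exists>S \<subseteq> {..<n}. \<forall>u<n. l u = membership S u" if le: "(\<Sum>u<n. F u (l u)) \<le> n" for l
  proof (intro exI conjI allI impI)
    fix u assume "u < n"
    then have "F u (l u) \<le> n" using le member_le_sum[of u "{..<n}" "\<lambda>u. F u (l u)"] by simp
    then show "l u = membership {u. u < n \<and> l u = inside} u"
      using \<open>u < n\<close> by (auto simp: F membership_def split: if_splits)
  qed auto
  show ?thesis
    unfolding dp_inv_def
  proof (intro conjI allI impI)
    fix S :: "nat set" assume "S \<subseteq> {..<n}" "valid E {..<n} (membership S)"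
    then show "\<exists>l. valid E {..<n} l \<and> (\<Sum>u<n. F u (l u)) \<le> card S"
      using sum[of "membership S" S] by (intro exI[of _ "membership S"]) auto
  next
    fix l assume v: "valid E {..<n} l" and le: "(\<Sum>u<n. F u (l u)) \<le> n"
    from fin[OF le] obtain S where S: "S \<subseteq> {..<n}" "\<And>u. u < n \<Longrightarrow> l u = membership S u" by blast
    then show "\<exists>S\<subseteq>{..<n}. valid E {..<n} (membership S) \<and> card S \<le> (\<Sum>u<n. F u (l u)) \<and>
      (\<forall>u<n. backtrack c d [] l u = membership S u)"
      using sum[of l S] v valid_cong[of "{..<n}" l "membership S" E] by (intro exI[of _ S]) auto
  qed auto
qed

lemma dp_inv_lower:
  "dp_inv E n A F c d ps \<Longrightarrow> S \<subseteq> {..<n} \<Longrightarrow> valid E {..<n} (membership S) \<Longrightarrow>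
    \<exists>l. valid E A l \<and> (\<Sum>u\<in>A. F u (l u)) \<le> card S"
  by (simp only: dp_inv_def)

lemma dp_inv_upper:
  "dp_inv E n A F c d ps \<Longrightarrow> valid E A l \<Longrightarrow> (\<Sum>u\<in>A. F u (l u)) \<le> n \<Longrightarrow>
    \<exists>S \<subseteq> {..<n}. valid E {..<n} (membership S) \<and> card S \<le> (\<Sum>u\<in>A. F u (l u)) \<and>
      (\<forall>u<n. backtrack c d ps l u = membership S u)"
  by (simp only: dp_inv_def)

text \<open>A labelling of \<open>A\<close> is pushed forward with \<open>join\<close>, which
  preserves lower bounds. A labelling of \<open>A - {v}\<close> is pulled back with the recorded
  choices, which realises costs up to \<open>n\<close>.\<close>

lemma dp_inv_step:
  assumes irr: "irrefl E" and lf: "leaf E A v p" and inv: "dp_inv E n A F c d ps"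
    and m: "merged n ((v, p) \<in> E) ((p, v) \<in> E) (F p) (F v) h (c' v) (d' v)"
    and same: "\<And>u. u \<noteq> v \<Longrightarrow> c' u = c u \<and> d' u = d u"
    and F': "\<And>u. u \<in> A - {v} \<Longrightarrow> F' u = (if u = p then h else F u)"
  shows "dp_inv E n (A - {v}) F' c' d' ((v, p) # ps)"
proof -
  have A: "A \<subseteq> {..<n}" "fst ` set ps \<inter> A = {}" using inv by (auto simp: dp_inv_def)
  then have fin: "finite A" using finite_subset by blast
  note lff = leaf_neighbour[OF irr lf]
  note step = valid_remove_leaf[OF fin irr lf]
  let ?up = "(v, p) \<in> E" and ?down = "(p, v) \<in> E"
  have split: "(\<Sum>u\<in>A. G u) = G p + G v + (\<Sum>u\<in>A - {v, p}. G u)"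
    "(\<Sum>u\<in>A - {v}. G u) = G p + (\<Sum>u\<in>A - {v, p}. G u)" for G :: "nat \<Rightarrow> nat"
  proof -
    have eq: "A - {v} - {p} = A - {v, p}" by auto
    show 2: "(\<Sum>u\<in>A - {v}. G u) = G p + (\<Sum>u\<in>A - {v, p}. G u)"
      using sum.remove[of "A - {v}" p G] fin lff unfolding eq by simp
    show "(\<Sum>u\<in>A. G u) = G p + G v + (\<Sum>u\<in>A - {v, p}. G u)"
      using sum.remove[of A v G] fin lff 2 by simp
  qed
  have rest: "(\<Sum>u\<in>A - {v, p}. F' u (l u)) = (\<Sum>u\<in>A - {v, p}. F u (l' u))"
    if "\<And>u. u \<in> A - {v, p} \<Longrightarrow> l u = l' u" for l l'
    using that F' by (intro sum.cong) auto
  have F'p: "F' p = h" using F' lff by auto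
  show ?thesis
    unfolding dp_inv_def
  proof (intro conjI allI impI)
    fix S :: "nat set" assume S: "S \<subseteq> {..<n}" "valid E {..<n} (membership S)"
    then obtain l where l: "valid E A l" "(\<Sum>u\<in>A. F u (l u)) \<le> card S"
      using dp_inv_lower[OF inv] by blast
    then obtain j where j: "join ?up ?down (l p) (l v) = Some j" "valid E (A - {v}) (l(p := j))"
      using step by blast
    have "h j \<le> F p (l p) + F v (l v)" using m j unfolding merged_def by blast
    then have "(\<Sum>u\<in>A - {v}. F' u ((l(p := j)) u)) \<le> (\<Sum>u\<in>A. F u (l u))"
      using rest[of "l(p := j)" l] by (simp add: split F'p)
    then show "\<exists>l. valid E (A - {v}) l \<and> (\<Sum>u\<in>A - {v}. F' u (l u)) \<le> card S"
      using l j order_trans by blast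
  next
    fix l assume l: "valid E (A - {v}) l" and le: "(\<Sum>u\<in>A - {v}. F' u (l u)) \<le> n"
    define l' where "l' = l(p := c' v (l p), v := d' v (l p))"
    have l'[simp]: "l' p = c' v (l p)" "l' v = d' v (l p)" "\<And>u. u \<noteq> v \<Longrightarrow> u \<noteq> p \<Longrightarrow> l' u = l u"
      using lff by (auto simp: l'_def)
    have "h (l p) \<le> n" using le by (simp add: split F'p)
    then have jn: "join ?up ?down (l' p) (l' v) = Some (l p)" "h (l p) = F p (l' p) + F v (l' v)"
      using m unfolding merged_def by auto
    have "valid E (A - {v}) (l'(p := l p))"
      using l valid_cong[of "A - {v}" l "l'(p := l p)" E] by auto
    then have v': "valid E A l'" using step jn by blast
    have eq: "(\<Sum>u\<in>A - {v}. F' u (l u)) = (\<Sum>u\<in>A. F u (l' u))"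
      using rest[of l l'] jn by (simp add: split F'p)
    \<comment> \<open>\<open>v\<close> still belongs to \<open>A\<close> and so is not among the
      leaves on the stack; entering its choices leaves the earlier backtracking intact.\<close>
    have "c' u = c u \<and> d' u = d u" if "u \<in> fst ` set ps" for u
      using same[of u] A(2) lff that by blast
    then have bt: "backtrack c' d' ((v, p) # ps) l = backtrack c d ps l'"
      using backtrack_cong[of ps c' c d' d l'] unfolding l'_def by simp
    then show "\<exists>S\<subseteq>{..<n}. valid E {..<n} (membership S) \<and> card S \<le> (\<Sum>u\<in>A - {v}. F' u (l u)) \<and>
      (\<forall>u<n. backtrack c' d' ((v, p) # ps) l u = membership S u)"
      using dp_inv_upper[OF inv v'] le unfolding eq bt by simp
  qed (use A lff in auto)
qed

text \<open>By \<open>all\<close> there is a solution of size \<open>n\<close>, so the minimal entry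
  at the root is finite and its choices are meaningful. On a single vertex, validity is
  \<open>settled\<close>, hence the minimum over settled labels.\<close>

lemma dp_inv_final:
  assumes irr: "irrefl E" and inv: "dp_inv E n {r} F c d ps"
    and q: "settled q" "\<And>q'. settled q' \<Longrightarrow> F r q \<le> F r q'"
    and all: "valid E {..<n} (membership {..<n})"
  obtains S where "S \<subseteq> {..<n}" "valid E {..<n} (membership S)"
    "\<And>u. u < n \<Longrightarrow> backtrack c d ps ((\<lambda>_. outside)(r := q)) u = membership S u"
    "\<And>S'. S' \<subseteq> {..<n} \<Longrightarrow> valid E {..<n} (membership S') \<Longrightarrow> card S \<le> card S'"
proof -
  have low: "F r q \<le> card S" if S: "S \<subseteq> {..<n}" "valid E {..<n} (membership S)" for S
  proof -
    obtain l where "valid E {r} l" "(\<Sum>u\<in>{r}. F u (l u)) \<le> card S"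
      using dp_inv_lower[OF inv S] by blast
    then show ?thesis using q(2)[of "l r"] valid_singleton[OF irr] by force
  qed
  let ?l = "(\<lambda>_. outside)(r := q)"
  have "F r q \<le> n" using low[OF order_refl all] by simp
  moreover have "valid E {r} ?l" using valid_singleton[OF irr] q by simp
  ultimately obtain S where S: "S \<subseteq> {..<n}" "valid E {..<n} (membership S)" "card S \<le> F r q"
    "\<forall>u<n. backtrack c d ps ?l u = membership S u"
    using dp_inv_upper[OF inv, of ?l] by auto
  show ?thesis
    by (rule that[of S]) (use S low order_trans in blast)+
qed

section \<open>Reasoning about programs\<close>

lemma set_simps[simp]:
  "reg (set_reg x v s) y = (if y = x then v else reg s y)"
  "arr (set_reg x v s) = arr s"
  "reg (set_arr a i v s) = reg s"
  "arr (set_arr a i v s) b j = (if b = a \<and> j = i then v else arr s b j)"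
  by (auto simp: set_reg_def set_arr_def)

text \<open>Loop-free commands are evaluated symbolically. The value at \<open>While\<close> is a
  dummy, since \<open>safe\<close> rejects loops.\<close>

fun sem :: "com \<Rightarrow> state \<Rightarrow> state" where
  "sem Skip s = s"
| "sem (Assign x e) s = set_reg x (aval s e) s"
| "sem (Store a i e) s = set_arr a (aval s i) (aval s e) s"
| "sem (Seq c d) s = sem d (sem c s)"
| "sem (Ite b c d) s = (if tval s b then sem c s else sem d s)"
| "sem (While b c) s = s"

fun safe :: "nat \<Rightarrow> com \<Rightarrow> state \<Rightarrow> bool" where
  "safe W Skip s = True"
| "safe W (Assign x e) s = exp_ok W s e"
| "safe W (Store a i e) s = (exp_ok W s i \<and> exp_ok W s e)"
| "safe W (Seq c d) s = (safe W c s \<and> safe W d (sem c s))"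
| "safe W (Ite b c d) s = (test_ok W s b \<and> (if tval s b then safe W c s else safe W d s))"
| "safe W (While b c) s = False"

text \<open>The bound must not depend on the state, so that a loop body has one constant cost;
  adding up both branches of \<open>Ite\<close> is precise enough for that.\<close>

fun cost :: "com \<Rightarrow> nat" where
  "cost (Seq c d) = cost c + cost d"
| "cost (Ite b c d) = 1 + cost c + cost d"
| "cost _ = 1"

lemma exec_sem: "safe W c s \<Longrightarrow> \<exists>t \<le> cost c. exec W c s t (sem c s)"
proof (induction c arbitrary: s)
  case (Seq c d)
  then obtain t u where "t \<le> cost c" "exec W c s t (sem c s)" "u \<le> cost d" "exec W d (sem c s) u (sem d (sem c s))"
    by fastforce
  then show ?case by (intro exI[of _ "t + u"]) (auto intro: exec.Seq)
next
  case (Ite b c d)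
  show ?case
  proof (cases "tval s b")
    case True
    with Ite obtain t where "t \<le> cost c" "exec W c s t (sem c s)" by auto
    with Ite.prems True have "exec W (Ite b c d) s (1 + t) (sem c s)" by (intro exec.IteTrue) auto
    then show ?thesis using \<open>t \<le> cost c\<close> True by (intro exI[of _ "1 + t"]) auto
  next
    case False
    with Ite obtain t where "t \<le> cost d" "exec W d s t (sem d s)" by auto
    with Ite.prems False have "exec W (Ite b c d) s (1 + t) (sem d s)" by (intro exec.IteFalse) auto
    then show ?thesis using \<open>t \<le> cost d\<close> False by (intro exI[of _ "1 + t"]) auto
  qed
qed (auto simp del: One_nat_def intro!: exI[of _ 1] intro: exec.intros)

definition halts :: "nat \<Rightarrow> com \<Rightarrow> state \<Rightarrow> nat \<Rightarrow> (state \<Rightarrow> bool) \<Rightarrow> bool" where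
  "halts W c s T Q \<longleftrightarrow> (\<exists>t s'. exec W c s t s' \<and> t \<le> T \<and> Q s')"

lemma halts_sem: "safe W c s \<Longrightarrow> Q (sem c s) \<Longrightarrow> halts W c s (cost c) Q"
  using exec_sem unfolding halts_def by blast

lemma halts_Seq:
  assumes "halts W c s T Q" "\<And>s'. Q s' \<Longrightarrow> halts W d s' U R"
  shows "halts W (Seq c d) s (T + U) R"
proof -
  obtain t s' where 1: "exec W c s t s'" "t \<le> T" "Q s'" using assms(1) by (auto simp: halts_def)
  obtain u s'' where 2: "exec W d s' u s''" "u \<le> U" "R s''" using assms(2)[OF 1(3)] by (auto simp: halts_def)
  show ?thesis unfolding halts_def
    using exec.Seq[OF 1(1) 2(1)] 1 2 by (intro exI[of _ "t + u"] exI[of _ s'']) auto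
qed

lemma halts_weaken: "halts W c s T Q \<Longrightarrow> T \<le> U \<Longrightarrow> (\<And>s'. Q s' \<Longrightarrow> R s') \<Longrightarrow> halts W c s U R"
  unfolding halts_def using order_trans by blast

text \<open>The body is loop-free, so \<open>cost c\<close> bounds every round alike, and
  \<open>f\<close> bounds the number of rounds. The leading 1 pays for the last, failing
  test.\<close>

lemma halts_While:
  fixes f :: "state \<Rightarrow> nat"
  assumes "I s"
    and "\<And>s. I s \<Longrightarrow> test_ok W s b"
    and "\<And>s. I s \<Longrightarrow> tval s b \<Longrightarrow> safe W c s \<and> I (sem c s) \<and> f (sem c s) < f s"
  shows "halts W (While b c) s (1 + (1 + cost c) * f s) (\<lambda>s'. I s' \<and> \<not> tval s' b)"
  using assms(1)
proof (induction "f s" arbitrary: s rule: less_induct)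
  case less
  show ?case
  proof (cases "tval s b")
    case False
    then show ?thesis using exec.WhileFalse[OF assms(2)[OF less.prems] False] less.prems
      unfolding halts_def by fastforce
  next
    case True
    note step = assms(3)[OF less.prems True]
    obtain t where t: "exec W c s t (sem c s)" "t \<le> cost c" using exec_sem step by blast
    from less.hyps[of "sem c s"] step obtain u s' where
      u: "exec W (While b c) (sem c s) u s'" "u \<le> 1 + (1 + cost c) * f (sem c s)" "I s' \<and> \<not> tval s' b"
      unfolding halts_def by blast
    have "(1 + cost c) * f (sem c s) + (1 + cost c) \<le> (1 + cost c) * f s"
      using step mult_le_mono2[of "Suc (f (sem c s))" "f s" "1 + cost c"] by (simp add: Suc_le_eq)
    then have "1 + t + u \<le> 1 + (1 + cost c) * f s" using t u by linarith
    then show ?thesis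
      using exec.WhileTrue[OF assms(2)[OF less.prems] True t(1) u(1)] u(3) unfolding halts_def by blast
  qed
qed

definition seqs :: "com list \<Rightarrow> com" where
  "seqs cs = foldr Seq cs Skip"

lemma seqs_simps[simp]: "seqs [] = Skip" "seqs (c # cs) = Seq c (seqs cs)"
  by (simp_all add: seqs_def)

text \<open>Treats iterations over finite lists that are unrolled in the program text;
  \<open>D\<close> collects the items already processed.\<close>

lemma seqs_invariant:
  assumes "\<And>x D s. x \<in> set xs \<Longrightarrow> I D s \<Longrightarrow> safe W (f x) s \<and> I (insert x D) (sem (f x) s)"
    and "I D s"
  shows "safe W (seqs (map f xs)) s \<and> I (D \<union> set xs) (sem (seqs (map f xs)) s)"
  using assms
proof (induction xs arbitrary: D s)
  case (Cons x xs)
  then have 1: "safe W (f x) s" "I (insert x D) (sem (f x) s)" by auto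
  from Cons.IH[OF _ this(2)] Cons.prems(1) have
    "safe W (seqs (map f xs)) (sem (f x) s)" "I (insert x D \<union> set xs) (sem (seqs (map f xs)) (sem (f x) s))"
    by auto
  then show ?case using 1 by simp
qed simp

section \<open>The program\<close>

text \<open>
  Registers: 2 scans vertices or arcs; 3 and 4 hold the current leaf and its neighbour, 5 and 6
  whether there is an arc from, respectively to, the leaf; 7 is the height of the stack of removed
  leaves and later the length of the output; 8 is the root; 9 and 10 the best cost and label at the
  root; 13 holds \<open>n + 1\<close>, which serves as infinity; \<open>20 + code q\<close> is the new table entry for \<open>q\<close>.

  Arrays: 2 and 3 hold the number and the sum of the remaining out-neighbours, 4 and 5 those of the
  in-neighbours; 6 and 7 the stack of pairs of a removed leaf and its neighbour; 8 the labels found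
  by backtracking; \<open>table q\<close> the costs, \<open>choice q\<close> and \<open>choice' q\<close> at a removed leaf the labels of its
  neighbour and of itself from which \<open>q\<close> at the neighbour arose.
\<close>

definition labels :: "label list" where
  "labels = [Label a b c. a \<leftarrow> [False, True], b \<leftarrow> [False, True], c \<leftarrow> [False, True]]"

lemma set_labels[simp]: "set labels = UNIV"
proof -
  have "q \<in> set labels" for q by (cases q) (auto simp: labels_def)
  then show ?thesis by blast
qed

definition code :: "label \<Rightarrow> nat" where
  "code q = 4 * of_bool (source q) + 2 * of_bool (settled q) + of_bool (spent q)"

lemma code_less: "code q < 8"
  by (simp add: code_def)

lemma code_eq_iff[simp]: "code q = code q' \<longleftrightarrow> q = q'"
  by (cases q; cases q') (auto simp: code_def split: if_splits)

text \<open>Cells never written hold 0 and thus read as \<open>outside\<close>, so the untouched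
  choice arrays and array 8 contain codes of labels from the start.\<close>

lemma code_outside[simp]: "code outside = 0"
  by (simp add: code_def outside_def)

abbreviation "table q \<equiv> 10 + code q"
abbreviation "choice q \<equiv> 20 + code q"
abbreviation "choice' q \<equiv> 30 + code q"

abbreviation (input) "incr x \<equiv> Assign x (Plus (V x) (N 1))"
abbreviation (input) "update a i e \<equiv> Store a i (Plus (Get a i) e)"
abbreviation (input) "downdate a i e \<equiv> Store a i (Minus (Get a i) e)"

definition count_arcs_body :: com where
  "count_arcs_body = (seqs
    [Assign 11 (Get 0 (V 2)), Assign 12 (Get 1 (V 2)),
     update 2 (V 11) (N 1), update 3 (V 11) (V 12),
     update 4 (V 12) (N 1), update 5 (V 12) (V 11), incr 2])"

definition count_arcs :: com where
  "count_arcs = While (Less (V 2) (V 1)) count_arcs_body"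

definition init_tables_body :: com where
  "init_tables_body = (Seq
     (seqs (map (\<lambda>q. Store (table q) (V 2) (if q = inside then N 1 else if q = outside then N 0 else V 13)) labels))
     (incr 2))"

definition init_tables :: com where
  "init_tables = While (Less (V 2) (V 0)) init_tables_body"

text \<open>
  The unique neighbour of a leaf can be read off the sums, so no adjacency lists are needed. Counting
  alone does not suffice: a vertex with one out- and one in-neighbour is a leaf only if these coincide,
  which the last clause tests.
\<close>

definition is_leaf :: test where
  "is_leaf = (let out = Get 2 (V 3); inn = Get 4 (V 3) in
     Conj (Conj (Less out (N 2)) (Less inn (N 2))) (Conj (Less (N 0) (Plus out inn))
       (Neg (Conj (Eq (Plus out inn) (N 2)) (Neg (Eq (Get 3 (V 3)) (Get 5 (V 3))))))))"

text \<open>Clearing the counts of the removed vertex makes \<open>is_leaf\<close> fail there when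
  the scan meets it later.\<close>

definition detach :: com where
  "detach = seqs
    [Assign 5 (Get 2 (V 3)), Assign 6 (Get 4 (V 3)),
     Ite (Eq (V 5) (N 1)) (Assign 4 (Get 3 (V 3))) (Assign 4 (Get 5 (V 3))),
     Ite (Eq (V 5) (N 1)) (Seq (downdate 4 (V 4) (N 1)) (downdate 5 (V 4) (V 3))) Skip,
     Ite (Eq (V 6) (N 1)) (Seq (downdate 2 (V 4) (N 1)) (downdate 3 (V 4) (V 3))) Skip,
     Store 2 (V 3) (N 0), Store 4 (V 3) (N 0),
     Store 6 (V 7) (V 3), Store 7 (V 7) (V 4), incr 7]"

definition entries :: "(bool \<times> bool \<times> label \<times> label) list" where
  "entries = List.product [False, True] (List.product [False, True] (List.product labels labels))"

lemma set_entries[simp]: "set entries = UNIV"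
proof -
  have "{False, True} = UNIV" by auto
  then show ?thesis by (simp only: entries_def set_product list.set set_labels UNIV_Times_UNIV)
qed

text \<open>\<open>join\<close> is evaluated when the program is written down, not by the machine:
  each of the 256 entries becomes a command with literal \<open>up\<close>, \<open>down\<close>,
  \<open>a\<close> and \<open>b\<close>, and registers 5 and 6 select those that apply.\<close>

definition relax :: "bool \<times> bool \<times> label \<times> label \<Rightarrow> com" where
  "relax = (\<lambda>(up, down, a, b). case join up down a b of None \<Rightarrow> Skip | Some q \<Rightarrow>
     let e = Plus (Get (table a) (V 4)) (Get (table b) (V 3)) in
     Ite (Conj (Conj (Eq (V 5) (N (of_bool up))) (Eq (V 6) (N (of_bool down)))) (Less e (V (20 + code q))))
       (seqs [Assign (20 + code q) e, Store (choice q) (V 3) (N (code a)), Store (choice' q) (V 3) (N (code b))])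
       Skip)"

text \<open>The new row is built in registers because the old entries at \<open>p\<close> are still
  being read meanwhile.\<close>

definition merge :: com where
  "merge = seqs
    [seqs (map (\<lambda>q. Assign (20 + code q) (V 13)) labels),
     seqs (map relax entries),
     seqs (map (\<lambda>q. Store (table q) (V 4) (V (20 + code q))) labels)]"

text \<open>
  After a removal, the neighbour is the only vertex that can have become a leaf, so it is examined
  next; the scan of all vertices resumes when the current vertex is no leaf. Every iteration thus
  removes a vertex or advances the scan.
\<close>

definition peel_body :: com where
  "peel_body = (Ite is_leaf
     (seqs [detach, merge, Assign 8 (V 4), Assign 3 (V 4)])
     (seqs [incr 2, Assign 3 (V 2)]))"

definition peel :: com where
  "peel = While (Less (V 2) (V 0)) peel_body"

definition choose_root :: com where
  "choose_root = seqs
    [Assign 9 (Get (table inside) (V 8)), Assign 10 (N (code inside)),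
     seqs (map (\<lambda>q. Ite (Less (Get (table q) (V 8)) (V 9))
       (Seq (Assign 9 (Get (table q) (V 8))) (Assign 10 (N (code q)))) Skip) (filter settled labels)),
     Store 8 (V 8) (V 10)]"

text \<open>Register 14 freezes the label of \<open>p\<close>: the matching branch overwrites array
  8 at \<open>p\<close>, and the tests after it must not see the new value.\<close>

definition trace_back_body :: com where
  "trace_back_body = (seqs
    [Assign 7 (Minus (V 7) (N 1)), Assign 3 (Get 6 (V 7)), Assign 4 (Get 7 (V 7)), Assign 14 (Get 8 (V 4)),
     seqs (map (\<lambda>q. Ite (Eq (V 14) (N (code q)))
       (Seq (Store 8 (V 4) (Get (choice q) (V 3))) (Store 8 (V 3) (Get (choice' q) (V 3)))) Skip) labels)])"

definition trace_back :: com where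
  "trace_back = While (Less (N 0) (V 7)) trace_back_body"

text \<open>Register 7 is 0 once the stack is empty and can count the output. Array 0 may be
  overwritten because the tails are read only by \<open>count_arcs\<close>.\<close>

definition collect_body :: com where
  "collect_body = (Seq
     (Ite (Eq (Get 8 (V 2)) (N (code inside))) (Seq (Store 0 (V 7) (V 2)) (incr 7)) Skip) (incr 2))"

definition collect :: com where
  "collect = While (Less (V 2) (V 0)) collect_body"

definition program :: com where
  "program = seqs
    [count_arcs, Assign 2 (N 0), Assign 13 (Plus (V 0) (N 1)), init_tables, Assign 2 (N 0), peel,
     choose_root, trace_back, Assign 2 (N 0), collect, Assign 0 (V 7)]"

section \<open>Correctness of the program\<close>

definition degrees :: "(nat \<times> nat) set \<Rightarrow> state \<Rightarrow> nat \<Rightarrow> bool" where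
  "degrees E s u \<longleftrightarrow>
     arr s 2 u = card {y. (u, y) \<in> E} \<and> arr s 3 u = \<Sum>{y. (u, y) \<in> E} \<and>
     arr s 4 u = card {y. (y, u) \<in> E} \<and> arr s 5 u = \<Sum>{y. (y, u) \<in> E}"

lemma finite_sections:
  assumes "finite E"
  shows "finite {y. (u, y) \<in> E}" "finite {y. (y, u) \<in> E}"
proof -
  have "{y. (u, y) \<in> E} \<subseteq> snd ` E" "{y. (y, u) \<in> E} \<subseteq> fst ` E" by force+
  then show "finite {y. (u, y) \<in> E}" "finite {y. (y, u) \<in> E}"
    using assms finite_subset by blast+
qed

lemma card_section_insert:
  assumes "finite E" "(a, b) \<notin> E"
  shows "card {y. (u, y) \<in> insert (a, b) E} = card {y. (u, y) \<in> E} + of_bool (u = a)"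
    "card {y. (y, u) \<in> insert (a, b) E} = card {y. (y, u) \<in> E} + of_bool (u = b)"
    "\<Sum>{y. (u, y) \<in> insert (a, b) E} = \<Sum>{y. (u, y) \<in> E} + (if u = a then b else 0)"
    "\<Sum>{y. (y, u) \<in> insert (a, b) E} = \<Sum>{y. (y, u) \<in> E} + (if u = b then a else 0)"
proof -
  have *: "{y. (u, y) \<in> insert (a, b) E} = (if u = a then insert b {y. (u, y) \<in> E} else {y. (u, y) \<in> E})"
    "{y. (y, u) \<in> insert (a, b) E} = (if u = b then insert a {y. (y, u) \<in> E} else {y. (y, u) \<in> E})"
    by auto
  show "card {y. (u, y) \<in> insert (a, b) E} = card {y. (u, y) \<in> E} + of_bool (u = a)"
    "card {y. (y, u) \<in> insert (a, b) E} = card {y. (y, u) \<in> E} + of_bool (u = b)"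
    "\<Sum>{y. (u, y) \<in> insert (a, b) E} = \<Sum>{y. (u, y) \<in> E} + (if u = a then b else 0)"
    "\<Sum>{y. (y, u) \<in> insert (a, b) E} = \<Sum>{y. (y, u) \<in> E} + (if u = b then a else 0)"
    unfolding * using assms finite_sections[OF assms(1)] by (auto simp: add.commute)
qed

lemma card_sum_subset_lessThan:
  assumes "X \<subseteq> {..<n :: nat}"
  shows "card X \<le> n" "\<Sum>X \<le> n * n"
proof -
  show c: "card X \<le> n" using card_mono[OF _ assms] by simp
  have "\<Sum>X \<le> card X * n" using sum_bounded_above[of X id n] assms by fastforce
  then show "\<Sum>X \<le> n * n" using c mult_le_mono1 order_trans by blast
qed

text \<open>The bounds on \<open>W\<close> follow the values that occur: 64 covers the literals of
  the program, \<open>n * n\<close> a sum of neighbours, \<open>2 * n + 2\<close> the sum of two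
  table entries of at most \<open>n + 1\<close> each, and \<open>length es\<close> the scan of the
  arcs.\<close>

locale ditree_input =
  fixes n :: nat and es :: "(nat \<times> nat) list" and W :: nat and E
  assumes E_def: "E = set es"
    and pos: "0 < n" and dist: "distinct es" and closed: "E \<subseteq> {..<n} \<times> {..<n}" and irr: "irrefl E"
    and tree: "tree_on E {..<n}"
    and W: "64 \<le> W" "n * n \<le> W" "2 * n + 2 \<le> W" "length es \<le> W"
begin

lemma section_bounds:
  assumes "F \<subseteq> E"
  shows "card {y. (u, y) \<in> F} \<le> n" "card {y. (y, u) \<in> F} \<le> n"
    "\<Sum>{y. (u, y) \<in> F} \<le> n * n" "\<Sum>{y. (y, u) \<in> F} \<le> n * n"
proof -
  have "{y. (u, y) \<in> F} \<subseteq> {..<n}" "{y. (y, u) \<in> F} \<subseteq> {..<n}" using assms closed by auto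
  then show "card {y. (u, y) \<in> F} \<le> n" "card {y. (y, u) \<in> F} \<le> n"
    "\<Sum>{y. (u, y) \<in> F} \<le> n * n" "\<Sum>{y. (y, u) \<in> F} \<le> n * n"
    using card_sum_subset_lessThan by blast+
qed

definition counted :: "state \<Rightarrow> bool" where
  "counted s \<longleftrightarrow> reg s 2 \<le> length es \<and> reg s 0 = n \<and> reg s 1 = length es \<and>
     (\<forall>r. r \<notin> {0, 1, 2, 11, 12} \<longrightarrow> reg s r = 0) \<and>
     (\<forall>j < length es. arr s 0 j = fst (es ! j) \<and> arr s 1 j = snd (es ! j)) \<and>
     (\<forall>a j. 6 \<le> a \<longrightarrow> arr s a j = 0) \<and>
     (\<forall>u. degrees (set (take (reg s 2) es)) s u)"

lemma counted_step:
  assumes c: "counted s" and lt: "reg s 2 < length es"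
  shows "safe W count_arcs_body s \<and> counted (sem count_arcs_body s) \<and> reg (sem count_arcs_body s) 2 = reg s 2 + 1"
proof -
  define i where "i = reg s 2"
  obtain a b where ab: "es ! i = (a, b)" by fastforce
  let ?F = "set (take i es)" and ?F' = "set (take (Suc i) es)"
  have lt': "i < length es" using lt i_def by simp
  have F': "?F' = insert (a, b) ?F" using lt' ab by (simp add: take_Suc_conv_app_nth)
  \<comment> \<open>Here distinctness of the list matters: the counts are to be sizes of neighbour
    sets, so no arc may be counted twice.\<close>
  have new: "(a, b) \<notin> ?F"
  proof
    assume "(a, b) \<in> ?F"
    then obtain j where "j < i" "es ! j = es ! i" using ab lt' by (auto simp: in_set_conv_nth)
    then show False using dist lt' by (simp add: nth_eq_iff_index_eq)
  qed
  have sub: "?F' \<subseteq> E" unfolding E_def by (rule set_take_subset)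
  have "(a, b) \<in> E" using ab lt' unfolding E_def by (metis nth_mem)
  then have abn: "a < n" "b < n" using closed by auto
  have F: "\<And>u. degrees ?F s u" using c by (simp add: counted_def i_def)
  note ins = card_section_insert[OF finite_set new, folded F']
  note bnd = section_bounds[OF sub]
  have le: "n \<le> W" "i < W" "length es \<le> W" using W lt' by auto
  have d: "arr s 2 a + 1 = card {y. (a, y) \<in> ?F'}" "arr s 3 a + b = \<Sum>{y. (a, y) \<in> ?F'}"
     "arr s 4 b + 1 = card {y. (y, b) \<in> ?F'}" "arr s 5 b + a = \<Sum>{y. (y, b) \<in> ?F'}"
    using F[of a] F[of b] by (simp_all add: ins degrees_def)
  have dW: "arr s 2 a + 1 \<le> W" "arr s 3 a + b \<le> W" "arr s 4 b + 1 \<le> W" "arr s 5 b + a \<le> W"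
    using bnd[of a] bnd[of b] W(2) le(1) order_trans unfolding d by blast+
  have ab': "arr s 0 i = a" "arr s (Suc 0) i = b" using c lt' ab by (auto simp: counted_def)
  have "safe W count_arcs_body s"
    unfolding count_arcs_body_def using dW abn le ab' c by (simp add: i_def[symmetric] counted_def)
  moreover have "counted (sem count_arcs_body s)"
  proof -
    have "degrees ?F' (sem count_arcs_body s) u" for u
      using F[of u] F[of a] F[of b] unfolding degrees_def count_arcs_body_def by (simp add: ab' i_def[symmetric] ins)
    moreover have "reg (sem count_arcs_body s) 2 = Suc i" by (simp add: count_arcs_body_def i_def)
    ultimately have "\<forall>u. degrees (set (take (reg (sem count_arcs_body s) 2) es)) (sem count_arcs_body s) u"
      by simp
    moreover have "reg (sem count_arcs_body s) 2 \<le> length es"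
      using lt' by (simp add: count_arcs_body_def i_def)
    ultimately show ?thesis unfolding counted_def
      by (intro conjI) (use c in \<open>auto simp: counted_def count_arcs_body_def\<close>)
  qed
  moreover have "reg (sem count_arcs_body s) 2 = reg s 2 + 1" by (simp add: count_arcs_body_def)
  ultimately show ?thesis by blast
qed

lemma counted_input: "counted (input_state n es)"
  by (auto simp: counted_def input_state_def degrees_def)

lemma halts_count_arcs:
  "halts W count_arcs (input_state n es)
     (1 + (1 + cost count_arcs_body) * length es)
     (\<lambda>s. counted s \<and> reg s 2 = length es)"
proof -
  have "halts W count_arcs (input_state n es)
     (1 + (1 + cost count_arcs_body) * (length es - reg (input_state n es) 2))
     (\<lambda>s. counted s \<and> \<not> tval s (Less (V 2) (V 1)))"
    unfolding count_arcs_def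
  proof (rule halts_While[where I = counted and f = "\<lambda>s. length es - reg s 2"])
    fix s assume "counted s" "tval s (Less (V 2) (V 1))"
    then have "reg s 2 < length es" "counted s" by (auto simp: counted_def)
    then show "safe W count_arcs_body s \<and> counted (sem count_arcs_body s) \<and> length es - reg (sem count_arcs_body s) 2 < length es - reg s 2"
      using counted_step[of s] by simp
  next
    fix s assume "counted s"
    then show "test_ok W s (Less (V 2) (V 1))" using W by (auto simp: counted_def)
  qed (rule counted_input)
  then show ?thesis
    by (rule halts_weaken) (auto simp: input_state_def counted_def)
qed

text \<open>The strict test against registers that start at \<open>n + 1\<close> admits only sums up
  to \<open>n\<close>, so an entry becomes finite exactly when choices are recorded for it. The
  remaining choice cells keep their contents, which \<open>old\<close> guarantees to be codes of
  labels.\<close>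

lemma merge_spec:
  assumes r: "reg s 3 = x" "reg s 4 = p" "reg s 5 = of_bool up" "reg s 6 = of_bool down" "reg s 13 = n + 1"
    and xp: "x < n" "p < n"
    and f: "\<And>q. arr s (table q) p = f q" "\<And>q. f q \<le> n + 1"
    and g: "\<And>q. arr s (table q) x = g q" "\<And>q. g q \<le> n + 1"
    and old: "\<And>q. arr s (choice q) x = code (c q)" "\<And>q. arr s (choice' q) x = code (d q)"
  defines "s' \<equiv> sem merge s"
  shows "safe W merge s" "\<And>r. r < 20 \<Longrightarrow> reg s' r = reg s r"
    "\<And>a j. a < 10 \<Longrightarrow> arr s' a j = arr s a j"
    "\<And>q j. j \<noteq> p \<Longrightarrow> arr s' (table q) j = arr s (table q) j"
    "\<And>q j. j \<noteq> x \<Longrightarrow> arr s' (choice q) j = arr s (choice q) j"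
    "\<And>q j. j \<noteq> x \<Longrightarrow> arr s' (choice' q) j = arr s (choice' q) j"
    "\<exists>h c d. (\<forall>q. arr s' (table q) p = h q \<and> h q \<le> n + 1 \<and> arr s' (choice q) x = code (c q) \<and>
       arr s' (choice' q) x = code (d q)) \<and> merged n up down f g h c d"
proof -
  let ?best = "\<lambda>(t :: state) q. reg t (20 + code q)"
  have le: "n \<le> W" "n + 1 \<le> W" "x \<le> W" "p \<le> W" using W xp by auto
  have fg: "f a + g b \<le> W" for a b using f(2)[of a] g(2)[of b] W by simp
  have fgW: "f a \<le> W" "g a \<le> W" for a using f(2)[of a] g(2)[of a] W by auto
  have cW: "code q \<le> W" for q using code_less[of q] W by simp
  have cl: "code q < 8" for q by (rule code_less)
  have ne: "20 + code q \<noteq> 30 + code q'" "30 + code q \<noteq> 20 + code q'" for q q' using cl[of q] cl[of q'] by auto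
  define same where "same = (\<lambda>t :: state. (\<forall>r<20. reg t r = reg s r) \<and> (\<forall>a j. a < 20 \<longrightarrow> arr t a j = arr s a j) \<and>
     (\<forall>a j. j \<noteq> x \<longrightarrow> arr t a j = arr s a j))"
  let ?c1 = "seqs (map (\<lambda>q. Assign (20 + code q) (V 13)) labels)"
  define I1 where "I1 = (\<lambda>D (t :: state). same t \<and> arr t = arr s \<and> (\<forall>q \<in> D. ?best t q = n + 1))"
  have 1: "safe W ?c1 s \<and> I1 ({} \<union> set labels) (sem ?c1 s)"
  proof (rule seqs_invariant)
    fix q D t assume "I1 D t"
    then show "safe W (Assign (20 + code q) (V 13)) t \<and> I1 (insert q D) (sem (Assign (20 + code q) (V 13)) t)"
      using r le by (auto simp: I1_def same_def)
  qed (simp add: I1_def same_def)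
  define s1 where "s1 = sem ?c1 s"
  let ?c2 = "seqs (map relax entries)"
  define I2 where "I2 = (\<lambda>D (t :: state). same t \<and> (\<forall>q. ?best t q \<le> n + 1) \<and>
     (\<forall>(up', down', a, b) \<in> D. up' = up \<longrightarrow> down' = down \<longrightarrow>
        (\<forall>q. join up down a b = Some q \<longrightarrow> ?best t q \<le> f a + g b)) \<and>
     (\<forall>q. \<exists>a b. arr t (choice q) x = code a \<and> arr t (choice' q) x = code b \<and>
        (?best t q \<le> n \<longrightarrow> join up down a b = Some q \<and> ?best t q = f a + g b)))"
  have "I1 UNIV s1" using 1 by (simp add: s1_def)
  then have I2_init: "I2 {} s1" using old by (auto simp: I1_def I2_def)
  have 2: "safe W ?c2 s1 \<and> I2 ({} \<union> set entries) (sem ?c2 s1)"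
  proof (rule seqs_invariant[where I = I2])
    fix e :: "bool \<times> bool \<times> label \<times> label" and D t assume I: "I2 D t"
    obtain up' down' a b where e: "e = (up', down', a, b)" by (cases e)
    have st: "reg t 3 = x" "reg t 4 = p" "reg t 5 = of_bool up" "reg t 6 = of_bool down"
      "arr t (table q) p = f q" "arr t (table q) x = g q" for q
      using I r f g cl[of q] by (auto simp: I2_def same_def)
    have bl: "?best t q \<le> W" for q using I le order_trans unfolding I2_def by blast
    show "safe W (relax e) t \<and> I2 (insert e D) (sem (relax e) t)"
    proof (cases "up' = up \<and> down' = down \<and> (\<exists>q. join up down a b = Some q \<and> f a + g b < ?best t q)")
      case False
      have "sem (relax e) t = t \<and> safe W (relax e) t"
      proof (cases "join up' down' a b")
        case None
        then show ?thesis by (simp add: relax_def e)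
      next
        case (Some q)
        then have "\<not> (up' = up \<and> down' = down \<and> f a + g b < ?best t q)" using False by blast
        moreover have "1 \<le> W" using W(1) by simp
        ultimately show ?thesis using Some st bl[of q] le fg[of a b] fgW
          by (auto simp: relax_def e Let_def)
      qed
      moreover have "I2 (insert e D) t"
        using I False unfolding I2_def e by (auto simp: not_less)
      ultimately show ?thesis by simp
    next
      case True
      then obtain q where q: "up' = up" "down' = down" "join up down a b = Some q" "f a + g b < ?best t q"
        by blast
      let ?t = "sem (relax e) t"
      have t: "?t = set_arr (choice' q) x (code b) (set_arr (choice q) x (code a) (set_reg (20 + code q) (f a + g b) t))"
        using st q by (simp add: relax_def e Let_def)
      have sf: "safe W (relax e) t"
        using st bl le fg fgW W q cW by (auto simp: relax_def e Let_def)
      have bt: "?best ?t q' = (if q' = q then f a + g b else ?best t q')" for q'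
        unfolding t by simp
      have ch: "arr ?t (choice q') x = (if q' = q then code a else arr t (choice q') x)"
        "arr ?t (choice' q') x = (if q' = q then code b else arr t (choice' q') x)" for q'
        unfolding t using ne by auto
      have sm: "same ?t" using I cl unfolding t I2_def same_def by auto
      have mono: "?best ?t q' \<le> ?best t q'" for q' using q by (simp add: bt)
      have le': "?best t q' \<le> n + 1" for q' using I by (simp add: I2_def)
      have "I2 (insert e D) ?t"
        unfolding I2_def
      proof (intro conjI)
        show "same ?t" by (rule sm)
        show "\<forall>q. ?best ?t q \<le> n + 1" using le' mono order_trans by blast
        show "\<forall>(up', down', a, b) \<in> insert e D. up' = up \<longrightarrow> down' = down \<longrightarrow>
          (\<forall>q. join up down a b = Some q \<longrightarrow> ?best ?t q \<le> f a + g b)"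
        proof clarify
          fix up'' down'' a' b' q'
          assume in': "(up, down, a', b') \<in> insert e D" and j: "join up down a' b' = Some q'"
          show "?best ?t q' \<le> f a' + g b'"
          proof (cases "(up, down, a', b') \<in> D")
            case True
            then have "?best t q' \<le> f a' + g b'" using I j unfolding I2_def by blast
            then show ?thesis using mono[of q'] by linarith
          next
            case False
            then have "a' = a" "b' = b" using in' e by auto
            then show ?thesis using j q by (simp add: bt)
          qed
        qed
        show "\<forall>q. \<exists>a b. arr ?t (choice q) x = code a \<and> arr ?t (choice' q) x = code b \<and>
          (?best ?t q \<le> n \<longrightarrow> join up down a b = Some q \<and> ?best ?t q = f a + g b)"
        proof
          fix q'
          show "\<exists>a b. arr ?t (choice q') x = code a \<and> arr ?t (choice' q') x = code b \<and>
            (?best ?t q' \<le> n \<longrightarrow> join up down a b = Some q' \<and> ?best ?t q' = f a + g b)"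
          proof (cases "q' = q")
            case True
            then show ?thesis using q by (intro exI[of _ a] exI[of _ b]) (simp add: bt ch)
          next
            case False
            then show ?thesis using I unfolding I2_def by (simp add: bt ch)
          qed
        qed
      qed
      then show ?thesis using sf by blast
    qed
  qed (rule I2_init)
  define s2 where "s2 = sem ?c2 s1"
  have I2: "I2 UNIV s2" using 2 by (simp add: s2_def)
  let ?c3 = "seqs (map (\<lambda>q. Store (table q) (V 4) (V (20 + code q))) labels)"
  define I3 where "I3 = (\<lambda>D (t :: state). reg t = reg s2 \<and> (\<forall>q \<in> D. arr t (table q) p = ?best s2 q) \<and>
     (\<forall>a j. j \<noteq> p \<or> a < 10 \<or> 20 \<le> a \<longrightarrow> arr t a j = arr s2 a j))"
  have sm2: "same s2" and b2: "\<And>q. ?best s2 q \<le> n + 1" using I2 by (auto simp: I2_def)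
  have 3: "safe W ?c3 s2 \<and> I3 ({} \<union> set labels) (sem ?c3 s2)"
  proof (rule seqs_invariant)
    fix q D t assume I: "I3 D t"
    have "reg s2 4 = p" using sm2 r by (simp add: same_def)
    moreover have "?best s2 q \<le> W" using b2[of q] le by linarith
    ultimately show "safe W (Store (table q) (V 4) (V (20 + code q))) t \<and>
      I3 (insert q D) (sem (Store (table q) (V 4) (V (20 + code q))) t)"
      using I le cl[of q] by (auto simp: I3_def)
  qed (simp add: I3_def)
  have s': "s' = sem ?c3 s2" by (simp add: s'_def merge_def s1_def s2_def)
  have I3: "I3 UNIV s'" using 3 by (simp add: s')
  show "safe W merge s" using 1 2 3 by (simp add: merge_def s1_def s2_def)
  show "reg s' r = reg s r" if "r < 20" for r using I3 sm2 that by (simp add: I3_def same_def)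
  show "arr s' a j = arr s a j" if "a < 10" for a j using I3 sm2 that by (simp add: I3_def same_def)
  show "arr s' (table q) j = arr s (table q) j" if "j \<noteq> p" for q j
    using I3 sm2 that cl[of q] by (simp add: I3_def same_def)
  show "arr s' (choice q) j = arr s (choice q) j" if "j \<noteq> x" for q j
    using I3 sm2 that by (simp add: I3_def same_def)
  show "arr s' (choice' q) j = arr s (choice' q) j" if "j \<noteq> x" for q j
    using I3 sm2 that by (simp add: I3_def same_def)
  have "\<forall>q. \<exists>a b. arr s2 (choice q) x = code a \<and> arr s2 (choice' q) x = code b \<and>
      (?best s2 q \<le> n \<longrightarrow> join up down a b = Some q \<and> ?best s2 q = f a + g b)"
    using I2 unfolding I2_def by (elim conjE)
  then obtain c' d' where cd: "\<And>q. arr s2 (choice q) x = code (c' q) \<and> arr s2 (choice' q) x = code (d' q) \<and>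
        (?best s2 q \<le> n \<longrightarrow> join up down (c' q) (d' q) = Some q \<and> ?best s2 q = f (c' q) + g (d' q))"
    by metis
  have "merged n up down f g (?best s2) c' d'"
    unfolding merged_def
  proof (intro conjI allI impI)
    have "\<forall>e \<in> UNIV. case e of (up', down', a, b) \<Rightarrow> up' = up \<longrightarrow> down' = down \<longrightarrow>
        (\<forall>q. join up down a b = Some q \<longrightarrow> ?best s2 q \<le> f a + g b)"
      using I2 unfolding I2_def by (elim conjE)
    then show "?best s2 q \<le> f a + g b" if "join up down a b = Some q" for a b q
      using bspec[of UNIV _ "(up, down, a, b)"] that by fastforce
  qed (use cd in blast)+
  then show "\<exists>h c d. (\<forall>q. arr s' (table q) p = h q \<and> h q \<le> n + 1 \<and> arr s' (choice q) x = code (c q) \<and>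
       arr s' (choice' q) x = code (d q)) \<and> merged n up down f g h c d"
    using I3 b2 cd by (intro exI[of _ "?best s2"] exI[of _ c'] exI[of _ d']) (simp add: I3_def)
qed

end

text \<open>A singleton is determined by its sum, so comparing sums decides whether the one
  out-neighbour and the one in-neighbour coincide.\<close>

lemma singleton_union_iff:
  fixes X Y :: "nat set"
  assumes fin: "finite X" "finite Y"
  shows "card X < 2 \<and> card Y < 2 \<and> 0 < card X + card Y \<and> (card X + card Y = 2 \<longrightarrow> \<Sum>X = \<Sum>Y) \<longleftrightarrow>
    (\<exists>p. X \<union> Y = {p})" (is "?L \<longleftrightarrow> ?R")
proof
  assume ?R
  then show ?L by (auto simp: Un_singleton_iff)
next
  assume ?L
  have small: "Z = {} \<or> (\<exists>p. Z = {p})" if Z: "card Z < 2" "finite Z" for Z :: "nat set"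
  proof -
    from Z have "card Z = 0 \<or> card Z = 1" by linarith
    then show ?thesis using Z(2) by (metis card_0_eq card_1_singletonE)
  qed
  have "X = {} \<or> (\<exists>p. X = {p})" "Y = {} \<or> (\<exists>p. Y = {p})"
    using \<open>?L\<close> small fin by simp_all
  then show ?R using \<open>?L\<close> by (elim disjE exE) simp_all
qed

context ditree_input begin

section \<open>Initial cost tables\<close>

definition tabled :: "state \<Rightarrow> bool" where
  "tabled s \<longleftrightarrow> reg s 2 \<le> n \<and> reg s 0 = n \<and> reg s 13 = n + 1 \<and> (\<forall>r \<in> {3, 7, 8}. reg s r = 0) \<and>
     (\<forall>u. degrees E s u) \<and> (\<forall>a j. 20 \<le> a \<or> a = 8 \<longrightarrow> arr s a j = 0) \<and>
     (\<forall>u < reg s 2. \<forall>q. arr s (table q) u = (if q = inside then 1 else if q = outside then 0 else Suc n))"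

lemma tabled_step:
  assumes t: "tabled s" and lt: "reg s 2 < n"
  shows "safe W init_tables_body s \<and> tabled (sem init_tables_body s) \<and> reg (sem init_tables_body s) 2 = reg s 2 + 1"
proof -
  define i where "i = reg s 2"
  let ?e = "\<lambda>q. if q = inside then N 1 else if q = outside then N 0 else V 13"
  let ?c = "seqs (map (\<lambda>q. Store (table q) (V 2) (?e q)) labels)"
  define v where "v q = (if q = inside then 1 else if q = outside then 0 else Suc n)" for q
  have le: "i < W" "n + 1 \<le> W" "1 \<le> W" using lt W(1,3) by (simp_all add: i_def)
  define I where "I = (\<lambda>D (t :: state). reg t = reg s \<and>
    (\<forall>a j. j \<noteq> i \<or> a < 10 \<or> 18 \<le> a \<longrightarrow> arr t a j = arr s a j) \<and> (\<forall>q \<in> D. arr t (table q) i = v q))"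
  have 1: "safe W ?c s \<and> I ({} \<union> set labels) (sem ?c s)"
  proof (rule seqs_invariant)
    fix q D t assume I: "I D t"
    then have r: "reg t 2 = i" "reg t 13 = n + 1" using t by (simp_all add: I_def tabled_def i_def)
    have e: "aval t (?e q) = v q" using r by (simp add: v_def)
    have "safe W (Store (table q) (V 2) (?e q)) t" using r le by simp
    moreover have "I (insert q D) (sem (Store (table q) (V 2) (?e q)) t)"
      using I code_less[of q] unfolding sem.simps e by (auto simp: I_def r i_def)
    ultimately show "safe W (Store (table q) (V 2) (?e q)) t \<and> I (insert q D) (sem (Store (table q) (V 2) (?e q)) t)"
      by blast
  qed (simp add: I_def)
  define s1 where "s1 = sem ?c s"
  have I: "I UNIV s1" and sf: "safe W ?c s" using 1 by (auto simp: s1_def)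
  have s': "sem init_tables_body s = set_reg 2 (i + 1) s1"
    using I by (simp add: init_tables_body_def s1_def I_def i_def)
  have "safe W init_tables_body s"
    using sf I le by (simp add: init_tables_body_def s1_def I_def i_def[symmetric])
  moreover have "tabled (sem init_tables_body s)"
    unfolding tabled_def
  proof (intro conjI)
    show "\<forall>u. degrees E (sem init_tables_body s) u"
      using t I unfolding s' by (simp add: tabled_def degrees_def I_def)
    show "\<forall>u<reg (sem init_tables_body s) 2. \<forall>q. arr (sem init_tables_body s) (table q) u =
      (if q = inside then 1 else if q = outside then 0 else Suc n)"
      unfolding v_def[symmetric]
    proof (intro allI impI)
      fix u q assume u: "u < reg (sem init_tables_body s) 2"
      show "arr (sem init_tables_body s) (table q) u = v q"
      proof (cases "u = i")
        case True
        then show ?thesis using I unfolding s' I_def by auto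
      next
        case False
        then have "u < i" "arr s1 (table q) u = arr s (table q) u" using u I unfolding s' I_def by auto
        then show ?thesis using t unfolding s' tabled_def i_def by (simp add: v_def)
      qed
    qed
    show "reg (sem init_tables_body s) 2 \<le> n" using lt by (simp add: s' i_def)
    show "\<forall>a j. 20 \<le> a \<or> a = 8 \<longrightarrow> arr (sem init_tables_body s) a j = 0"
      using t I by (auto simp: s' tabled_def I_def)
  qed (use t I in \<open>simp_all add: s' tabled_def I_def\<close>)
  moreover have "reg (sem init_tables_body s) 2 = reg s 2 + 1" by (simp add: s' i_def)
  ultimately show ?thesis by blast
qed

lemma halts_init_tables:
  assumes "tabled s" "reg s 2 = 0"
  shows "halts W init_tables s (1 + (1 + cost init_tables_body) * n) (\<lambda>s. tabled s \<and> reg s 2 = n)"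
proof -
  have "halts W init_tables s (1 + (1 + cost init_tables_body) * (n - reg s 2))
    (\<lambda>s. tabled s \<and> \<not> tval s (Less (V 2) (V 0)))"
    unfolding init_tables_def
  proof (rule halts_While[where I = tabled and f = "\<lambda>s. n - reg s 2"])
    fix s assume "tabled s" "tval s (Less (V 2) (V 0))"
    then have "tabled s" "reg s 2 < n" by (auto simp: tabled_def)
    then show "safe W init_tables_body s \<and> tabled (sem init_tables_body s) \<and>
      n - reg (sem init_tables_body s) 2 < n - reg s 2"
      using tabled_step[of s] by simp
  next
    fix s assume "tabled s"
    then show "test_ok W s (Less (V 2) (V 0))" using W(3) by (auto simp: tabled_def)
  qed (rule assms)
  then show ?thesis
    by (rule halts_weaken) (use assms in \<open>auto simp: tabled_def\<close>)
qed

section \<open>Removing leaves on the machine\<close>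

definition stack :: "state \<Rightarrow> (nat \<times> nat) list" where
  "stack s = rev (map (\<lambda>j. (arr s 6 j, arr s 7 j)) [0..<reg s 7])"

definition arcs_on :: "nat set \<Rightarrow> (nat \<times> nat) set" where
  "arcs_on A = E \<inter> A \<times> A"

definition detached :: "nat set \<Rightarrow> state \<Rightarrow> bool" where
  "detached A s \<longleftrightarrow> (\<forall>u \<in> A. degrees (arcs_on A) s u) \<and> (\<forall>u. u \<notin> A \<longrightarrow> arr s 2 u = 0 \<and> arr s 4 u = 0)"

lemma finite_arcs_on: "finite (arcs_on A)"
  using closed finite_subset[of "arcs_on A" "{..<n} \<times> {..<n}"] by (auto simp: arcs_on_def)

lemma is_leaf_iff:
  assumes d: "detached A s" and A: "A \<subseteq> {..<n}" and x: "reg s 3 = x"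
  shows "tval s is_leaf \<longleftrightarrow> (\<exists>p. leaf E A x p)"
proof (cases "x \<in> A")
  case False
  then have "\<not> tval s is_leaf" using d x by (simp add: is_leaf_def Let_def detached_def)
  then show ?thesis using False by (auto simp: leaf_def)
next
  case True
  let ?O = "{y. (x, y) \<in> arcs_on A}" and ?I = "{y. (y, x) \<in> arcs_on A}"
  have fin: "finite ?O" "finite ?I" using finite_sections[OF finite_arcs_on] by auto
  have deg: "arr s 2 x = card ?O" "arr s 3 x = \<Sum>?O" "arr s 4 x = card ?I" "arr s 5 x = \<Sum>?I"
    using d True by (auto simp: detached_def degrees_def)
  have nb: "{y \<in> A. adj E x y} = ?O \<union> ?I" using True by (auto simp: adj_def arcs_on_def)
  have "tval s is_leaf \<longleftrightarrow> card ?O < 2 \<and> card ?I < 2 \<and> 0 < card ?O + card ?I \<and>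
     (card ?O + card ?I = 2 \<longrightarrow> \<Sum>?O = \<Sum>?I)"
    by (simp add: is_leaf_def Let_def x deg)
  also have "\<dots> \<longleftrightarrow> (\<exists>p. ?O \<union> ?I = {p})"
    by (rule singleton_union_iff[OF fin])
  finally show ?thesis using True by (simp add: leaf_def nb)
qed

lemma detach_spec:
  assumes d: "detached A s" and A: "A \<subseteq> {..<n}" and x: "reg s 3 = x" and lf: "leaf E A x p" and cnt: "reg s 7 < n"
  defines "s' \<equiv> sem detach s"
  shows "safe W detach s" "detached (A - {x}) s'"
    "reg s' 4 = p" "reg s' 5 = of_bool ((x, p) \<in> E)" "reg s' 6 = of_bool ((p, x) \<in> E)" "reg s' 7 = reg s 7 + 1"
    "\<And>r. r \<notin> {4, 5, 6, 7} \<Longrightarrow> reg s' r = reg s r"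
    "\<And>a j. 8 \<le> a \<Longrightarrow> arr s' a j = arr s a j"
    "\<And>j. arr s' 6 j = (if j = reg s 7 then x else arr s 6 j)"
    "\<And>j. arr s' 7 j = (if j = reg s 7 then p else arr s 7 j)"
    "\<And>u. arr s' 3 u \<le> arr s 3 u" "\<And>u. arr s' 5 u \<le> arr s 5 u"
proof -
  note lff = leaf_neighbour[OF irr lf]
  let ?up = "(x, p) \<in> E" and ?down = "(p, x) \<in> E"
  have xp: "x < n" "p < n" "x \<noteq> p" "x \<in> A" "p \<in> A" using lff A by auto
  have ud: "?up \<or> ?down" using lff by (auto simp: adj_def)
  have O: "{y. (x, y) \<in> arcs_on A} = (if ?up then {p} else {})"
    and I: "{y. (y, x) \<in> arcs_on A} = (if ?down then {p} else {})"
    using leaf_unique[OF lf] lff by (auto simp: arcs_on_def adj_def)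
  have W': "arcs_on A = arcs_on (A - {x}) \<union> (if ?up then {(x, p)} else {}) \<union> (if ?down then {(p, x)} else {})"
    using leaf_unique[OF lf] lff by (auto simp: arcs_on_def adj_def)
  have degx: "arr s 2 x = of_bool ?up" "arr s 3 x = (if ?up then p else 0)"
    "arr s 4 x = of_bool ?down" "arr s 5 x = (if ?down then p else 0)"
    using d xp(4) O I by (auto simp: detached_def degrees_def)
  have deg: "degrees (arcs_on A) s u" if "u \<in> A" for u using d that by (simp add: detached_def)
  have out: "{y. (u, y) \<in> arcs_on A} = (if u = p \<and> ?down then insert x {y. (u, y) \<in> arcs_on (A - {x})} else {y. (u, y) \<in> arcs_on (A - {x})})"
    "{y. (y, u) \<in> arcs_on A} = (if u = p \<and> ?up then insert x {y. (y, u) \<in> arcs_on (A - {x})} else {y. (y, u) \<in> arcs_on (A - {x})})"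
    if "u \<noteq> x" for u unfolding W' using that xp(3) by (auto split: if_splits)
  have nx: "x \<notin> {y. (u, y) \<in> arcs_on (A - {x})}" "x \<notin> {y. (y, u) \<in> arcs_on (A - {x})}" for u
    by (auto simp: arcs_on_def)
  note fin = finite_sections[OF finite_arcs_on[of "A - {x}"]]
  have old: "arr s 2 u = card {y. (u, y) \<in> arcs_on (A - {x})} + of_bool (u = p \<and> ?down)"
    "arr s 3 u = \<Sum>{y. (u, y) \<in> arcs_on (A - {x})} + (if u = p \<and> ?down then x else 0)"
    "arr s 4 u = card {y. (y, u) \<in> arcs_on (A - {x})} + of_bool (u = p \<and> ?up)"
    "arr s 5 u = \<Sum>{y. (y, u) \<in> arcs_on (A - {x})} + (if u = p \<and> ?up then x else 0)"
    if "u \<in> A" "u \<noteq> x" for u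
    using deg[OF that(1)] out[OF that(2)] nx fin by (auto simp: degrees_def add.commute)
  have bnd: "arr s 2 u \<le> W" "arr s 3 u \<le> W" "arr s 4 u \<le> W" "arr s 5 u \<le> W" if "u \<in> A" for u
  proof -
    have "arcs_on A \<subseteq> E" by (auto simp: arcs_on_def)
    from section_bounds[OF this, of u] show "arr s 2 u \<le> W" "arr s 3 u \<le> W" "arr s 4 u \<le> W" "arr s 5 u \<le> W"
      using deg[OF that] W by (auto simp: degrees_def)
  qed
  have le: "x \<le> W" "p \<le> W" "reg s 7 + 1 \<le> W" "1 \<le> W" using xp cnt W(1,3) by linarith+
  note b = bnd[OF xp(4)] bnd[OF xp(5)]
  define s1 where "s1 = set_reg 4 p (set_reg 6 (of_bool ?down) (set_reg 5 (of_bool ?up) s))"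
  define s2 where "s2 = (if ?up then set_arr 5 p (arr s 5 p - x) (set_arr 4 p (arr s 4 p - 1) s1) else s1)"
  define s3 where "s3 = (if ?down then set_arr 3 p (arr s 3 p - x) (set_arr 2 p (arr s 2 p - 1) s2) else s2)"
  let ?c1 = "Ite (Eq (V 5) (N 1)) (Assign 4 (Get 3 (V 3))) (Assign 4 (Get 5 (V 3)))"
  let ?c2 = "Ite (Eq (V 5) (N 1)) (Seq (downdate 4 (V 4) (N 1)) (downdate 5 (V 4) (V 3))) Skip"
  let ?c3 = "Ite (Eq (V 6) (N 1)) (Seq (downdate 2 (V 4) (N 1)) (downdate 3 (V 4) (V 3))) Skip"
  let ?c4 = "seqs [Store 2 (V 3) (N 0), Store 4 (V 3) (N 0), Store 6 (V 7) (V 3), Store 7 (V 7) (V 4), incr 7]"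
  let ?s0 = "set_reg 6 (of_bool ?down) (set_reg 5 (of_bool ?up) s)"
  have 0: "sem (Assign 6 (Get 4 (V 3))) (sem (Assign 5 (Get 2 (V 3))) s) = ?s0"
    "safe W (Assign 5 (Get 2 (V 3))) s" "safe W (Assign 6 (Get 4 (V 3))) (sem (Assign 5 (Get 2 (V 3))) s)"
    using b le by (simp_all add: x degx)
  have 1: "sem ?c1 ?s0 = s1" "safe W ?c1 ?s0"
    using ud b le by (cases ?up; simp add: x degx s1_def)+
  have r1: "reg s1 5 = of_bool ?up" "reg s1 6 = of_bool ?down" "reg s1 4 = p" "reg s1 3 = x" "reg s1 7 = reg s 7"
    "arr s1 = arr s" "\<And>r. r \<notin> {4, 5, 6} \<Longrightarrow> reg s1 r = reg s r"
    by (auto simp: s1_def x)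
  have 2: "sem ?c2 s1 = s2" "safe W ?c2 s1"
    using b le by (simp_all add: s2_def r1)
  have r2: "reg s2 = reg s1" "arr s2 4 u = arr s 4 u - of_bool (u = p \<and> ?up)"
    "arr s2 5 u = arr s 5 u - (if u = p \<and> ?up then x else 0)"
    "\<And>a j. a \<notin> {4, 5} \<Longrightarrow> arr s2 a j = arr s a j" for u
    by (auto simp: s2_def r1)
  have 3: "sem ?c3 s2 = s3" "safe W ?c3 s2"
    using b le by (simp_all add: s3_def r1 r2)
  have r3: "reg s3 = reg s1" "arr s3 2 u = arr s 2 u - of_bool (u = p \<and> ?down)"
    "arr s3 3 u = arr s 3 u - (if u = p \<and> ?down then x else 0)"
    "\<And>a j. a \<notin> {2, 3} \<Longrightarrow> arr s3 a j = arr s2 a j" for u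
    by (auto simp: s3_def r2)
  have s': "s' = sem ?c4 s3"
    unfolding s'_def detach_def seqs_simps sem.simps(4) 0 1 2 3 ..
  have s'_arr: "arr s' 2 u = (if u = x then 0 else arr s 2 u - of_bool (u = p \<and> ?down))"
    "arr s' 3 u = arr s 3 u - (if u = p \<and> ?down then x else 0)"
    "arr s' 4 u = (if u = x then 0 else arr s 4 u - of_bool (u = p \<and> ?up))"
    "arr s' 5 u = arr s 5 u - (if u = p \<and> ?up then x else 0)" for u
    unfolding s' by (simp_all add: r1 r3 r2)
  \<comment> \<open>The sums only decrease, so the bound \<open>n * n\<close> persists even at
    removed vertices, whose sums are never reset but are still read by
    \<open>is_leaf\<close>.\<close>
  show "\<And>u. arr s' 3 u \<le> arr s 3 u" "\<And>u. arr s' 5 u \<le> arr s 5 u"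
    by (simp_all add: s'_arr)
  show "safe W detach s"
  proof -
    have "safe W ?c4 s3" using le by (simp add: r1 r3)
    note c4 = this[unfolded seqs_simps safe.simps(4)]
    show ?thesis
      unfolding detach_def seqs_simps safe.simps(4) 0(1) 1(1) 2(1) 3(1)
      using 0(2,3) 1(2) 2(2) 3(2) c4 by blast
  qed
  show "detached (A - {x}) s'"
    unfolding detached_def
  proof (intro conjI ballI allI impI)
    fix u assume "u \<in> A - {x}"
    then show "degrees (arcs_on (A - {x})) s' u"
      using old[of u] by (simp add: degrees_def s'_arr)
  next
    fix u assume "u \<notin> A - {x}"
    then show "arr s' 2 u = 0" "arr s' 4 u = 0" using d by (auto simp: s'_arr detached_def)
  qed
  show "reg s' 4 = p" "reg s' 5 = of_bool ?up" "reg s' 6 = of_bool ?down" "reg s' 7 = reg s 7 + 1"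
    "\<And>r. r \<notin> {4, 5, 6, 7} \<Longrightarrow> reg s' r = reg s r"
    "\<And>a j. 8 \<le> a \<Longrightarrow> arr s' a j = arr s a j"
    "\<And>j. arr s' 6 j = (if j = reg s 7 then x else arr s 6 j)"
    "\<And>j. arr s' 7 j = (if j = reg s 7 then p else arr s 7 j)"
    unfolding s' by (simp_all add: r1 r3 r2)
qed

text \<open>The clause on leaves makes the scan complete: up to the scan position, only the current
  vertex can be a leaf. The equivalence for registers 2 and 3 puts the current vertex out of range
  when the scan ends, so that no leaf is left then. Register 8 always holds a remaining vertex and
  finally the root.\<close>

definition peeled :: "nat set \<Rightarrow> (nat \<Rightarrow> label \<Rightarrow> label) \<Rightarrow> (nat \<Rightarrow> label \<Rightarrow> label) \<Rightarrow> state \<Rightarrow> bool" where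
  "peeled A c d s \<longleftrightarrow>
     reg s 0 = n \<and> reg s 13 = n + 1 \<and> reg s 2 \<le> n \<and> (reg s 2 < n \<longleftrightarrow> reg s 3 < n) \<and>
     reg s 8 \<in> A \<and> tree_on E A \<and> A \<subseteq> {..<n} \<and> card A + reg s 7 = n \<and> detached A s \<and>
     (\<forall>u p. leaf E A u p \<longrightarrow> reg s 2 < u \<or> u = reg s 3) \<and>
     (\<forall>u \<in> A. \<forall>q. arr s (table q) u \<le> n + 1) \<and>
     (\<forall>v q. arr s (choice q) v = code (c v q) \<and> arr s (choice' q) v = code (d v q)) \<and>
     (\<forall>u. arr s 3 u \<le> n * n \<and> arr s 5 u \<le> n * n) \<and>
     (\<forall>j. arr s 8 j = 0) \<and> (\<forall>(v, p) \<in> set (stack s). v < n \<and> p < n) \<and>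
     dp_inv E n A (\<lambda>u q. arr s (table q) u) c d (stack s)"

lemma advance_step:
  assumes pe: "peeled A c d s" and lt: "reg s 2 < n" and nl: "\<not> tval s is_leaf"
  defines "s' \<equiv> sem (seqs [incr 2, Assign 3 (V 2)]) s"
  shows "safe W (seqs [incr 2, Assign 3 (V 2)]) s" "peeled A c d s'" "reg s' 2 = reg s 2 + 1" "reg s' 7 = reg s 7"
proof -
  have A: "A \<subseteq> {..<n}" "detached A s" using pe by (auto simp: peeled_def)
  have nl': "\<not> leaf E A (reg s 3) p" for p using nl is_leaf_iff[OF A(2,1) refl] by blast
  have lv: "reg s 2 < u" if "leaf E A u p" for u p
    using pe nl'[of p] that unfolding peeled_def by blast
  have s': "s' = set_reg 3 (reg s 2 + 1) (set_reg 2 (reg s 2 + 1) s)" by (simp add: s'_def)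
  have st: "stack s' = stack s" by (simp add: stack_def s')
  have dt: "detached A s'" using A(2) by (simp add: detached_def degrees_def s')
  show "safe W (seqs [incr 2, Assign 3 (V 2)]) s" using lt W(3) by simp
  show "reg s' 2 = reg s 2 + 1" "reg s' 7 = reg s 7" by (simp_all add: s')
  have "\<forall>u p. leaf E A u p \<longrightarrow> reg s' 2 < u \<or> u = reg s' 3"
    using lv by (force simp: s')
  then show "peeled A c d s'"
    using pe lt st dt unfolding peeled_def by (simp add: s')
qed

lemma peel_step:
  assumes pe: "peeled A c d s" and lt: "reg s 2 < n" and lf: "leaf E A (reg s 3) p"
  defines "body \<equiv> seqs [detach, merge, Assign 8 (V 4), Assign 3 (V 4)]"
  defines "s' \<equiv> sem body s"
  shows "safe W body s" "\<exists>c d. peeled (A - {reg s 3}) c d s'" "reg s' 2 = reg s 2" "reg s' 7 = reg s 7 + 1"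
    "reg s 7 < n"
proof -
  define x where "x = reg s 3"
  let ?up = "(x, p) \<in> E" and ?down = "(p, x) \<in> E"
  note lf = lf[folded x_def]
  note lff = leaf_neighbour[OF irr lf]
  have A: "A \<subseteq> {..<n}" "detached A s" "tree_on E A" "card A + reg s 7 = n" and r: "reg s 0 = n" "reg s 13 = n + 1"
    and T: "\<And>u q. u \<in> A \<Longrightarrow> arr s (table q) u \<le> n + 1"
    and ch: "\<And>v q. arr s (choice q) v = code (c v q)" "\<And>v q. arr s (choice' q) v = code (d v q)"
    and lv: "\<And>u p. leaf E A u p \<Longrightarrow> reg s 2 < u \<or> u = x"
    and sk: "\<forall>(v, p) \<in> set (stack s). v < n \<and> p < n"
    and sums: "\<And>u. arr s 3 u \<le> n * n" "\<And>u. arr s 5 u \<le> n * n"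
    and st8: "\<And>j. arr s 8 j = 0"
    and dp: "dp_inv E n A (\<lambda>u q. arr s (table q) u) c d (stack s)"
    using pe unfolding peeled_def x_def by blast+
  have fA: "finite A" using A(1) finite_subset by blast
  have xp: "x < n" "p < n" "x \<in> A" "p \<in> A" "x \<noteq> p" using lff A(1) by auto
  have cA: "card (A - {x}) + (reg s 7 + 1) = n" "0 < card A" using A(4) fA xp card_gt_0_iff[of A] by auto
  then show cnt: "reg s 7 < n" using A(4) by simp
  define s1 where "s1 = sem detach s"
  note dt = detach_spec[OF A(2,1) x_def[symmetric] lf cnt, folded s1_def]
  define s2 where "s2 = sem merge s1"
  have s1r: "reg s1 3 = x" "reg s1 13 = n + 1" "reg s1 0 = n" "reg s1 2 = reg s 2"
    using dt(7) r by (simp_all add: x_def)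
  have s1a: "arr s1 (table q) u = arr s (table q) u" "arr s1 (choice q) u = arr s (choice q) u"
    "arr s1 (choice' q) u = arr s (choice' q) u" for q u by (simp_all add: dt(8))
  note mg = merge_spec[OF s1r(1) dt(3,4,5) s1r(2) xp(1,2), where f = "\<lambda>q. arr s (table q) p" and g = "\<lambda>q. arr s (table q) x"
      and c = "c x" and d = "d x", folded s2_def, unfolded s1a ch, OF refl T[OF xp(4)] refl T[OF xp(3)] refl refl]
  from mg(7) obtain h cx dx where h: "\<And>q. arr s2 (table q) p = h q" "\<And>q. h q \<le> n + 1"
    "\<And>q. arr s2 (choice q) x = code (cx q)" "\<And>q. arr s2 (choice' q) x = code (dx q)"
    "merged n ?up ?down (\<lambda>q. arr s (table q) p) (\<lambda>q. arr s (table q) x) h cx dx" by blast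
  have s': "s' = set_reg 3 p (set_reg 8 p s2)"
    using mg(2)[of 4] dt(3) by (simp add: s'_def body_def s1_def[symmetric] s2_def[symmetric])
  have s'r: "reg s' 0 = n" "reg s' 13 = n + 1" "reg s' 2 = reg s 2" "reg s' 3 = p" "reg s' 8 = p" "reg s' 7 = reg s 7 + 1"
    by (simp_all add: s' mg(2) s1r dt(6))
  then show "reg s' 2 = reg s 2" "reg s' 7 = reg s 7 + 1" by blast+
  have s'a: "arr s' = arr s2" by (simp add: s')
  show "safe W body s"
    using dt(1) mg(1) mg(2)[of 4] dt(3) xp W(3)
    by (simp add: body_def s1_def[symmetric] s2_def[symmetric])
  have st: "stack s' = (x, p) # stack s"
    by (simp add: stack_def s'r s'a mg(3) dt(9,10))
  have tab: "arr s' (table q) u = (if u = p then h q else arr s (table q) u)" for u q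
    using mg(4)[of u q] h(1) by (simp add: s'a)
  define c' where "c' = c(x := cx)"
  define d' where "d' = d(x := dx)"
  have det: "detached (A - {x}) s'"
    using dt(2) by (simp add: detached_def degrees_def s'a mg(3))
  have dp': "dp_inv E n (A - {x}) (\<lambda>u q. arr s' (table q) u) c' d' (stack s')"
    unfolding st
  proof (rule dp_inv_step[OF irr lf dp])
    show "merged n ?up ?down (\<lambda>q. arr s (table q) p) (\<lambda>q. arr s (table q) x) h (c' x) (d' x)"
      using h(5) by (simp add: c'_def d'_def)
  qed (auto simp: tab c'_def d'_def)
  have chs: "arr s' (choice q) v = code (c' v q) \<and> arr s' (choice' q) v = code (d' v q)" for v q
    using mg(5)[of v q] mg(6)[of v q] h(3,4) ch by (cases "v = x") (simp_all add: s'a c'_def d'_def)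
  have lv': "reg s 2 < u \<or> u = p" if "leaf E (A - {x}) u y" for u y
  proof (rule ccontr)
    assume neg: "\<not> ?thesis"
    have u: "u \<in> A" "u \<noteq> x" using that by (auto simp: leaf_def)
    have "\<not> adj E u x" using leaf_unique[OF lf u(1)] neg by (auto simp: adj_sym)
    then have "leaf E A u y" using that u unfolding leaf_def by blast
    then show False using lv neg u by blast
  qed
  have "peeled (A - {x}) c' d' s'"
    unfolding peeled_def s'r
  proof (intro conjI)
    show "tree_on E (A - {x})" by (rule tree_on_remove_leaf[OF A(3) irr lf])
    show "\<forall>u\<in>A - {x}. \<forall>q. arr s' (table q) u \<le> n + 1" using T h(2) by (auto simp: tab)
    show "\<forall>j. arr s' 8 j = 0" using st8 by (simp add: s'a mg(3) dt(8))
    show "\<forall>u. arr s' 3 u \<le> n * n \<and> arr s' 5 u \<le> n * n"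
      using order_trans[OF dt(11) sums(1)] order_trans[OF dt(12) sums(2)] by (simp add: s'a mg(3))
    show "\<forall>(v, p) \<in> set (stack s'). v < n \<and> p < n" using sk xp by (simp add: st)
    show "\<forall>u y. leaf E (A - {x}) u y \<longrightarrow> reg s 2 < u \<or> u = p" using lv' by blast
    show "\<forall>v q. arr s' (choice q) v = code (c' v q) \<and> arr s' (choice' q) v = code (d' v q)" using chs by blast
    show "reg s 2 \<le> n" "reg s 2 < n \<longleftrightarrow> p < n" using lt xp by auto
    show "p \<in> A - {x}" "A - {x} \<subseteq> {..<n}" using xp A by auto
  qed (use cA det dp' in auto)
  then show "\<exists>c d. peeled (A - {reg s 3}) c d s'" unfolding x_def by blast
qed

lemma halts_peel:
  assumes "\<exists>A c d. peeled A c d s"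
  shows "halts W peel s (1 + (1 + cost peel_body) * (2 * n))
    (\<lambda>s. \<exists>c d. peeled {reg s 8} c d s)"
proof -
  let ?I = "\<lambda>s. \<exists>A c d. peeled A c d s"
  have "halts W peel s (1 + (1 + cost peel_body) * (2 * n - (reg s 2 + reg s 7)))
    (\<lambda>s. ?I s \<and> \<not> tval s (Less (V 2) (V 0)))"
    unfolding peel_def
  \<comment> \<open>Neither the scan position nor the height of the stack exceeds \<open>n\<close>,
    and each round raises one of them while the other stays.\<close>
  proof (rule halts_While[where I = ?I and f = "\<lambda>s. 2 * n - (reg s 2 + reg s 7)"])
    fix s assume "?I s"
    then show "test_ok W s (Less (V 2) (V 0))" using W(3) by (auto simp: peeled_def)
  next
    fix s assume "?I s" "tval s (Less (V 2) (V 0))"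
    then obtain A c d where pe: "peeled A c d s" and lt: "reg s 2 < n" by (auto simp: peeled_def)
    then have A: "A \<subseteq> {..<n}" "detached A s" "card A + reg s 7 = n" "reg s 3 < n"
      by (simp_all add: peeled_def)
    have ok: "test_ok W s is_leaf"
    proof -
      have "arr s 2 (reg s 3) \<le> n \<and> arr s 4 (reg s 3) \<le> n"
      proof (cases "reg s 3 \<in> A")
        case True
        then have "degrees (arcs_on A) s (reg s 3)" using A by (simp add: detached_def)
        moreover have "arcs_on A \<subseteq> E" by (auto simp: arcs_on_def)
        ultimately show ?thesis using section_bounds[of "arcs_on A" "reg s 3"] by (simp add: degrees_def)
      next
        case False
        then show ?thesis using A by (simp add: detached_def)
      qed
      moreover have "arr s 3 (reg s 3) \<le> W" "arr s 5 (reg s 3) \<le> W"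
        using pe W(2) order_trans unfolding peeled_def by blast+
      ultimately show ?thesis using A(4) W(1,3) by (simp add: is_leaf_def Let_def)
    qed
    show "safe W peel_body s \<and> ?I (sem peel_body s) \<and>
      2 * n - (reg (sem peel_body s) 2 + reg (sem peel_body s) 7) < 2 * n - (reg s 2 + reg s 7)"
    proof (cases "tval s is_leaf")
      case True
      then obtain p where "leaf E A (reg s 3) p" using is_leaf_iff[OF A(2,1) refl] by blast
      from peel_step[OF pe lt this] show ?thesis
        using ok True lt by (auto simp: peel_body_def)
    next
      case False
      from advance_step[OF pe lt this] show ?thesis
        using ok False lt A(3) pe by (auto simp: peel_body_def)
    qed
  qed (rule assms)
  then show ?thesis
  proof (rule halts_weaken)
    fix s assume "?I s \<and> \<not> tval s (Less (V 2) (V 0))"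
    then obtain A c d where pe: "peeled A c d s" and "\<not> reg s 2 < n" by (auto simp: peeled_def)
    then have *: "tree_on E A" "A \<subseteq> {..<n}" "reg s 8 \<in> A" "reg s 2 = n" "\<not> reg s 3 < n"
      "\<And>u p. leaf E A u p \<Longrightarrow> reg s 2 < u \<or> u = reg s 3" by (auto simp: peeled_def)
    \<comment> \<open>With register 2 at \<open>n\<close> and register 3 not below \<open>n\<close>,
      the clause on leaves admits no leaf inside \<open>{..<n}\<close>.\<close>
    have "\<not> leaf E A u p" for u p
      using *(2,4,5) *(6)[of u p] by (auto simp: leaf_def)
    then obtain r where "A = {r}" using tree_on_no_leaf[OF *(1)] by blast
    then show "\<exists>c d. peeled {reg s 8} c d s" using pe *(3) by auto
  qed (intro add_left_mono mult_left_mono; simp)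
qed

end

text \<open>Supplies the solution that keeps the optimum finite in \<open>dp_inv_final\<close>:
  every out-neighbour is itself a source.\<close>

lemma valid_membership_all: "irrefl E \<Longrightarrow> valid E A (membership A)"
proof -
  assume irr: "irrefl E"
  have "unreached E A (source \<circ> membership A) z = {}" for z
  proof -
    have "reached E A (source \<circ> membership A) z a" if "a \<in> A" "(z, a) \<in> E" for a
    proof -
      have "a \<noteq> z" using that irr by (auto simp: irrefl_def)
      then show ?thesis unfolding reached_def using that by (intro bexI[of _ a]) auto
    qed
    then show ?thesis by (auto simp: unreached_def)
  qed
  then show ?thesis by (simp add: valid_def)
qed

section \<open>Choosing the root, backtracking and output\<close>

context ditree_input begin

lemma peeled_of_tabled:
  assumes t: "tabled s" and r: "reg s 2 = n"
  defines "s' \<equiv> set_reg 2 0 s"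
  shows "\<exists>A c d. peeled A c d s'"
proof -
  let ?c = "\<lambda>_ _. outside"
  have st: "stack s' = []" using t by (simp add: stack_def s'_def tabled_def)
  have E': "arcs_on {..<n} = E" using closed by (auto simp: arcs_on_def)
  have deg: "degrees E s u" for u using t by (simp add: tabled_def)
  have z: "arr s 2 u = 0 \<and> arr s 4 u = 0" if "u \<notin> {..<n}" for u
  proof -
    have "{y. (u, y) \<in> E} = {}" "{y. (y, u) \<in> E} = {}" using closed that by auto
    then show ?thesis using deg[of u] by (simp add: degrees_def)
  qed
  have tab: "arr s (table q) u = (if q = inside then 1 else if q = outside then 0 else Suc n)" if "u < n" for u q
    using t r that by (simp add: tabled_def)
  have "peeled {..<n} ?c ?c s'"
    unfolding peeled_def st
  proof (intro conjI)
    show "detached {..<n} s'"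
      using deg z unfolding detached_def E' by (simp add: degrees_def s'_def)
    show "\<forall>u p. leaf E {..<n} u p \<longrightarrow> reg s' 2 < u \<or> u = reg s' 3"
      using t by (auto simp: s'_def tabled_def)
    show "\<forall>u\<in>{..<n}. \<forall>q. arr s' (table q) u \<le> n + 1" by (simp add: s'_def tab)
    show "dp_inv E n {..<n} (\<lambda>u q. arr s' (table q) u) ?c ?c []"
      by (rule dp_inv_init) (simp add: s'_def tab)
    show "\<forall>u. arr s' 3 u \<le> n * n \<and> arr s' 5 u \<le> n * n"
      using deg section_bounds[OF order_refl] by (simp add: degrees_def s'_def)
  qed (use t tree pos in \<open>auto simp: s'_def tabled_def\<close>)
  then show ?thesis by blast
qed

lemma choose_root_spec:
  assumes pe: "peeled {r} c d s" and r: "reg s 8 = r"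
  defines "s' \<equiv> sem choose_root s"
  shows "safe W choose_root s"
    "\<exists>q. settled q \<and> (\<forall>q'. settled q' \<longrightarrow> arr s (table q) r \<le> arr s (table q') r) \<and>
       (\<forall>u. arr s' 8 u = code (((\<lambda>_. outside)(r := q)) u))"
    "\<And>i. i \<notin> {9, 10} \<Longrightarrow> reg s' i = reg s i" "\<And>a. a \<noteq> 8 \<Longrightarrow> arr s' a = arr s a"
proof -
  have rn: "r < n" and T: "\<And>q. arr s (table q) r \<le> n + 1" and z: "\<And>j. arr s 8 j = 0"
    using pe by (auto simp: peeled_def)
  have TW: "arr s (table q) r \<le> W" for q using T[of q] W(3) by linarith
  have cW: "code q \<le> W" for q using code_less[of q] W(1) by linarith
  have rW: "r \<le> W" using rn W(3) by linarith
  let ?a = "Assign 9 (Get (table inside) (V 8))" and ?b = "Assign 10 (N (code inside))"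
  let ?f = "\<lambda>q. Ite (Less (Get (table q) (V 8)) (V 9)) (Seq (Assign 9 (Get (table q) (V 8))) (Assign 10 (N (code q)))) Skip"
  let ?c = "seqs (map ?f (filter settled labels))"
  define I where "I = (\<lambda>D (t :: state). (\<forall>i. i \<notin> {9, 10} \<longrightarrow> reg t i = reg s i) \<and> arr t = arr s \<and>
    (\<exists>q. settled q \<and> reg t 10 = code q \<and> reg t 9 = arr s (table q) r \<and> (\<forall>q' \<in> D. arr s (table q) r \<le> arr s (table q') r)))"
  define s1 where "s1 = sem ?b (sem ?a s)"
  have sf1: "safe W ?a s" "safe W ?b (sem ?a s)" using r rW TW cW by simp_all
  have 1: "safe W ?c s1 \<and> I ({} \<union> set (filter settled labels)) (sem ?c s1)"
  proof (rule seqs_invariant)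
    fix q D t assume q: "q \<in> set (filter settled labels)" and I: "I D t"
    obtain q0 where q0: "settled q0" "reg t 10 = code q0" "reg t 9 = arr s (table q0) r"
      "\<And>q'. q' \<in> D \<Longrightarrow> arr s (table q0) r \<le> arr s (table q') r" using I unfolding I_def by blast
    have t: "reg t 8 = r" "arr t = arr s" "\<And>i. i \<notin> {9, 10} \<Longrightarrow> reg t i = reg s i" using I r by (auto simp: I_def)
    have "safe W (?f q) t" using t q0 rW TW cW by simp
    moreover have "I (insert q D) (sem (?f q) t)"
    proof (cases "arr s (table q) r < arr s (table q0) r")
      case True
      have "sem (?f q) t = set_reg 10 (code q) (set_reg 9 (arr s (table q) r) t)"
        using True t q0 by simp
      moreover have "\<forall>q'\<in>insert q D. arr s (table q) r \<le> arr s (table q') r"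
        using True q0(4) by fastforce
      ultimately show ?thesis using q t unfolding I_def by auto
    next
      case False
      have "sem (?f q) t = t" using False t q0 by simp
      moreover have "\<forall>q'\<in>insert q D. arr s (table q0) r \<le> arr s (table q') r"
        using False q0(4) by auto
      ultimately show ?thesis using q0 t unfolding I_def by auto
    qed
    ultimately show "safe W (?f q) t \<and> I (insert q D) (sem (?f q) t)" by blast
  next
    have "settled inside" by (simp add: inside_def)
    then show "I {} s1" unfolding I_def s1_def using r by auto
  qed
  define s2 where "s2 = sem ?c s1"
  have I2: "I {q. settled q} s2" using 1 by (simp add: s2_def)
  then obtain q where q: "settled q" "reg s2 10 = code q" "\<And>q'. settled q' \<Longrightarrow> arr s (table q) r \<le> arr s (table q') r"
    unfolding I_def by blast
  have t: "reg s2 8 = r" "arr s2 = arr s" "\<And>i. i \<notin> {9, 10} \<Longrightarrow> reg s2 i = reg s i"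
    using I2 r by (auto simp: I_def)
  have s': "s' = set_arr 8 r (code q) s2"
    unfolding s'_def choose_root_def seqs_simps(2) sem.simps(4) s1_def[symmetric] s2_def[symmetric]
    using t q by simp
  show "safe W choose_root s"
    unfolding choose_root_def seqs_simps(2) safe.simps(4) s1_def[symmetric] s2_def[symmetric]
    using sf1 1 t q rW cW by simp
  have "\<forall>u. arr s' 8 u = code (((\<lambda>_. outside)(r := q)) u)" by (simp add: s' t z)
  then show "\<exists>q. settled q \<and> (\<forall>q'. settled q' \<longrightarrow> arr s (table q) r \<le> arr s (table q') r) \<and>
       (\<forall>u. arr s' 8 u = code (((\<lambda>_. outside)(r := q)) u))" using q by blast
  show "\<And>i. i \<notin> {9, 10} \<Longrightarrow> reg s' i = reg s i" by (simp add: s' t)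
  show "\<And>a. a \<noteq> 8 \<Longrightarrow> arr s' a = arr s a" by (rule ext) (simp add: s' t)
qed

text \<open>\<open>S\<close> stays fixed while the stack shrinks: each pair that
  \<open>backtrack\<close> consumes is absorbed into array 8, until the labels there are the
  memberships themselves.\<close>

definition traced :: "nat set \<Rightarrow> (nat \<Rightarrow> label \<Rightarrow> label) \<Rightarrow> (nat \<Rightarrow> label \<Rightarrow> label) \<Rightarrow> state \<Rightarrow> bool" where
  "traced S c d s \<longleftrightarrow> reg s 0 = n \<and> reg s 7 \<le> n \<and>
     (\<forall>v q. arr s (choice q) v = code (c v q) \<and> arr s (choice' q) v = code (d v q)) \<and>
     (\<forall>(v, p) \<in> set (stack s). v < n \<and> p < n) \<and>
     (\<exists>l. (\<forall>u. arr s 8 u = code (l u)) \<and> (\<forall>u<n. backtrack c d (stack s) l u = membership S u))"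

lemma trace_back_step:
  assumes tr: "traced S c d s" and pos': "0 < reg s 7"
  defines "s' \<equiv> sem trace_back_body s"
  shows "safe W trace_back_body s" "traced S c d s'" "reg s' 7 = reg s 7 - 1"
proof -
  define k where "k = reg s 7 - 1"
  have k: "reg s 7 = Suc k" using pos' by (simp add: k_def)
  define x where "x = arr s 6 k"
  define p where "p = arr s 7 k"
  have ch: "\<And>v q. arr s (choice q) v = code (c v q)" "\<And>v q. arr s (choice' q) v = code (d v q)"
    and r: "reg s 0 = n" "Suc k \<le> n" and sk: "\<forall>(v, p) \<in> set (stack s). v < n \<and> p < n"
    using tr k by (auto simp: traced_def)
  obtain l where l: "\<And>u. arr s 8 u = code (l u)" "\<And>u. u < n \<Longrightarrow> backtrack c d (stack s) l u = membership S u"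
    using tr unfolding traced_def by blast
  have st: "stack s = (x, p) # rev (map (\<lambda>j. (arr s 6 j, arr s 7 j)) [0..<k])"
    by (simp add: stack_def k x_def p_def)
  have xp: "x < n" "p < n" using sk st by auto
  have le: "x \<le> W" "p \<le> W" "k \<le> W" "Suc k \<le> W" "1 \<le> W" using xp r W(1,3) by linarith+
  have cW: "code q \<le> W" for q using code_less[of q] W(1) by linarith
  let ?c1 = "Assign 7 (Minus (V 7) (N 1))" and ?c2 = "Assign 3 (Get 6 (V 7))" and ?c3 = "Assign 4 (Get 7 (V 7))"
    and ?c4 = "Assign 14 (Get 8 (V 4))"
  define s1 where "s1 = set_reg 14 (code (l p)) (set_reg 4 p (set_reg 3 x (set_reg 7 k s)))"
  have e1: "sem ?c4 (sem ?c3 (sem ?c2 (sem ?c1 s))) = s1"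
    by (simp add: s1_def k x_def p_def l)
  have sf1: "safe W ?c1 s" "safe W ?c2 (sem ?c1 s)" "safe W ?c3 (sem ?c2 (sem ?c1 s))"
    "safe W ?c4 (sem ?c3 (sem ?c2 (sem ?c1 s)))"
    using le cW by (simp_all add: k x_def[symmetric] p_def[symmetric] l)
  have r1: "reg s1 14 = code (l p)" "reg s1 4 = p" "reg s1 3 = x" "reg s1 7 = k" "reg s1 0 = n" "arr s1 = arr s"
    by (simp_all add: s1_def r)
  let ?f = "\<lambda>q. Ite (Eq (V 14) (N (code q)))
       (Seq (Store 8 (V 4) (Get (choice q) (V 3))) (Store 8 (V 3) (Get (choice' q) (V 3)))) Skip"
  let ?c = "seqs (map ?f labels)"
  define l' where "l' = l(p := c x (l p), x := d x (l p))"
  define I where "I = (\<lambda>D (t :: state). reg t = reg s1 \<and> (\<forall>a j. a \<noteq> 8 \<longrightarrow> arr t a j = arr s a j) \<and>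
    (\<forall>u. arr t 8 u = code (if l p \<in> D then l' u else l u)))"
  have 1: "safe W ?c s1 \<and> I ({} \<union> set labels) (sem ?c s1)"
  proof (rule seqs_invariant)
    fix q D t assume I: "I D t"
    have t: "reg t 14 = code (l p)" "reg t 4 = p" "reg t 3 = x" "arr t (choice q) x = code (c x q)" "arr t (choice' q) x = code (d x q)"
      using I ch by (simp_all add: I_def r1)
    have "safe W (?f q) t" using t le cW by simp
    moreover have "I (insert q D) (sem (?f q) t)"
    proof (cases "q = l p")
      case True
      have "sem (?f q) t = set_arr 8 x (code (d x q)) (set_arr 8 p (code (c x q)) t)"
        using True t by simp
      moreover have "arr t 8 u = code (l u)" if "u \<noteq> x" "u \<noteq> p" for u
        using I that by (simp add: I_def l'_def)
      ultimately show ?thesis using I True by (auto simp: I_def l'_def)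
    next
      case False
      then have "sem (?f q) t = t" using t by simp
      then show ?thesis using I False by (simp add: I_def)
    qed
    ultimately show "safe W (?f q) t \<and> I (insert q D) (sem (?f q) t)" by blast
  next
    show "I {} s1" by (simp add: I_def r1 l)
  qed
  have s': "s' = sem ?c s1"
    unfolding s'_def trace_back_body_def seqs_simps(2) sem.simps(4) e1 by simp
  have I: "I UNIV s'" using 1 by (simp add: s')
  show "safe W trace_back_body s"
    unfolding trace_back_body_def seqs_simps(2) safe.simps(4) e1 using sf1 1 by simp
  show "reg s' 7 = reg s 7 - 1" using I by (simp add: I_def r1 k)
  have st': "stack s' = rev (map (\<lambda>j. (arr s 6 j, arr s 7 j)) [0..<k])"
    using I by (simp add: I_def r1 stack_def)
  have bt: "backtrack c d (stack s) l = backtrack c d (stack s') l'"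
    by (simp add: st st' l'_def)
  show "traced S c d s'"
    unfolding traced_def
  proof (intro conjI)
    show "\<exists>l. (\<forall>u. arr s' 8 u = code (l u)) \<and> (\<forall>u<n. backtrack c d (stack s') l u = membership S u)"
      using I l(2) bt by (intro exI[of _ l']) (simp add: I_def)
    show "\<forall>(v, p) \<in> set (stack s'). v < n \<and> p < n" using sk by (simp add: st st')
  qed (use I ch r in \<open>auto simp: I_def r1\<close>)
qed

lemma halts_trace_back:
  assumes "traced S c d s"
  shows "halts W trace_back s (1 + (1 + cost trace_back_body) * n)
    (\<lambda>s. reg s 0 = n \<and> reg s 7 = 0 \<and> (\<forall>u<n. arr s 8 u = code (membership S u)))"
proof -
  have "halts W trace_back s (1 + (1 + cost trace_back_body) * reg s 7)
    (\<lambda>s. traced S c d s \<and> \<not> tval s (Less (N 0) (V 7)))"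
    unfolding trace_back_def
  proof (rule halts_While[where I = "traced S c d" and f = "\<lambda>s. reg s 7"])
    fix s assume "traced S c d s" "tval s (Less (N 0) (V 7))"
    then show "safe W trace_back_body s \<and> traced S c d (sem trace_back_body s) \<and>
      reg (sem trace_back_body s) 7 < reg s 7"
      using trace_back_step[of S c d s] by simp
  next
    fix s assume "traced S c d s"
    then show "test_ok W s (Less (N 0) (V 7))" using W(3) by (auto simp: traced_def)
  qed (rule assms)
  then show ?thesis
  proof (rule halts_weaken)
    show "1 + (1 + cost trace_back_body) * reg s 7 \<le> 1 + (1 + cost trace_back_body) * n"
      using assms by (intro add_left_mono mult_left_mono) (simp_all add: traced_def)
    fix s assume "traced S c d s \<and> \<not> tval s (Less (N 0) (V 7))"
    then show "reg s 0 = n \<and> reg s 7 = 0 \<and> (\<forall>u<n. arr s 8 u = code (membership S u))"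
      by (auto simp: traced_def stack_def)
  qed
qed

definition collected :: "nat set \<Rightarrow> state \<Rightarrow> bool" where
  "collected S s \<longleftrightarrow> reg s 0 = n \<and> reg s 2 \<le> n \<and> (\<forall>u<n. arr s 8 u = code (membership S u)) \<and>
     map (arr s 0) [0..<reg s 7] = filter (\<lambda>u. u \<in> S) [0..<reg s 2]"

lemma collect_step:
  assumes co: "collected S s" and lt: "reg s 2 < n"
  defines "s' \<equiv> sem collect_body s"
  shows "safe W collect_body s" "collected S s'" "reg s' 2 = reg s 2 + 1"
proof -
  define i where "i = reg s 2"
  define k where "k = reg s 7"
  have i: "i < n" "reg s 2 = i" using lt by (auto simp: i_def)
  have mp: "map (arr s 0) [0..<k] = filter (\<lambda>u. u \<in> S) [0..<i]" using co by (simp add: collected_def i_def k_def)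
  have "k \<le> i" using arg_cong[OF mp, of length] length_filter_le[of "\<lambda>u. u \<in> S" "[0..<i]"] by simp
  then have le: "k + 1 \<le> W" "i + 1 \<le> W" "1 \<le> W" using i W(1,3) by linarith+
  have cW: "code q \<le> W" for q using code_less[of q] W(1) by linarith
  have a8: "arr s 8 i = code (membership S i)" using co i by (simp add: collected_def)
  have io: "membership S i = inside \<longleftrightarrow> i \<in> S" by (simp add: membership_def inside_def outside_def)
  have s': "s' = set_reg 2 (i + 1) (if i \<in> S then set_reg 7 (k + 1) (set_arr 0 k i s) else s)"
    by (simp add: s'_def collect_body_def i a8 io k_def)
  show "safe W collect_body s"
    using le cW i by (simp add: collect_body_def a8 io k_def)
  show "reg s' 2 = reg s 2 + 1" by (simp add: s' i)
  show "collected S s'"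
  proof (cases "i \<in> S")
    case True
    have "map (arr (set_arr 0 k i s) 0) [0..<k] = map (arr s 0) [0..<k]"
      by (rule map_cong) simp_all
    then show ?thesis using True co i mp by (simp add: collected_def s')
  next
    case False
    then show ?thesis using co i mp by (simp add: collected_def s' k_def)
  qed
qed

lemma halts_collect:
  assumes "collected S s" "reg s 2 = 0"
  shows "halts W collect s (1 + (1 + cost collect_body) * n) (\<lambda>s. collected S s \<and> reg s 2 = n)"
proof -
  have "halts W collect s (1 + (1 + cost collect_body) * (n - reg s 2))
    (\<lambda>s. collected S s \<and> \<not> tval s (Less (V 2) (V 0)))"
    unfolding collect_def
  proof (rule halts_While[where I = "collected S" and f = "\<lambda>s. n - reg s 2"])
    fix s assume "collected S s" "tval s (Less (V 2) (V 0))"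
    then have "collected S s" "reg s 2 < n" by (auto simp: collected_def)
    then show "safe W collect_body s \<and> collected S (sem collect_body s) \<and>
      n - reg (sem collect_body s) 2 < n - reg s 2"
      using collect_step[of S s] by simp
  next
    fix s assume "collected S s"
    then show "test_ok W s (Less (V 2) (V 0))" using W(3) by (auto simp: collected_def)
  qed (rule assms)
  then show ?thesis
    by (rule halts_weaken) (use assms in \<open>auto simp: collected_def\<close>)
qed

end

section \<open>Composing the loops and adding up the time\<close>

lemma halts_safe_Seq:
  "safe W c s \<Longrightarrow> halts W d (sem c s) T Q \<Longrightarrow> halts W (Seq c d) s (cost c + T) Q"
  using halts_Seq[OF halts_sem[of W c s "\<lambda>s'. s' = sem c s"], of d T Q] by simp

lemma halts_Assign_Seq:
  "exp_ok W s e \<Longrightarrow> halts W d (sem (Assign x e) s) T Q \<Longrightarrow> halts W (Seq (Assign x e) d) s (1 + T) Q"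
  using halts_safe_Seq[of W "Assign x e" s d T Q] by (simp only: cost.simps safe.simps)

text \<open>The sum is nested like the \<open>Seq\<close>s of \<open>program\<close>, so that
  \<open>halts_Seq\<close> matches it term by term. The final 2 pays for storing the length and for
  the closing \<open>Skip\<close>.\<close>

definition time_bound :: "nat \<Rightarrow> nat \<Rightarrow> nat" where
  "time_bound n m = (1 + (1 + cost count_arcs_body) * m) + (1 + (1 + ((1 + (1 + cost init_tables_body) * n) + (1 +
      ((1 + (1 + cost peel_body) * (2 * n)) + (cost choose_root + ((1 + (1 + cost trace_back_body) * n) +
      (1 + ((1 + (1 + cost collect_body) * n) + 2)))))))))"

context ditree_input begin

lemma halts_program:
  "halts W program (input_state n es)
    (time_bound n (length es))
    (\<lambda>s. \<exists>S \<subseteq> {..<n}. valid E {..<n} (membership S) \<and>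
       (\<forall>S' \<subseteq> {..<n}. valid E {..<n} (membership S') \<longrightarrow> card S \<le> card S') \<and>
       output_list s = filter (\<lambda>u. u \<in> S) [0..<n])"
  (is "halts W program _ _ ?Q")
proof -
  have fin: "halts W (seqs [Assign 2 (N 0), collect, Assign 0 (V 7)]) s
      (1 + ((1 + (1 + cost collect_body) * n) + 2)) ?Q"
    if S: "S \<subseteq> {..<n}" "valid E {..<n} (membership S)"
      "\<And>S'. S' \<subseteq> {..<n} \<Longrightarrow> valid E {..<n} (membership S') \<Longrightarrow> card S \<le> card S'"
      and s: "reg s 0 = n" "reg s 7 = 0" "\<forall>u<n. arr s 8 u = code (membership S u)" for S s
    unfolding seqs_simps
  proof (rule halts_Assign_Seq)
    show "exp_ok W s (N 0)" by simp
    have "collected S (sem (Assign 2 (N 0)) s)" "reg (sem (Assign 2 (N 0)) s) 2 = 0"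
      using s by (simp_all add: collected_def)
    from halts_collect[OF this]
    show "halts W (Seq collect (Seq (Assign 0 (V 7)) Skip)) (sem (Assign 2 (N 0)) s)
      ((1 + (1 + cost collect_body) * n) + 2) ?Q"
    proof (rule halts_Seq)
      fix t assume t: "collected S t \<and> reg t 2 = n"
      then have mp: "map (arr t 0) [0..<reg t 7] = filter (\<lambda>u. u \<in> S) [0..<n]" by (simp add: collected_def)
      from arg_cong[OF mp, of length] have "reg t 7 \<le> n"
        using length_filter_le[of "\<lambda>u. u \<in> S" "[0..<n]"] by (simp only: length_map length_upt diff_zero)
      then have "safe W (Seq (Assign 0 (V 7)) Skip) t" using W(3) by simp
      moreover have "?Q (sem (Seq (Assign 0 (V 7)) Skip) t)"
        using S mp by (intro exI[of _ S]) (simp add: output_list_def)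
      ultimately show "halts W (Seq (Assign 0 (V 7)) Skip) t 2 ?Q"
        using halts_sem[of W "Seq (Assign 0 (V 7)) Skip" t ?Q] by (simp add: numeral_2_eq_2)
    qed
  qed
  show ?thesis
    unfolding program_def seqs_simps time_bound_def
  proof (rule halts_Seq[OF halts_count_arcs])
    fix s assume s: "counted s \<and> reg s 2 = length es"
    have le: "n + 1 \<le> W" "1 \<le> W" "n \<le> W" using W(1,3) by linarith+
    define t where "t = sem (Assign 13 (Plus (V 0) (N 1))) (sem (Assign 2 (N 0)) s)"
    have sf: "exp_ok W s (N 0)" "exp_ok W (sem (Assign 2 (N 0)) s) (Plus (V 0) (N 1))"
      using s le by (simp_all add: counted_def)
    have "\<forall>u. degrees (set (take (reg s 2) es)) s u" using s unfolding counted_def by blast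
    then have "degrees E s u" for u using s by (simp add: E_def)
    then have "\<forall>u. degrees E t u" by (simp add: t_def degrees_def)
    then have t: "tabled t" "reg t 2 = 0"
      unfolding tabled_def using s by (simp_all add: t_def counted_def)
    let ?rest = "Seq (Assign 2 (N 0)) (Seq peel (Seq choose_root (Seq trace_back (Seq (Assign 2 (N 0))
      (Seq collect (Seq (Assign 0 (V 7)) Skip))))))"
    let ?T4 = "(1 + (1 + cost collect_body) * n) + 2"
    let ?T3 = "(1 + (1 + cost trace_back_body) * n) + (1 + ?T4)"
    let ?T2 = "(1 + (1 + cost peel_body) * (2 * n)) + (cost choose_root + ?T3)"
    have "halts W ?rest u (1 + ?T2) ?Q" if u: "tabled u \<and> reg u 2 = n" for u
    proof (rule halts_Assign_Seq)
      have u': "sem (Assign 2 (N 0)) u = set_reg 2 0 u" by simp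
      have "\<exists>A c d. peeled A c d (sem (Assign 2 (N 0)) u)"
        unfolding u' using peeled_of_tabled u by blast
      from halts_peel[OF this]
      show "halts W (Seq peel (Seq choose_root (Seq trace_back (Seq (Assign 2 (N 0))
        (Seq collect (Seq (Assign 0 (V 7)) Skip)))))) (sem (Assign 2 (N 0)) u)
        ((1 + (1 + cost peel_body) * (2 * n)) + (cost choose_root + ((1 + (1 + cost trace_back_body) * n) +
          (1 + ?T4)))) ?Q"
      proof (rule halts_Seq)
        fix v assume "\<exists>c d. peeled {reg v 8} c d v"
        then obtain c d where pe: "peeled {reg v 8} c d v" by blast
        then have v: "reg v 0 = n" "reg v 7 \<le> n"
          "\<And>i q. arr v (choice q) i = code (c i q)" "\<And>i q. arr v (choice' q) i = code (d i q)"
          "\<forall>(x, p) \<in> set (stack v). x < n \<and> p < n"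
          and dp: "dp_inv E n {reg v 8} (\<lambda>u q. arr v (table q) u) c d (stack v)"
          by (simp_all add: peeled_def)
        let ?w = "sem choose_root v"
        note cr = choose_root_spec[OF pe refl]
        obtain q where q: "settled q" "\<And>q'. settled q' \<Longrightarrow> arr v (table q) (reg v 8) \<le> arr v (table q') (reg v 8)"
          "\<And>u. arr ?w 8 u = code (((\<lambda>_. outside)(reg v 8 := q)) u)" using cr(2) by blast
        obtain S where S: "S \<subseteq> {..<n}" "valid E {..<n} (membership S)"
          "\<And>u. u < n \<Longrightarrow> backtrack c d (stack v) ((\<lambda>_. outside)(reg v 8 := q)) u = membership S u"
          "\<And>S'. S' \<subseteq> {..<n} \<Longrightarrow> valid E {..<n} (membership S') \<Longrightarrow> card S \<le> card S'"
          using dp_inv_final[OF irr dp q(1) q(2) valid_membership_all[OF irr]] by metis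
        have st: "stack ?w = stack v" by (simp add: stack_def cr(3,4))
        have tr: "traced S c d ?w"
          unfolding traced_def st
        proof (intro conjI)
          show "\<exists>l. (\<forall>u. arr ?w 8 u = code (l u)) \<and> (\<forall>u<n. backtrack c d (stack v) l u = membership S u)"
            using q(3) S(3) by (intro exI[of _ "(\<lambda>_. outside)(reg v 8 := q)"]) blast
        qed (use v in \<open>auto simp: cr(3,4)\<close>)
        show "halts W (Seq choose_root (Seq trace_back (Seq (Assign 2 (N 0))
          (Seq collect (Seq (Assign 0 (V 7)) Skip))))) v (cost choose_root + ?T3) ?Q"
        proof (rule halts_safe_Seq[OF cr(1)], rule halts_Seq[OF halts_trace_back[OF tr]])
          fix z :: state assume z: "reg z 0 = n \<and> reg z 7 = 0 \<and> (\<forall>u<n. arr z 8 u = code (membership S u))"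
          show "halts W (Seq (Assign 2 (N 0)) (Seq collect (Seq (Assign 0 (V 7)) Skip))) z (1 + ?T4) ?Q"
            using fin[of S z] S z by simp
        qed
      qed
    qed simp
    then have "halts W (Seq init_tables ?rest) t ((1 + (1 + cost init_tables_body) * n) + (1 + ?T2)) ?Q"
      using halts_Seq[OF halts_init_tables[OF t]] by blast
    from halts_Assign_Seq[OF sf(1) halts_Assign_Seq[OF sf(2) this[unfolded t_def]]]
    show "halts W (Seq (Assign 2 (N 0)) (Seq (Assign 13 (Plus (V 0) (N 1))) (Seq init_tables ?rest))) s
      (1 + (1 + ((1 + (1 + cost init_tables_body) * n) + (1 + ?T2)))) ?Q" .
  qed
qed

end

text \<open>Since \<open>0 < n\<close>, the base is at least 2, and the exponent 6 is chosen for
  \<open>2 ^ 6 = 64\<close>. The other bounds already follow from the square.\<close>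

lemma ditree_input_digraph_of:
  assumes "distinct es" "di_tree (digraph_of n es)"
  shows "ditree_input n es ((n + length es + 1) ^ 6) (set es)"
proof -
  let ?G = "digraph_of n es"
  have G: "digraph ?G" and tree: "tree_on (arcs_ends ?G) (verts ?G)" using di_tree_tree_on[OF assms(2)] by blast+
  interpret digraph ?G by (rule G)
  have E: "arcs_ends ?G = set es" "verts ?G = {..<n}" by (auto simp: arcs_ends_conv digraph_of_def)
  have pos: "0 < n" using tree_on_nonempty[OF tree] unfolding E by (cases n) simp_all
  let ?k = "n + length es + 1"
  have k: "2 \<le> ?k" using pos by simp
  have sq: "m \<le> ?k ^ 6" if "m \<le> ?k * ?k" for m
    using that power_increasing[of 2 6 ?k] k unfolding power2_eq_square by linarith
  have "n * n \<le> ?k * ?k" "2 * (n + 1) \<le> ?k * ?k" "length es * 1 \<le> ?k * ?k"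
    using k by (intro mult_le_mono; simp)+
  then have "n * n \<le> ?k ^ 6" "2 * n + 2 \<le> ?k ^ 6" "length es \<le> ?k ^ 6" using sq by auto
  moreover have "64 \<le> ?k ^ 6" using power_mono[OF k, of 6] by simp
  ultimately show ?thesis
    using assms(1) pos tree adj_in_verts adj_not_same
    by unfold_locales (auto simp: E irrefl_def)
qed

theorem theorem4:
  shows "\<exists>(P :: com) (c :: nat) (k :: nat). \<forall>(n :: nat) (es :: (nat \<times> nat) list).
    distinct es \<and> di_tree (digraph_of n es) \<longrightarrow>
    (\<exists>t s. exec ((n + length es + 1) ^ k) P (input_state n es) t s \<and>
       t \<le> c * (n + length es) \<and>
       distinct (output_list s) \<and>
       metric_basis (digraph_of n es) (set (output_list s)) \<and>
       length (output_list s) = metric_dimension (digraph_of n es))"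
proof -
  define c where "c = cost count_arcs_body + cost init_tables_body + 2 * cost peel_body + cost choose_root +
    cost trace_back_body + cost collect_body + 20"
  show ?thesis
  proof (rule exI[of _ program], rule exI[of _ c], rule exI[of _ 6], intro allI impI)
    fix n :: nat and es :: "(nat \<times> nat) list"
    assume es: "distinct es \<and> di_tree (digraph_of n es)"
    let ?G = "digraph_of n es" and ?W = "(n + length es + 1) ^ 6"
    interpret ditree_input n es ?W "set es" using ditree_input_digraph_of es by blast
    have E: "arcs_ends ?G = set es" "verts ?G = {..<n}" by (auto simp: arcs_ends_conv digraph_of_def)
    obtain d where d: "tree_metric (set es) {..<n} d" using tree_metric_exists[OF tree irr] by blast
    have "digraph ?G" using di_tree_tree_on es by blast
    then interpret G: ditree_digraph ?G d
      by (simp add: ditree_digraph_def ditree_digraph_axioms_def E d)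
    have resolving: "resolving_set ?G S \<longleftrightarrow> S \<subseteq> {..<n} \<and> valid (set es) {..<n} (membership S)" for S
      using G.resolving_iff_valid by (simp add: E)
    obtain t s S where run: "exec ?W program (input_state n es) t s"
      and time: "t \<le> time_bound n (length es)"
      and S: "S \<subseteq> {..<n}" "valid (set es) {..<n} (membership S)"
      and least: "\<And>S'. S' \<subseteq> {..<n} \<Longrightarrow> valid (set es) {..<n} (membership S') \<Longrightarrow> card S \<le> card S'"
      and out: "output_list s = filter (\<lambda>u. u \<in> S) [0..<n]"
      using halts_program unfolding halts_def by blast
    have set_out: "set (output_list s) = S" using S(1) by (auto simp: out)
    have basis: "metric_basis ?G S" unfolding metric_basis_def resolving using S least by blast
    have dist_out: "distinct (output_list s)" by (simp add: out)
    have "metric_dimension ?G = card S"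
      unfolding metric_dimension_def
      by (rule Least_equality) (use basis in \<open>auto simp: metric_basis_def\<close>)
    moreover have "length (output_list s) = card S" using distinct_card[OF dist_out] set_out by simp
    moreover have "t \<le> c * (n + length es)"
    proof -
      have "t \<le> (12 + cost choose_root) * 1 + (1 + cost count_arcs_body) * length es +
        (5 + cost init_tables_body + 2 * cost peel_body + cost trace_back_body + cost collect_body) * n"
        using time by (simp add: time_bound_def algebra_simps)
      \<comment> \<open>A di-tree has a vertex, so the constant term is absorbed into the multiple
        of \<open>n\<close>.\<close>
      also have "\<dots> \<le> (12 + cost choose_root) * n + (1 + cost count_arcs_body) * length es +
        (5 + cost init_tables_body + 2 * cost peel_body + cost trace_back_body + cost collect_body) * n"
        using pos by (intro add_right_mono mult_le_mono2) simp
      also have "\<dots> \<le> c * (n + length es)" by (simp add: c_def algebra_simps)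
      finally show ?thesis .
    qed
    ultimately show "\<exists>t s. exec ?W program (input_state n es) t s \<and> t \<le> c * (n + length es) \<and>
       distinct (output_list s) \<and> metric_basis ?G (set (output_list s)) \<and>
       length (output_list s) = metric_dimension ?G"
      using run dist_out basis set_out by metis
  qed
qed

end
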